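(* Let ${\rm t}\in\{{\rm loc},{\rm q},{\rm qa},{\rm qc},{\rm ns}\}$. The relation $\leadsto_{\rm t}$ is a quasi-order (i.e. reflexive and transitive) on the set of all hypergraphs.
   Context: A hypergraph is a subset $E\subseteq V\times W$ with $V,W$ finite sets. $\mathcal D_V$ is the algebra of complex diagonal $V\times V$ matrices with diagonal matrix units $\epsilon_{v,v}$; $VW=V\times W$. A channel is a positive trace-preserving linear map $\mathcal E:\mathcal D_V\to\mathcal D_W$; $\mathcal E(w|v)$ is the $(w,w)$ entry of $\mathcal E(\epsilon_{v,v})$. A POVM is a finite family of positive operators on a Hilbert space summing to $I$. An NS correlation over a quadruple $(V_2,W_1,V_1,W_2)$ of finite sets is a channel $\Gamma:\mathcal D_{V_2W_1}\to\mathcal D_{V_1W_2}$ such that $\sum_{w_2}\Gamma(v_1,w_2|v_2,w_1)$ does not depend on $w_1$ and $\sum_{v_1}\Gamma(v_1,w_2|v_2,w_1)$ does not depend on $v_2$. $\Gamma$ is: qc if there are a Hilbert space $H$, a unit vector $\xi\in H$ and POVMs $(E_{v_2,v_1})_{v_1}$, $(F_{w_1,w_2})_{w_2}$ on $H$ with $E_{v_2,v_1}F_{w_1,w_2}=F_{w_1,w_2}E_{v_2,v_1}$ and $\Gamma(v_1,w_2|v_2,w_1)=\langle E_{v_2,v_1}F_{w_1,w_2}\xi,\xi\rangle$; q if moreover $H=H_V\otimes H_W$ with $H_V,H_W$ finite dimensional, $E_{v_2,v_1}=E'_{v_2,v_1}\otimes I$, $F_{w_1,w_2}=I\otimes F'_{w_1,w_2}$;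 qa if it is a limit of quantum correlations; loc if it is a convex combination of $\Phi\otimes\Psi$ with channels $\Phi:\mathcal D_{V_2}\to\mathcal D_{V_1}$, $\Psi:\mathcal D_{W_1}\to\mathcal D_{W_2}$. $\mathcal C_{\rm t}$ is the set of NS correlations of type ${\rm t}$ (ns = all). For hypergraphs $E_i\subseteq V_i\times W_i$, $i=1,2$, $E_1\leadsto_{\rm t}E_2$ means that there is $\Gamma\in\mathcal C_{\rm t}$ over $(V_2,W_1,V_1,W_2)$ such that $\Gamma(v_1,w_2|v_2,w_1)\ne0$ and $(v_1,w_1)\in E_1$ imply $(v_2,w_2)\in E_2$.
   Formalization: For t = ns the hypergraph with V and W both empty is excluded: zero channels relate it to every hypergraph in both directions, so transitivity fails through it; for the other four types all finite hypergraphs are included. *)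

theory Defs
  imports Complex_Main "HOL-Library.Nonpos_Ints" "HOL-Library.Equipollence" "HOL-Algebra.Module"
begin

section \<open>Diagonal matrices and channels\<close>

text \<open>A matrix over an index set is a function of two indices; the diagonal matrices over \<open>V\<close>
  are those vanishing off the diagonal of \<open>V\<close> (in particular outside \<open>V\<close>).\<close>

type_synonym 'a cmat = "'a \<Rightarrow> 'a \<Rightarrow> complex"

definition diag_mats :: "'a set \<Rightarrow> 'a cmat set" where
  "diag_mats V = {A. \<forall>x y. A x y \<noteq> 0 \<longrightarrow> x = y \<and> x \<in> V}"

definition diag_unit :: "'a \<Rightarrow> 'a cmat" where
  "diag_unit v = (\<lambda>x y. if x = v \<and> y = v then 1 else 0)"

definition psd_on :: "'a set \<Rightarrow> 'a cmat \<Rightarrow> bool" where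
  "psd_on V A \<longleftrightarrow> (\<forall>z. (\<Sum>x\<in>V. \<Sum>y\<in>V. cnj (z x) * A x y * z y) \<in> \<real>\<^sub>\<ge>\<^sub>0)"

definition trace_on :: "'a set \<Rightarrow> 'a cmat \<Rightarrow> complex" where
  "trace_on V A = (\<Sum>x\<in>V. A x x)"

definition kron :: "'a cmat \<Rightarrow> 'b cmat \<Rightarrow> ('a \<times> 'b) cmat" where
  "kron A B = (\<lambda>p q. A (fst p) (fst q) * B (snd p) (snd q))"

text \<open>The values of the underlying function outside \<open>diag_mats V\<close> are irrelevant.\<close>

definition channel :: "'a set \<Rightarrow> 'b set \<Rightarrow> ('a cmat \<Rightarrow> 'b cmat) \<Rightarrow> bool" where
  "channel V W \<Phi> \<longleftrightarrow>
     (\<forall>A\<in>diag_mats V. \<Phi> A \<in> diag_mats W) \<and>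
     (\<forall>A\<in>diag_mats V. \<forall>B\<in>diag_mats V. \<forall>a b.
        \<Phi> (\<lambda>x y. a * A x y + b * B x y) = (\<lambda>x y. a * \<Phi> A x y + b * \<Phi> B x y)) \<and>
     (\<forall>A\<in>diag_mats V. psd_on V A \<longrightarrow> psd_on W (\<Phi> A)) \<and>
     (\<forall>A\<in>diag_mats V. trace_on W (\<Phi> A) = trace_on V A)"

text \<open>\<open>entry \<Phi> w v\<close> is $\Phi(w|v)$.\<close>

definition entry :: "('a cmat \<Rightarrow> 'b cmat) \<Rightarrow> 'b \<Rightarrow> 'a \<Rightarrow> complex" where
  "entry \<Phi> w v = \<Phi> (diag_unit v) w w"

section \<open>Complex Hilbert spaces on carrier sets\<close>

definition complex_ring :: "complex ring" where
  "complex_ring = \<lparr>carrier = UNIV, monoid.mult = (*), one = 1, ring.zero = 0, add = (+)\<rparr>"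

text \<open>The multiplication and unit that the record \<^type>\<open>module\<close> inherits from
  rings play no role. The inner product is linear in the first argument.\<close>

record 'h ip_module = "(complex, 'h) module" +
  ip :: "'h \<Rightarrow> 'h \<Rightarrow> complex"

definition ipnorm :: "'h ip_module \<Rightarrow> 'h \<Rightarrow> real" where
  "ipnorm H x = sqrt (Re (ip H x x))"

locale hilbert_space = module complex_ring H for H :: "'h ip_module" (structure) +
  assumes ip_add: "\<lbrakk>x \<in> carrier H; y \<in> carrier H; z \<in> carrier H\<rbrakk>
      \<Longrightarrow> ip H (x \<oplus>\<^bsub>H\<^esub> y) z = ip H x z + ip H y z"
    and ip_scale: "\<lbrakk>x \<in> carrier H; z \<in> carrier H\<rbrakk> \<Longrightarrow> ip H (a \<odot>\<^bsub>H\<^esub> x) z = a * ip H x z"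
    and ip_cnj: "\<lbrakk>x \<in> carrier H; y \<in> carrier H\<rbrakk> \<Longrightarrow> ip H y x = cnj (ip H x y)"
    and ip_nonneg: "x \<in> carrier H \<Longrightarrow> ip H x x \<in> \<real>\<^sub>\<ge>\<^sub>0"
    and ip_definite: "\<lbrakk>x \<in> carrier H; ip H x x = 0\<rbrakk> \<Longrightarrow> x = \<zero>\<^bsub>H\<^esub>"
    and complete: "\<lbrakk>\<forall>n. X n \<in> carrier H;
        \<forall>e>0. \<exists>N. \<forall>m\<ge>N. \<forall>n\<ge>N. ipnorm H (X m \<ominus>\<^bsub>H\<^esub> X n) < e\<rbrakk>
      \<Longrightarrow> \<exists>x\<in>carrier H. (\<lambda>n::nat. ipnorm H (X n \<ominus>\<^bsub>H\<^esub> x)) \<longlonglongrightarrow> 0"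

definition finite_dim :: "'h ip_module \<Rightarrow> bool" where
  "finite_dim H \<longleftrightarrow> (\<exists>B. finite B \<and> B \<subseteq> carrier H \<and>
     (\<forall>x\<in>carrier H. \<exists>c. x = (\<Oplus>\<^bsub>H\<^esub>b\<in>B. c b \<odot>\<^bsub>H\<^esub> b)))"

definition bounded_op :: "'h ip_module \<Rightarrow> ('h \<Rightarrow> 'h) \<Rightarrow> bool" where
  "bounded_op H T \<longleftrightarrow>
     (\<forall>x\<in>carrier H. T x \<in> carrier H) \<and>
     (\<forall>x\<in>carrier H. \<forall>y\<in>carrier H. T (x \<oplus>\<^bsub>H\<^esub> y) = T x \<oplus>\<^bsub>H\<^esub> T y) \<and>
     (\<forall>a. \<forall>x\<in>carrier H. T (a \<odot>\<^bsub>H\<^esub> x) = a \<odot>\<^bsub>H\<^esub> T x) \<and>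
     (\<exists>C. \<forall>x\<in>carrier H. ipnorm H (T x) \<le> C * ipnorm H x)"

definition positive_op :: "'h ip_module \<Rightarrow> ('h \<Rightarrow> 'h) \<Rightarrow> bool" where
  "positive_op H T \<longleftrightarrow> bounded_op H T \<and> (\<forall>x\<in>carrier H. ip H (T x) x \<in> \<real>\<^sub>\<ge>\<^sub>0)"

definition povm :: "'h ip_module \<Rightarrow> 'i set \<Rightarrow> ('i \<Rightarrow> 'h \<Rightarrow> 'h) \<Rightarrow> bool" where
  "povm H I E \<longleftrightarrow> finite I \<and> (\<forall>i\<in>I. positive_op H (E i)) \<and>
     (\<forall>x\<in>carrier H. (\<Oplus>\<^bsub>H\<^esub>i\<in>I. E i x) = x)"

text \<open>\<open>hilbert_tensor H K L \<tau>\<close>: the space \<open>L\<close> with \<open>\<tau> x y\<close> as \<open>x \<otimes> y\<close> is the tensor product of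
  \<open>H\<close> and \<open>K\<close>. It is only used for finite dimensional \<open>H\<close> and \<open>K\<close>, where the elementary tensors
  span without completion.\<close>

definition hilbert_tensor ::
  "'h ip_module \<Rightarrow> 'h ip_module \<Rightarrow> 'h ip_module \<Rightarrow> ('h \<Rightarrow> 'h \<Rightarrow> 'h) \<Rightarrow> bool" where
  "hilbert_tensor H K L \<tau> \<longleftrightarrow>
     hilbert_space H \<and> hilbert_space K \<and> hilbert_space L \<and>
     (\<forall>x\<in>carrier H. \<forall>y\<in>carrier K. \<tau> x y \<in> carrier L) \<and>
     (\<forall>x\<in>carrier H. \<forall>x'\<in>carrier H. \<forall>y\<in>carrier K. \<tau> (x \<oplus>\<^bsub>H\<^esub> x') y = \<tau> x y \<oplus>\<^bsub>L\<^esub> \<tau> x' y) \<and>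
     (\<forall>x\<in>carrier H. \<forall>y\<in>carrier K. \<forall>y'\<in>carrier K. \<tau> x (y \<oplus>\<^bsub>K\<^esub> y') = \<tau> x y \<oplus>\<^bsub>L\<^esub> \<tau> x y') \<and>
     (\<forall>a. \<forall>x\<in>carrier H. \<forall>y\<in>carrier K.
        \<tau> (a \<odot>\<^bsub>H\<^esub> x) y = a \<odot>\<^bsub>L\<^esub> \<tau> x y \<and> \<tau> x (a \<odot>\<^bsub>K\<^esub> y) = a \<odot>\<^bsub>L\<^esub> \<tau> x y) \<and>
     (\<forall>x\<in>carrier H. \<forall>x'\<in>carrier H. \<forall>y\<in>carrier K. \<forall>y'\<in>carrier K.
        ip L (\<tau> x y) (\<tau> x' y') = ip H x x' * ip K y y') \<and>
     (\<forall>z\<in>carrier L. \<exists>(n::nat) X Y. (\<forall>i<n. X i \<in> carrier H \<and> Y i \<in> carrier K) \<and>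
        z = (\<Oplus>\<^bsub>L\<^esub>i\<in>{..<n}. \<tau> (X i) (Y i)))"

section \<open>No-signalling correlations\<close>

type_synonym ('v, 'w) corr = "('v \<times> 'w) cmat \<Rightarrow> ('v \<times> 'w) cmat"

definition ns_corr :: "'v set \<Rightarrow> 'w set \<Rightarrow> 'v set \<Rightarrow> 'w set \<Rightarrow> ('v, 'w) corr \<Rightarrow> bool" where
  "ns_corr V2 W1 V1 W2 \<Gamma> \<longleftrightarrow>
     channel (V2 \<times> W1) (V1 \<times> W2) \<Gamma> \<and>
     (\<forall>v1\<in>V1. \<forall>v2\<in>V2. \<forall>w1\<in>W1. \<forall>w1'\<in>W1.
        (\<Sum>w2\<in>W2. entry \<Gamma> (v1, w2) (v2, w1)) = (\<Sum>w2\<in>W2. entry \<Gamma> (v1, w2) (v2, w1'))) \<and>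
     (\<forall>w2\<in>W2. \<forall>w1\<in>W1. \<forall>v2\<in>V2. \<forall>v2'\<in>V2.
        (\<Sum>v1\<in>V1. entry \<Gamma> (v1, w2) (v2, w1)) = (\<Sum>v1\<in>V1. entry \<Gamma> (v1, w2) (v2', w1)))"

definition qc_model ::
  "'v set \<Rightarrow> 'w set \<Rightarrow> 'v set \<Rightarrow> 'w set \<Rightarrow> ('v, 'w) corr \<Rightarrow>
   'h ip_module \<Rightarrow> 'h \<Rightarrow> ('v \<Rightarrow> 'v \<Rightarrow> 'h \<Rightarrow> 'h) \<Rightarrow> ('w \<Rightarrow> 'w \<Rightarrow> 'h \<Rightarrow> 'h) \<Rightarrow> bool" where
  "qc_model V2 W1 V1 W2 \<Gamma> H \<xi> E F \<longleftrightarrow>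
     hilbert_space H \<and> \<xi> \<in> carrier H \<and> ipnorm H \<xi> = 1 \<and>
     (\<forall>v2\<in>V2. povm H V1 (E v2)) \<and> (\<forall>w1\<in>W1. povm H W2 (F w1)) \<and>
     (\<forall>v2\<in>V2. \<forall>v1\<in>V1. \<forall>w1\<in>W1. \<forall>w2\<in>W2. \<forall>x\<in>carrier H.
        E v2 v1 (F w1 w2 x) = F w1 w2 (E v2 v1 x)) \<and>
     (\<forall>v2\<in>V2. \<forall>v1\<in>V1. \<forall>w1\<in>W1. \<forall>w2\<in>W2.
        entry \<Gamma> (v1, w2) (v2, w1) = ip H (E v2 v1 (F w1 w2 \<xi>)) \<xi>)"

text \<open>HOL cannot quantify existentially over types, so the Hilbert spaces in the definitions of
  qc and q range over all Hilbert space structures on all subsets of a type \<open>'h\<close>, which is an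
  explicit parameter and remains arbitrary.\<close>

definition qc_corr :: "'h itself \<Rightarrow>
    'v set \<Rightarrow> 'w set \<Rightarrow> 'v set \<Rightarrow> 'w set \<Rightarrow> ('v, 'w) corr \<Rightarrow> bool" where
  "qc_corr (_ :: 'h itself) V2 W1 V1 W2 \<Gamma> \<longleftrightarrow> ns_corr V2 W1 V1 W2 \<Gamma> \<and>
     (\<exists>(H :: 'h ip_module) \<xi> E F. qc_model V2 W1 V1 W2 \<Gamma> H \<xi> E F)"

definition q_corr :: "'h itself \<Rightarrow>
    'v set \<Rightarrow> 'w set \<Rightarrow> 'v set \<Rightarrow> 'w set \<Rightarrow> ('v, 'w) corr \<Rightarrow> bool" where
  "q_corr (_ :: 'h itself) V2 W1 V1 W2 \<Gamma> \<longleftrightarrow> ns_corr V2 W1 V1 W2 \<Gamma> \<and>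
     (\<exists>(H :: 'h ip_module) \<xi> E F HV HW \<tau> E' F'.
        qc_model V2 W1 V1 W2 \<Gamma> H \<xi> E F \<and>
        hilbert_tensor HV HW H \<tau> \<and> finite_dim HV \<and> finite_dim HW \<and>
        (\<forall>v2\<in>V2. povm HV V1 (E' v2)) \<and> (\<forall>w1\<in>W1. povm HW W2 (F' w1)) \<and>
        (\<forall>v2\<in>V2. \<forall>v1\<in>V1. \<forall>x\<in>carrier HV. \<forall>y\<in>carrier HW. E v2 v1 (\<tau> x y) = \<tau> (E' v2 v1 x) y) \<and>
        (\<forall>w1\<in>W1. \<forall>w2\<in>W2. \<forall>x\<in>carrier HV. \<forall>y\<in>carrier HW. F w1 w2 (\<tau> x y) = \<tau> x (F' w1 w2 y)))"

definition qa_corr :: "'h itself \<Rightarrow>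
    'v set \<Rightarrow> 'w set \<Rightarrow> 'v set \<Rightarrow> 'w set \<Rightarrow> ('v, 'w) corr \<Rightarrow> bool" where
  "qa_corr U V2 W1 V1 W2 \<Gamma> \<longleftrightarrow> ns_corr V2 W1 V1 W2 \<Gamma> \<and>
     (\<exists>\<Gamma>s. (\<forall>n::nat. q_corr U V2 W1 V1 W2 (\<Gamma>s n)) \<and>
        (\<forall>A\<in>diag_mats (V2 \<times> W1). \<forall>x y. (\<lambda>n. \<Gamma>s n A x y) \<longlonglongrightarrow> \<Gamma> A x y))"

text \<open>The product of channels \<open>\<Phi>\<close> and \<open>\<Psi>\<close> is determined by its values \<open>\<Phi> A \<otimes> \<Psi> B\<close> on the
  elementary tensors \<open>A \<otimes> B\<close>.\<close>

definition loc_corr :: "'v set \<Rightarrow> 'w set \<Rightarrow> 'v set \<Rightarrow> 'w set \<Rightarrow> ('v, 'w) corr \<Rightarrow> bool" where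
  "loc_corr V2 W1 V1 W2 \<Gamma> \<longleftrightarrow> ns_corr V2 W1 V1 W2 \<Gamma> \<and>
     (\<exists>(n::nat) (p :: nat \<Rightarrow> real) \<Phi> \<Psi>.
        (\<forall>i<n. p i \<ge> 0 \<and> channel V2 V1 (\<Phi> i) \<and> channel W1 W2 (\<Psi> i)) \<and> (\<Sum>i<n. p i) = 1 \<and>
        (\<forall>A\<in>diag_mats V2. \<forall>B\<in>diag_mats W1.
           \<Gamma> (kron A B) = (\<lambda>x y. \<Sum>i<n. complex_of_real (p i) * kron (\<Phi> i A) (\<Psi> i B) x y)))"

datatype corr_type = Loc | Q | Qa | Qc | Ns

fun corr_of_type :: "'h itself \<Rightarrow> corr_type \<Rightarrow>
    'v set \<Rightarrow> 'w set \<Rightarrow> 'v set \<Rightarrow> 'w set \<Rightarrow> ('v, 'w) corr \<Rightarrow> bool" where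
  "corr_of_type U Loc V2 W1 V1 W2 \<Gamma> = loc_corr V2 W1 V1 W2 \<Gamma>"
| "corr_of_type U Q V2 W1 V1 W2 \<Gamma> = q_corr U V2 W1 V1 W2 \<Gamma>"
| "corr_of_type U Qa V2 W1 V1 W2 \<Gamma> = qa_corr U V2 W1 V1 W2 \<Gamma>"
| "corr_of_type U Qc V2 W1 V1 W2 \<Gamma> = qc_corr U V2 W1 V1 W2 \<Gamma>"
| "corr_of_type U Ns V2 W1 V1 W2 \<Gamma> = ns_corr V2 W1 V1 W2 \<Gamma>"

section \<open>Hypergraphs\<close>

record ('v, 'w) hypergraph =
  left :: "'v set"
  right :: "'w set"
  edges :: "('v \<times> 'w) set"

definition is_hypergraph :: "('v, 'w) hypergraph \<Rightarrow> bool" where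
  "is_hypergraph G \<longleftrightarrow> finite (left G) \<and> finite (right G) \<and> edges G \<subseteq> left G \<times> right G"

definition leads_to :: "'h itself \<Rightarrow> corr_type \<Rightarrow>
    ('v, 'w) hypergraph \<Rightarrow> ('v, 'w) hypergraph \<Rightarrow> bool" where
  "leads_to U t G1 G2 \<longleftrightarrow>
     (\<exists>\<Gamma>. corr_of_type U t (left G2) (right G1) (left G1) (right G2) \<Gamma> \<and>
        (\<forall>v1\<in>left G1. \<forall>w2\<in>right G2. \<forall>v2\<in>left G2. \<forall>w1\<in>right G1.
           entry \<Gamma> (v1, w2) (v2, w1) \<noteq> 0 \<and> (v1, w1) \<in> edges G1 \<longrightarrow> (v2, w2) \<in> edges G2))"

text \<open>Empty \<open>V\<close> and \<open>W\<close> are allowed, with one exception: for ns, the hypergraph with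
  \<open>V = W = {}\<close> is left out, since transitivity fails there. Indeed, the zero map is an NS
  correlation over \<open>({}, W\<^sub>1, V\<^sub>1, {})\<close> and over \<open>(V\<^sub>3, {}, {}, W\<^sub>3)\<close>, so this
  hypergraph is both below and above every other one, but if \<open>V\<^sub>1 = {}\<close> and \<open>V\<^sub>3, W\<^sub>1\<close>
  are nonempty there is no channel at all over \<open>(V\<^sub>3, W\<^sub>1, V\<^sub>1, W\<^sub>3)\<close>.\<close>

definition hypergraphs :: "corr_type \<Rightarrow> ('v, 'w) hypergraph set" where
  "hypergraphs t = {G. is_hypergraph G \<and> (t = Ns \<longrightarrow> left G \<noteq> {} \<or> right G \<noteq> {})}"

end

theory Submission
  imports Defs "HOL-Analysis.Infinite_Sum"
begin

text \<open>A correlation \<open>\<Gamma>\<close> witnessing \<open>E\<^sub>1 \<leadsto> E\<^sub>2\<close> and a correlation \<open>\<Delta>\<close> witnessing \<open>E\<^sub>2 \<leadsto> E\<^sub>3\<close> compose to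
  \<open>(v\<^sub>1, w\<^sub>3 | v\<^sub>3, w\<^sub>1) \<mapsto> \<Sum> \<Gamma>(v\<^sub>1, w\<^sub>2 | v\<^sub>2, w\<^sub>1) \<Delta>(v\<^sub>2, w\<^sub>3 | v\<^sub>3, w\<^sub>2)\<close>, summed over \<open>v\<^sub>2\<close> and \<open>w\<^sub>2\<close>, whose support
  condition is immediate. The composition keeps the type of the correlations: local decompositions multiply,
  and operator models of \<open>\<Gamma>\<close> and \<open>\<Delta>\<close> are put on the tensor product of the two Hilbert spaces, with the
  measurements \<open>\<Sum> E\<^sub>1(v\<^sub>2, v\<^sub>1) \<otimes> E\<^sub>2(v\<^sub>3, v\<^sub>2)\<close> and \<open>\<Sum> F\<^sub>1(w\<^sub>1, w\<^sub>2) \<otimes> F\<^sub>2(w\<^sub>2, w\<^sub>3)\<close>.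
  Through orthonormal bases the tensor product is \<open>\<ell>\<^sup>2(I \<times> J)\<close>. It fits into the type that carries the
  factors \<open>\<ell>\<^sup>2(I)\<close> and \<open>\<ell>\<^sup>2(J)\<close>: if \<open>I \<times> J\<close> is infinite, it is equipollent to \<open>I\<close> or to \<open>J\<close>, and otherwise
  \<open>\<ell>\<^sup>2(I \<times> J)\<close> has at most the cardinality of the complex numbers. Reflexivity is witnessed by the identity channel.\<close>

section \<open>Hilbert spaces\<close>

text \<open>The composition is not a composition of channels: v2 is an output of \<Delta> and an
  input of \<Gamma>, while w2 travels the other way, so neither correlation runs before the other.
  That this loop is normalised is an effect of no-signalling: the marginal of \<Gamma> on w2 does
  not depend on v2, the marginal of \<Delta> on v2 does not depend on w2, and the total mass splits
  into a product of two sums equal to 1. The argument needs some v2 and some w2, whence the care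
  with empty middle sets. On the operator side the analytic obstacle is the positivity of A
  \<otimes> B. It is a product of the commuting positive operators A \<otimes> I and I \<otimes> B,
  and such products are shown to be positive by an elementary iteration. In coordinates both factors
  act on slices of functions of two variables, so they are defined on the whole space and not
  extended from elementary tensors. The cardinality assumption on \<open>'h\<close> reflects that a
  space with a unit vector contains a complex line: over a smaller type there is no q or qc
  correlation at all, and reflexivity fails.\<close>

lemma complex_ring_simps [simp]:
  "carrier complex_ring = UNIV" "monoid.mult complex_ring = (*)" "one complex_ring = 1"
  "ring.zero complex_ring = 0" "add complex_ring = (+)"
  by (simp_all add: complex_ring_def)

lemma cring_complex_ring: "cring complex_ring"
proof (rule cringI)
  show "abelian_group complex_ring"
  proof (rule abelian_groupI)
    fix x :: complex
    show "\<exists>y\<in>carrier complex_ring. y \<oplus>\<^bsub>complex_ring\<^esub> x = \<zero>\<^bsub>complex_ring\<^esub>"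
      by (auto intro: exI[of _ "- x"])
  qed auto
  show "comm_monoid complex_ring" by (rule comm_monoidI) auto
qed (auto simp: algebra_simps)

lemma a_inv_complex_ring [simp]: "\<ominus>\<^bsub>complex_ring\<^esub> a = - a"
proof -
  interpret cring complex_ring by (rule cring_complex_ring)
  show ?thesis by (rule minus_equality) auto
qed

context hilbert_space
begin

lemma scale_closed [simp, intro]: "x \<in> carrier H \<Longrightarrow> a \<odot> x \<in> carrier H"
  using smult_closed by simp

lemma scale_add_left: "x \<in> carrier H \<Longrightarrow> (a + b) \<odot> x = a \<odot> x \<oplus> b \<odot> x"
  using smult_l_distr[of a b x] by simp

lemma scale_add_right:
  "\<lbrakk>x \<in> carrier H; y \<in> carrier H\<rbrakk> \<Longrightarrow> a \<odot> (x \<oplus> y) = a \<odot> x \<oplus> a \<odot> y"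
  using smult_r_distr[of a x y] by simp

lemma scale_scale: "x \<in> carrier H \<Longrightarrow> a \<odot> (b \<odot> x) = (a * b) \<odot> x"
  using smult_assoc1[of a b x] by simp

lemma scale_one [simp]: "x \<in> carrier H \<Longrightarrow> 1 \<odot> x = x"
  using smult_one[of x] by simp

lemma scale_0_left [simp]: "x \<in> carrier H \<Longrightarrow> 0 \<odot> x = \<zero>"
  using smult_l_null[of x] by simp

lemma scale_0_right [simp]: "a \<odot> \<zero> = \<zero>"
  using smult_r_null[of a] by simp

lemma minus_conv_scale:
  "\<lbrakk>x \<in> carrier H; y \<in> carrier H\<rbrakk> \<Longrightarrow> x \<ominus> y = x \<oplus> (- 1) \<odot> y"
  using smult_l_minus[of 1 y] by (simp add: a_minus_def)

lemma diff_closed [simp, intro]: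
  "\<lbrakk>x \<in> carrier H; y \<in> carrier H\<rbrakk> \<Longrightarrow> x \<ominus> y \<in> carrier H"
  by simp

lemma ip_add_right:
  "\<lbrakk>x \<in> carrier H; y \<in> carrier H; z \<in> carrier H\<rbrakk> \<Longrightarrow> ip H z (x \<oplus> y) = ip H z x + ip H z y"
  using ip_cnj[of "x \<oplus> y" z] ip_cnj[of x z] ip_cnj[of y z] by (simp add: ip_add)

lemma ip_scale_right:
  "\<lbrakk>x \<in> carrier H; z \<in> carrier H\<rbrakk> \<Longrightarrow> ip H z (a \<odot> x) = cnj a * ip H z x"
  using ip_cnj[of "a \<odot> x" z] ip_cnj[of x z] by (simp add: ip_scale)

lemma ip_diff:
  "\<lbrakk>x \<in> carrier H; y \<in> carrier H; z \<in> carrier H\<rbrakk> \<Longrightarrow> ip H (x \<ominus> y) z = ip H x z - ip H y z"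
  by (simp add: minus_conv_scale ip_add ip_scale)

lemma ip_diff_right:
  "\<lbrakk>x \<in> carrier H; y \<in> carrier H; z \<in> carrier H\<rbrakk> \<Longrightarrow> ip H z (x \<ominus> y) = ip H z x - ip H z y"
  by (simp add: minus_conv_scale ip_add_right ip_scale_right)

lemma ip_zero_left [simp]: "z \<in> carrier H \<Longrightarrow> ip H \<zero> z = 0"
  using ip_scale[of \<zero> z 0] by simp

lemma ip_zero_right [simp]: "z \<in> carrier H \<Longrightarrow> ip H z \<zero> = 0"
  using ip_scale_right[of \<zero> z 0] by simp

lemma ip_finsum:
  assumes "z \<in> carrier H" "f \<in> A \<rightarrow> carrier H"
  shows "ip H (\<Oplus>i\<in>A. f i) z = (\<Sum>i\<in>A. ip H (f i) z)"
  using assms(2)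
proof (induction A rule: infinite_finite_induct)
  case (insert a A)
  then have "f \<in> A \<rightarrow> carrier H" "f a \<in> carrier H" by auto
  then show ?case using insert assms(1) by (simp add: ip_add)
\<comment> \<open>For infinite A both \<open>finsum\<close> and \<open>sum\<close> default to
  zero.\<close>
qed (use assms in \<open>auto simp: finsum_def finprod_def\<close>)

lemma ip_self: "x \<in> carrier H \<Longrightarrow> ip H x x = of_real ((ipnorm H x)\<^sup>2)"
  using ip_nonneg[of x] by (simp add: ipnorm_def complex_eq_iff complex_nonneg_Reals_iff)

lemma ipnorm_sq: "x \<in> carrier H \<Longrightarrow> (ipnorm H x)\<^sup>2 = Re (ip H x x)"
  by (simp add: ip_self)

lemma ipnorm_nonneg [simp]: "x \<in> carrier H \<Longrightarrow> 0 \<le> ipnorm H x"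
  using ip_nonneg[of x] by (simp add: ipnorm_def complex_nonneg_Reals_iff)

lemma ipnorm_zero [simp]: "ipnorm H \<zero> = 0"
  by (simp add: ipnorm_def)

lemma ipnorm_eq_0D: "\<lbrakk>x \<in> carrier H; ipnorm H x = 0\<rbrakk> \<Longrightarrow> x = \<zero>"
  using ip_definite ip_self by simp

lemma ipnorm_scale: "x \<in> carrier H \<Longrightarrow> ipnorm H (a \<odot> x) = norm a * ipnorm H x"
proof -
  assume x: "x \<in> carrier H"
  have "ip H (a \<odot> x) (a \<odot> x) = (a * cnj a) * ip H x x"
    using x by (simp add: ip_scale ip_scale_right)
  then have "ip H (a \<odot> x) (a \<odot> x) = of_real ((norm a)\<^sup>2 * (ipnorm H x)\<^sup>2)"
    using x by (simp add: ip_self flip: complex_norm_square)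
  then have "Re (ip H (a \<odot> x) (a \<odot> x)) = (norm a * ipnorm H x)\<^sup>2"
    by (simp add: power_mult_distrib)
  then show ?thesis using x by (simp add: ipnorm_def[of H "a \<odot> x"])
qed

lemma Cauchy_Schwarz:
  assumes x: "x \<in> carrier H" and y: "y \<in> carrier H"
  shows "norm (ip H x y) \<le> ipnorm H x * ipnorm H y"
proof (cases "ipnorm H y = 0")
  case True
  then have "y = \<zero>" using y ipnorm_eq_0D by simp
  then show ?thesis using x by simp
next
  case False
  then have pos: "ipnorm H y > 0" using ipnorm_nonneg[OF y] by simp
  let ?N = "complex_of_real ((ipnorm H y)\<^sup>2)" and ?a = "ip H x y"
  \<comment> \<open>z is the component of x orthogonal to y, multiplied by the squared norm of y to
    avoid a division.\<close>
  define z where "z = ?N \<odot> x \<ominus> ?a \<odot> y"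
  have z: "z \<in> carrier H" using x y by (simp add: z_def)
  have yx: "ip H y x = cnj ?a" using ip_cnj[OF x y] .
  have "ip H z z = ?N * (?N * ip H x x - cnj ?a * ?a) - ?a * (?N * cnj ?a - cnj ?a * ip H y y)"
    using x y by (simp add: z_def ip_diff ip_diff_right ip_scale ip_scale_right yx algebra_simps)
  also have "\<dots> = ?N * (?N * ip H x x - ?a * cnj ?a)"
    using y by (simp add: ip_self algebra_simps)
  also have "\<dots> = of_real ((ipnorm H y)\<^sup>2 * ((ipnorm H y)\<^sup>2 * (ipnorm H x)\<^sup>2 - (norm ?a)\<^sup>2))"
    using x by (simp add: ip_self flip: complex_norm_square)
  finally have "(ipnorm H z)\<^sup>2 = (ipnorm H y)\<^sup>2 * ((ipnorm H y)\<^sup>2 * (ipnorm H x)\<^sup>2 - (norm ?a)\<^sup>2)"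
    using ipnorm_sq[OF z] by simp
  then have "0 \<le> (ipnorm H y)\<^sup>2 * ((ipnorm H y)\<^sup>2 * (ipnorm H x)\<^sup>2 - (norm ?a)\<^sup>2)"
    by (simp only: flip: \<open>(ipnorm H z)\<^sup>2 = _\<close>) simp
  then have "(norm ?a)\<^sup>2 \<le> (ipnorm H x * ipnorm H y)\<^sup>2"
    using pos by (simp add: zero_le_mult_iff power_mult_distrib mult.commute)
  then show ?thesis by (rule power2_le_imp_le) (use x y in simp)
qed

lemma ipnorm_triangle:
  assumes x: "x \<in> carrier H" and y: "y \<in> carrier H"
  shows "ipnorm H (x \<oplus> y) \<le> ipnorm H x + ipnorm H y"
proof -
  have "(ipnorm H (x \<oplus> y))\<^sup>2 = (ipnorm H x)\<^sup>2 + (ipnorm H y)\<^sup>2 + (Re (ip H x y) + Re (ip H y x))"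
    using x y by (simp add: ipnorm_sq ip_add ip_add_right)
  also have "\<dots> = (ipnorm H x)\<^sup>2 + (ipnorm H y)\<^sup>2 + 2 * Re (ip H x y)"
    using ip_cnj[OF x y] by simp
  also have "\<dots> \<le> (ipnorm H x + ipnorm H y)\<^sup>2"
    using Cauchy_Schwarz[OF x y] complex_Re_le_cmod[of "ip H x y"] by (simp add: power2_sum)
  finally show ?thesis by (rule power2_le_imp_le) (use x y in simp)
qed

lemma ipnorm_diff_commute:
  assumes x: "x \<in> carrier H" and y: "y \<in> carrier H"
  shows "ipnorm H (x \<ominus> y) = ipnorm H (y \<ominus> x)"
proof -
  have "ip H (x \<ominus> y) (x \<ominus> y) = ip H (y \<ominus> x) (y \<ominus> x)"
    using x y by (simp add: ip_diff ip_diff_right)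
  then show ?thesis by (simp add: ipnorm_def)
qed

lemma add_diff_cancel: 
  assumes x: "x \<in> carrier H" and y: "y \<in> carrier H"
  shows "(x \<ominus> y) \<oplus> y = x"
  using x y by (simp add: a_minus_def M.a_assoc M.l_neg)

lemma eq_if_diff_zero:
  assumes x: "x \<in> carrier H" and y: "y \<in> carrier H" and "x \<ominus> y = \<zero>"
  shows "x = y"
  using add_diff_cancel[OF x y] assms by simp

lemma ipnorm_diff_ge:
  assumes x: "x \<in> carrier H" and y: "y \<in> carrier H"
  shows "\<bar>ipnorm H x - ipnorm H y\<bar> \<le> ipnorm H (x \<ominus> y)"
proof -
  have d: "x \<ominus> y \<in> carrier H" "y \<ominus> x \<in> carrier H" using x y by auto
  have "ipnorm H x \<le> ipnorm H (x \<ominus> y) + ipnorm H y"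
    using ipnorm_triangle[OF d(1) y] unfolding add_diff_cancel[OF x y] .
  moreover have "ipnorm H y \<le> ipnorm H (y \<ominus> x) + ipnorm H x"
    using ipnorm_triangle[OF d(2) x] unfolding add_diff_cancel[OF y x] .
  ultimately show ?thesis unfolding ipnorm_diff_commute[OF y x] by linarith
qed

lemma finsum_closedH [simp]: "f \<in> A \<rightarrow> carrier H \<Longrightarrow> (\<Oplus>i\<in>A. f i) \<in> carrier H"
  by (rule M.finsum_closed)

end

section \<open>Bounded and positive operators\<close>

lemma bounded_opD:
  assumes "bounded_op H T"
  shows "x \<in> carrier H \<Longrightarrow> T x \<in> carrier H"
    and "\<lbrakk>x \<in> carrier H; y \<in> carrier H\<rbrakk> \<Longrightarrow> T (x \<oplus>\<^bsub>H\<^esub> y) = T x \<oplus>\<^bsub>H\<^esub> T y"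
    and "x \<in> carrier H \<Longrightarrow> T (a \<odot>\<^bsub>H\<^esub> x) = a \<odot>\<^bsub>H\<^esub> T x"
  using assms unfolding bounded_op_def by blast+

context hilbert_space
begin

text \<open>The constant in \<open>bounded_op\<close> may be zero, and even negative on the zero
  space; a positive one is needed to chain bounds and to rescale an operator.\<close>

lemma bounded_op_bound:
  assumes "bounded_op H T"
  obtains C where "C > 0" "\<And>x. x \<in> carrier H \<Longrightarrow> ipnorm H (T x) \<le> C * ipnorm H x"
proof -
  obtain C where C: "\<And>x. x \<in> carrier H \<Longrightarrow> ipnorm H (T x) \<le> C * ipnorm H x"
    using assms unfolding bounded_op_def by blast
  have "ipnorm H (T x) \<le> max 1 C * ipnorm H x" if "x \<in> carrier H" for x
    using C[OF that] mult_right_mono[OF max.cobounded2[of C 1] ipnorm_nonneg[OF that]]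
    by linarith
  then show thesis using that[of "max 1 C"] by simp
qed

lemma bounded_op_diff:
  assumes "bounded_op H T" "x \<in> carrier H" "y \<in> carrier H"
  shows "T (x \<ominus> y) = T x \<ominus> T y"
  using assms by (simp add: minus_conv_scale bounded_opD)

lemma bounded_op_zero:
  assumes "bounded_op H T"
  shows "T \<zero> = \<zero>"
  using bounded_opD(3)[OF assms, of \<zero> 0] bounded_opD(1)[OF assms, of \<zero>] by simp

lemma bounded_op_finsum:
  assumes "bounded_op H T" "f \<in> A \<rightarrow> carrier H"
  shows "T (\<Oplus>i\<in>A. f i) = (\<Oplus>i\<in>A. T (f i))"
  using assms(2)
proof (induction A rule: infinite_finite_induct)
  case (insert a A)
  then have f: "f \<in> A \<rightarrow> carrier H" "f a \<in> carrier H" by auto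
  then have "(\<lambda>i. T (f i)) \<in> A \<rightarrow> carrier H" using bounded_opD(1)[OF assms(1)] by auto
  then show ?case using insert f by (simp add: bounded_opD[OF assms(1)])
qed (auto simp: finsum_def finprod_def bounded_op_zero[OF assms(1), simplified])

lemma bounded_op_zero_op: "bounded_op H (\<lambda>x. \<zero>)"
  unfolding bounded_op_def by (auto intro!: exI[of _ 0])

lemma bounded_op_add:
  assumes "bounded_op H S" "bounded_op H T"
  shows "bounded_op H (\<lambda>x. S x \<oplus> T x)"
proof -
  note S = bounded_opD[OF assms(1)] and T = bounded_opD[OF assms(2)]
  obtain C where C: "\<And>x. x \<in> carrier H \<Longrightarrow> ipnorm H (S x) \<le> C * ipnorm H x"
    using bounded_op_bound[OF assms(1)] by metis
  obtain D where D: "\<And>x. x \<in> carrier H \<Longrightarrow> ipnorm H (T x) \<le> D * ipnorm H x"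
    using bounded_op_bound[OF assms(2)] by metis
  have "ipnorm H (S x \<oplus> T x) \<le> (C + D) * ipnorm H x" if "x \<in> carrier H" for x
    using C[OF that] D[OF that] ipnorm_triangle[of "S x" "T x"] S(1)[OF that] T(1)[OF that]
    by (simp add: algebra_simps)
  then show ?thesis
    unfolding bounded_op_def by (auto simp: S T scale_add_right M.a_ac)
qed

lemma bounded_op_compose:
  assumes "bounded_op H S" "bounded_op H T"
  shows "bounded_op H (\<lambda>x. S (T x))"
proof -
  note S = bounded_opD[OF assms(1)] and T = bounded_opD[OF assms(2)]
  obtain C where C: "C > 0" "\<And>x. x \<in> carrier H \<Longrightarrow> ipnorm H (S x) \<le> C * ipnorm H x"
    using bounded_op_bound[OF assms(1)] by metis
  obtain D where D: "\<And>x. x \<in> carrier H \<Longrightarrow> ipnorm H (T x) \<le> D * ipnorm H x"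
    using bounded_op_bound[OF assms(2)] by metis
  have "ipnorm H (S (T x)) \<le> (C * D) * ipnorm H x" if "x \<in> carrier H" for x
    using order_trans[OF C(2)[OF T(1)[OF that]] mult_left_mono[OF D[OF that]]] C(1)
    by (simp add: mult.assoc)
  then show ?thesis
    unfolding bounded_op_def by (auto simp: S T)
qed

lemma bounded_op_scale:
  assumes "bounded_op H T"
  shows "bounded_op H (\<lambda>x. a \<odot> T x)"
proof -
  note T = bounded_opD[OF assms(1)]
  obtain D where D: "\<And>x. x \<in> carrier H \<Longrightarrow> ipnorm H (T x) \<le> D * ipnorm H x"
    using bounded_op_bound[OF assms(1)] by metis
  have "ipnorm H (a \<odot> T x) \<le> (norm a * D) * ipnorm H x" if "x \<in> carrier H" for x
    using mult_left_mono[OF D[OF that], of "norm a"] T(1)[OF that] by (simp add: ipnorm_scale)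
  then show ?thesis
    unfolding bounded_op_def by (auto simp: T scale_add_right scale_scale mult.commute[of a] intro!: exI[of _ "norm a * D"])
qed

lemma positive_op_zero: "positive_op H (\<lambda>x. \<zero>)"
  using bounded_op_zero_op by (simp add: positive_op_def)

lemma positive_op_add:
  assumes "positive_op H S" "positive_op H T"
  shows "positive_op H (\<lambda>x. S x \<oplus> T x)"
  using assms bounded_op_add unfolding positive_op_def
  by (auto simp: bounded_opD ip_add complex_nonneg_Reals_iff)

lemma bounded_op_cong:
  assumes "bounded_op H S" "\<And>x. x \<in> carrier H \<Longrightarrow> T x = S x"
  shows "bounded_op H T"
  using assms unfolding bounded_op_def by auto

lemma positive_op_cong:
  assumes "positive_op H S" "\<And>x. x \<in> carrier H \<Longrightarrow> T x = S x"
  shows "positive_op H T"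
  using assms bounded_op_cong unfolding positive_op_def by auto

lemma positive_op_finsum:
  assumes "finite A" "\<And>i. i \<in> A \<Longrightarrow> positive_op H (T i)"
  shows "positive_op H (\<lambda>x. \<Oplus>i\<in>A. T i x)"
  using assms
proof (induction A rule: finite_induct)
  case empty
  then show ?case using positive_op_zero by simp
next
  case (insert a A)
  have *: "T i x \<in> carrier H" if "i \<in> insert a A" "x \<in> carrier H" for i x
    using insert.prems[OF that(1)] bounded_opD(1)[OF _ that(2)] by (simp add: positive_op_def)
  have "positive_op H (\<lambda>x. T a x \<oplus> (\<Oplus>i\<in>A. T i x))"
    using insert by (intro positive_op_add) auto
  then show ?case
  proof (rule positive_op_cong)
    fix x assume "x \<in> carrier H"
    then have "(\<lambda>i. T i x) \<in> A \<rightarrow> carrier H" "T a x \<in> carrier H" using * by auto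
    then show "(\<Oplus>i\<in>insert a A. T i x) = T a x \<oplus> (\<Oplus>i\<in>A. T i x)"
      using insert.hyps by simp
  qed
qed

text \<open>Polarisation of a real-valued quadratic form: the vector x + y compares the imaginary
  parts, the vector x + \<i> y the real parts.\<close>

lemma positive_op_symmetric:
  assumes T: "positive_op H T" and x: "x \<in> carrier H" and y: "y \<in> carrier H"
  shows "ip H (T x) y = ip H x (T y)"
proof -
  have b: "bounded_op H T" using T by (simp add: positive_op_def)
  note bT = bounded_opD[OF b]
  have im: "Im (ip H (T z) z) = 0" if "z \<in> carrier H" for z
    using T that by (simp add: positive_op_def complex_nonneg_Reals_iff)
  have 1: "Im (ip H (T x) y) + Im (ip H (T y) x) = 0"
    using im[of "x \<oplus> y"] im[of x] im[of y] x y by (simp add: bT ip_add ip_add_right)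
  have 2: "Re (ip H (T x) y) = Re (ip H (T y) x)"
    using im[of "x \<oplus> \<i> \<odot> y"] im[of x] im[of "\<i> \<odot> y"] x y
    by (simp add: bT ip_add ip_add_right ip_scale ip_scale_right)
  show ?thesis
    using 1 2 ip_cnj[of "T y" x] x y bT(1) by (simp add: complex_eq_iff)
qed

end

section \<open>Products of commuting positive operators\<close>

context hilbert_space
begin

lemma positive_op_compose_commute:
  assumes S: "positive_op H S" and T: "positive_op H T"
    and comm: "\<And>x. x \<in> carrier H \<Longrightarrow> S (T x) = T (S x)"
  shows "positive_op H (\<lambda>x. S (T x))"
proof -
  have bS: "bounded_op H S" and bT: "bounded_op H T" using S T by (auto simp: positive_op_def)
  obtain C where C: "C > 0" "\<And>x. x \<in> carrier H \<Longrightarrow> ipnorm H (T x) \<le> C * ipnorm H x"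
    using bounded_op_bound[OF bT] by metis
  txt \<open>After scaling to \<open>0 \<le> T \<le> 1\<close>, the operators \<open>R 0 = T\<close>, \<open>R (n + 1) = R n - (R n)\<^sup>2\<close> satisfy
    \<open>0 \<le> R n \<le> 1\<close>, \<open>S R n - S R (n + 1) = R n S R n \<ge> 0\<close> and \<open>R n \<longlongrightarrow> 0\<close> pointwise, so that
    \<open>S T \<ge> lim S R n = 0\<close>. This replaces the use of a square root of \<open>T\<close>.\<close>
  define R where "R n = ((\<lambda>P x. P x \<ominus> P (P x)) ^^ n) (\<lambda>x. of_real (1 / C) \<odot> T x)" for n
  have R0: "R 0 x = of_real (1 / C) \<odot> T x" for x by (simp add: R_def)
  have RS: "R (Suc n) x = R n x \<ominus> R n (R n x)" for n x by (simp add: R_def)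
  have inv: "positive_op H (R n) \<and> (\<forall>x\<in>carrier H. S (R n x) = R n (S x)) \<and>
      (\<forall>x\<in>carrier H. Re (ip H (R n x) x) \<le> Re (ip H x x))" for n
  proof (induction n)
    case 0
    have "bounded_op H (R 0)"
      by (rule bounded_op_cong[OF bounded_op_scale[OF bT]]) (rule R0)
    moreover have "ip H (R 0 x) x \<in> \<real>\<^sub>\<ge>\<^sub>0" if "x \<in> carrier H" for x
      using T that C(1) bounded_opD(1)[OF bT that]
      by (simp add: R0 ip_scale positive_op_def complex_nonneg_Reals_iff)
    moreover have "S (R 0 x) = R 0 (S x)" if "x \<in> carrier H" for x
      using that bounded_opD[OF bS] bounded_opD[OF bT] comm by (simp add: R0)
    moreover have "Re (ip H (R 0 x) x) \<le> Re (ip H x x)" if x: "x \<in> carrier H" for x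
    proof -
      have "Re (ip H (T x) x) \<le> ipnorm H (T x) * ipnorm H x"
        using Cauchy_Schwarz[OF bounded_opD(1)[OF bT x] x] complex_Re_le_cmod[of "ip H (T x) x"]
        by linarith
      also have "\<dots> \<le> C * ipnorm H x * ipnorm H x"
        using C(2)[OF x] x by (intro mult_right_mono) auto
      finally show ?thesis using C(1) x bounded_opD(1)[OF bT x]
        by (simp add: R0 ip_scale ip_self field_simps power2_eq_square)
    qed
    ultimately show ?case by (auto simp: positive_op_def)
  next
    case (Suc n)
    let ?P = "R n"
    have P: "positive_op H ?P" using Suc.IH by simp
    then have bP: "bounded_op H ?P" by (simp add: positive_op_def)
    note lP = bounded_opD[OF bP]
    note sym = positive_op_symmetric[OF P]
    have le1: "Re (ip H (?P x) x) \<le> Re (ip H x x)" if "x \<in> carrier H" for x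
      using conjunct2[OF conjunct2[OF Suc.IH]] that by blast
    have c: "S (?P z) = ?P (S z)" if "z \<in> carrier H" for z
      using conjunct1[OF conjunct2[OF Suc.IH]] that by blast
    have pos: "Im (ip H (?P x) x) = 0" "0 \<le> Re (ip H (?P x) x)" if "x \<in> carrier H" for x
      using P that by (simp_all add: positive_op_def complex_nonneg_Reals_iff)
    have "bounded_op H (\<lambda>x. ?P x \<oplus> (- 1) \<odot> ?P (?P x))"
      by (rule bounded_op_add[OF bP bounded_op_scale[OF bounded_op_compose[OF bP bP]]])
    then have b: "bounded_op H (R (Suc n))"
      by (rule bounded_op_cong) (simp only: RS minus_conv_scale lP(1))
    have "ip H (R (Suc n) x) x \<in> \<real>\<^sub>\<ge>\<^sub>0 \<and> Re (ip H (R (Suc n) x) x) \<le> Re (ip H x x)"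
      if x: "x \<in> carrier H" for x
    proof -
      have Px: "?P x \<in> carrier H" and PPx: "?P (?P x) \<in> carrier H" using x lP(1) by auto
      have 1: "ip H (R (Suc n) x) x = ip H (?P x) x - ip H (?P x) (?P x)"
        using sym[OF Px x] x Px PPx by (simp add: RS ip_diff)
      \<comment> \<open>With P = R n, positivity of P - P P comes from writing it as (1 - P) P (1 -
        P) + P (1 - P) P. The first summand is the form of P at x - P x, the second uses P \<le> 1
        at the vector P x.\<close>
      have y: "x \<ominus> ?P x \<in> carrier H" using x Px by simp
      have "ip H (?P (x \<ominus> ?P x)) (x \<ominus> ?P x) = ip H (?P x) x - ip H (?P x) (?P x)
          - ip H (?P (?P x)) x + ip H (?P (?P x)) (?P x)"
        using x Px PPx by (simp add: bounded_op_diff[OF bP] ip_diff ip_diff_right)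
      then have "0 \<le> Re (ip H (?P x) x) - 2 * Re (ip H (?P x) (?P x)) + Re (ip H (?P (?P x)) (?P x))"
        using pos(2)[OF y] sym[OF Px x] by simp
      moreover have "Re (ip H (?P (?P x)) (?P x)) \<le> Re (ip H (?P x) (?P x))"
        using le1[OF Px] .
      moreover have "Re (ip H (?P x) x) \<le> Re (ip H x x)" using le1[OF x] .
      moreover have "Im (ip H (?P x) (?P x)) = 0" "0 \<le> Re (ip H (?P x) (?P x))"
        using ip_nonneg[OF Px] by (auto simp: complex_nonneg_Reals_iff)
      ultimately show ?thesis using pos(1)[OF x]
        unfolding 1 complex_nonneg_Reals_iff by simp
    qed
    moreover have "S (R (Suc n) x) = R (Suc n) (S x)" if x: "x \<in> carrier H" for x
      using x lP(1) bounded_opD(1)[OF bS] by (simp add: RS bounded_op_diff[OF bS] c)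
    ultimately show ?case using b by (auto simp: positive_op_def)
  qed
  have Rcl: "R n x \<in> carrier H" if "x \<in> carrier H" for n x
    using inv[of n] that by (auto simp: positive_op_def bounded_op_def)
  have nonneg: "0 \<le> Re (ip H (S (R 0 x)) x)" if x: "x \<in> carrier H" for x
  proof -
    \<comment> \<open>Telescoping identity for any bounded A that commutes with \<open>R n\<close>.
      With A the identity it bounds the sum of the squared norms of \<open>R n x\<close>; with A = S
      it makes the forms of S after \<open>R n\<close> decrease.\<close>
    have step: "ip H (A (R n x)) x - ip H (A (R (Suc n) x)) x = ip H (A (R n x)) (R n x)"
      if A: "bounded_op H A" "\<And>x. x \<in> carrier H \<Longrightarrow> A (R n x) = R n (A x)" for A n
    proof -
      have cl: "R n x \<in> carrier H" "R n (R n x) \<in> carrier H" "A (R n x) \<in> carrier H"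
        "A (R n (R n x)) \<in> carrier H"
        using Rcl x bounded_opD(1)[OF A(1)] by auto
      have "ip H (A (R (Suc n) x)) x = ip H (A (R n x)) x - ip H (R n (A (R n x))) x"
        using cl x A(2)[of "R n x"] by (simp add: RS bounded_op_diff[OF A(1)] ip_diff)
      then show ?thesis
        using positive_op_symmetric[of "R n" "A (R n x)" x] inv[of n] cl x by simp
    qed
    have "bounded_op H (\<lambda>x. x)" by (auto simp: bounded_op_def intro!: exI[of _ 1])
    from step[OF this] have step1:
      "Re (ip H (R n x) x) - Re (ip H (R (Suc n) x) x) = (ipnorm H (R n x))\<^sup>2" for n
      using ipnorm_sq[OF Rcl[OF x, of n]] by (metis minus_complex.simps(1))
    have "Re (ip H (R n x) x) \<ge> 0" for n
      using inv[of n] x by (auto simp: positive_op_def complex_nonneg_Reals_iff)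
    moreover have "(\<Sum>k<n. (ipnorm H (R k x))\<^sup>2) = Re (ip H (R 0 x) x) - Re (ip H (R n x) x)" for n
      by (induction n) (simp_all flip: step1)
    ultimately have le: "(\<Sum>k<n. (ipnorm H (R k x))\<^sup>2) \<le> Re (ip H (R 0 x) x)" for n
      by (simp add: diff_le_eq)
    \<comment> \<open>The telescoped sums stay below the first term, so the squared norms are
      summable and \<open>R n x\<close> tends to zero.\<close>
    have "summable (\<lambda>k. (ipnorm H (R k x))\<^sup>2)"
      using le[of "Suc _"]
      by (intro bounded_imp_summable[where B = "Re (ip H (R 0 x) x)"])
        (simp_all only: lessThan_Suc_atMost zero_le_power2)
    then have "(\<lambda>k. sqrt ((ipnorm H (R k x))\<^sup>2)) \<longlonglongrightarrow> sqrt 0"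
      by (intro tendsto_real_sqrt summable_LIMSEQ_zero)
    then have lim0: "(\<lambda>k. ipnorm H (R k x)) \<longlonglongrightarrow> 0"
      using Rcl[OF x] by simp
    have Sx: "S x \<in> carrier H" using bounded_opD(1)[OF bS x] .
    have "(\<lambda>k. Re (ip H (S (R k x)) x)) \<longlonglongrightarrow> 0"
    proof (rule tendsto_0_le[OF lim0, of _ "ipnorm H (S x)"])
      have "norm (Re (ip H (S (R k x)) x)) \<le> norm (ipnorm H (R k x)) * ipnorm H (S x)" for k
        using Cauchy_Schwarz[OF Rcl[OF x, of k] Sx] positive_op_symmetric[OF S Rcl[OF x, of k] x]
          abs_Re_le_cmod[of "ip H (S (R k x)) x"] Rcl[OF x, of k] by simp
      then show "\<forall>\<^sub>F k in sequentially. norm (Re (ip H (S (R k x)) x)) \<le> norm (ipnorm H (R k x)) * ipnorm H (S x)"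
        by simp
    qed
    moreover have "decseq (\<lambda>k. Re (ip H (S (R k x)) x))"
    proof (rule decseq_SucI)
      fix n
      have "Re (ip H (S (R n x)) (R n x)) \<ge> 0"
        using S Rcl[OF x, of n] by (auto simp: positive_op_def complex_nonneg_Reals_iff)
      moreover have "Re (ip H (S (R n x)) x) - Re (ip H (S (R (Suc n) x)) x) = Re (ip H (S (R n x)) (R n x))"
        using step[OF bS, of n] inv[of n] by (metis minus_complex.simps(1))
      ultimately show "Re (ip H (S (R (Suc n) x)) x) \<le> Re (ip H (S (R n x)) x)" by linarith
    qed
    \<comment> \<open>A decreasing sequence with limit zero has a nonnegative first term.\<close>
    ultimately show ?thesis using decseq_ge[of _ 0 0] by blast
  qed
  have "ip H (S (T x)) x \<in> \<real>\<^sub>\<ge>\<^sub>0" if x: "x \<in> carrier H" for x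
  proof -
    have cl: "T x \<in> carrier H" "S x \<in> carrier H" "S (T x) \<in> carrier H"
      using bounded_opD(1)[OF bS] bounded_opD(1)[OF bT] x by auto
    have "ip H (S (T x)) x = ip H (T x) (S x)" using positive_op_symmetric[OF S cl(1) x] .
    also have "\<dots> = ip H x (S (T x))" using positive_op_symmetric[OF T x cl(2)] comm[OF x] by simp
    also have "\<dots> = cnj (ip H (S (T x)) x)" using ip_cnj[OF cl(3) x] .
    finally have "Im (ip H (S (T x)) x) = 0" by (simp add: complex_eq_iff)
    moreover have "0 \<le> Re (ip H (S (T x)) x)"
      using nonneg[OF x] C(1) cl x by (simp add: R0 bounded_opD[OF bS] ip_scale zero_le_divide_iff)
    ultimately show ?thesis by (simp add: complex_nonneg_Reals_iff)
  qed
  then show ?thesis using bounded_op_compose[OF bS bT] by (simp add: positive_op_def)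
qed

end

text \<open>Stated for bare modules, because \<open>push\<close> and \<open>ell2\<close> need it
  before they are known to be Hilbert spaces.\<close>

lemma module_minus_conv:
  assumes "module complex_ring M" "x \<in> carrier M" "y \<in> carrier M"
  shows "x \<ominus>\<^bsub>M\<^esub> y = x \<oplus>\<^bsub>M\<^esub> (- 1) \<odot>\<^bsub>M\<^esub> y"
proof -
  interpret module complex_ring M by fact
  show ?thesis using smult_l_minus[of 1 y] assms(3) smult_one[of y] by (simp add: a_minus_def)
qed

section \<open>Unitary equivalence and transport of structure\<close>

definition unitary :: "'h ip_module \<Rightarrow> 'k ip_module \<Rightarrow> ('h \<Rightarrow> 'k) \<Rightarrow> bool" where
  "unitary H K U \<longleftrightarrow> bij_betw U (carrier H) (carrier K) \<and>
     (\<forall>x\<in>carrier H. \<forall>y\<in>carrier H. U (x \<oplus>\<^bsub>H\<^esub> y) = U x \<oplus>\<^bsub>K\<^esub> U y) \<and>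
     (\<forall>a. \<forall>x\<in>carrier H. U (a \<odot>\<^bsub>H\<^esub> x) = a \<odot>\<^bsub>K\<^esub> U x) \<and>
     (\<forall>x\<in>carrier H. \<forall>y\<in>carrier H. ip K (U x) (U y) = ip H x y)"

locale hilbert_iso = H: hilbert_space H + K: hilbert_space K
  for H :: "'h ip_module" and K :: "'k ip_module" +
  fixes U :: "'h \<Rightarrow> 'k"
  assumes unitary: "unitary H K U"
begin

abbreviation V :: "'k \<Rightarrow> 'h" where "V \<equiv> inv_into (carrier H) U"

definition conj_op :: "('h \<Rightarrow> 'h) \<Rightarrow> 'k \<Rightarrow> 'k" where
  "conj_op T y = U (T (V y))"

lemma bij: "bij_betw U (carrier H) (carrier K)"
  using unitary by (simp add: unitary_def)

lemma U_closed [simp]: "x \<in> carrier H \<Longrightarrow> U x \<in> carrier K"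
  using bij by (auto simp: bij_betw_def)

lemma V_closed [simp]: "y \<in> carrier K \<Longrightarrow> V y \<in> carrier H"
  using bij by (metis bij_betw_def inv_into_into)

lemma U_V [simp]: "y \<in> carrier K \<Longrightarrow> U (V y) = y"
  using bij by (metis bij_betw_def f_inv_into_f)

lemma V_U [simp]: "x \<in> carrier H \<Longrightarrow> V (U x) = x"
  using bij by (metis bij_betw_def inv_into_f_f)

lemma U_add: "\<lbrakk>x \<in> carrier H; y \<in> carrier H\<rbrakk> \<Longrightarrow> U (x \<oplus>\<^bsub>H\<^esub> y) = U x \<oplus>\<^bsub>K\<^esub> U y"
  using unitary by (simp add: unitary_def)

lemma U_scale: "x \<in> carrier H \<Longrightarrow> U (a \<odot>\<^bsub>H\<^esub> x) = a \<odot>\<^bsub>K\<^esub> U x"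
  using unitary by (simp add: unitary_def)

lemma U_ip: "\<lbrakk>x \<in> carrier H; y \<in> carrier H\<rbrakk> \<Longrightarrow> ip K (U x) (U y) = ip H x y"
  using unitary by (simp add: unitary_def)

lemma U_ipnorm: "x \<in> carrier H \<Longrightarrow> ipnorm K (U x) = ipnorm H x"
  by (simp add: ipnorm_def U_ip)

lemma V_add: "\<lbrakk>x \<in> carrier K; y \<in> carrier K\<rbrakk> \<Longrightarrow> V (x \<oplus>\<^bsub>K\<^esub> y) = V x \<oplus>\<^bsub>H\<^esub> V y"
  using U_add[of "V x" "V y"] V_U[of "V x \<oplus>\<^bsub>H\<^esub> V y"] by simp

lemma V_scale: "x \<in> carrier K \<Longrightarrow> V (a \<odot>\<^bsub>K\<^esub> x) = a \<odot>\<^bsub>H\<^esub> V x"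
  using U_scale[of "V x" a] V_U[of "a \<odot>\<^bsub>H\<^esub> V x"] by simp

lemma V_ip: "\<lbrakk>x \<in> carrier K; y \<in> carrier K\<rbrakk> \<Longrightarrow> ip H (V x) (V y) = ip K x y"
  using U_ip[of "V x" "V y"] by simp

lemma V_ipnorm: "x \<in> carrier K \<Longrightarrow> ipnorm H (V x) = ipnorm K x"
  by (simp add: ipnorm_def V_ip)

lemma U_zero: "U \<zero>\<^bsub>H\<^esub> = \<zero>\<^bsub>K\<^esub>"
  using U_scale[of "\<zero>\<^bsub>H\<^esub>" 0] by simp

lemma U_finsum:
  "f \<in> A \<rightarrow> carrier H \<Longrightarrow> U (\<Oplus>\<^bsub>H\<^esub>i\<in>A. f i) = (\<Oplus>\<^bsub>K\<^esub>i\<in>A. U (f i))"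
proof (induction A rule: infinite_finite_induct)
  case (insert a A)
  then have f: "f \<in> A \<rightarrow> carrier H" "f a \<in> carrier H" by auto
  then have "(\<lambda>i. U (f i)) \<in> A \<rightarrow> carrier K" by (auto simp: Pi_iff)
  then show ?case using insert f by (simp add: U_add)
next
  case (infinite A)
  then show ?case using U_zero by (simp add: finsum_def finprod_def)
qed (simp add: U_zero)

lemma bounded_op_conj:
  assumes "bounded_op H T"
  shows "bounded_op K (conj_op T)"
proof -
  note T = bounded_opD[OF assms]
  obtain C where C: "\<And>x. x \<in> carrier H \<Longrightarrow> ipnorm H (T x) \<le> C * ipnorm H x"
    using assms unfolding bounded_op_def by blast
  have "\<forall>y\<in>carrier K. ipnorm K (conj_op T y) \<le> C * ipnorm K y"
  proof
    fix y assume y: "y \<in> carrier K"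
    show "ipnorm K (conj_op T y) \<le> C * ipnorm K y"
      using C[OF V_closed[OF y]] y by (simp add: conj_op_def T U_ipnorm V_ipnorm)
  qed
  moreover have "conj_op T y \<in> carrier K" if "y \<in> carrier K" for y
    using that by (simp add: conj_op_def T)
  moreover have "conj_op T (x \<oplus>\<^bsub>K\<^esub> y) = conj_op T x \<oplus>\<^bsub>K\<^esub> conj_op T y"
    if "x \<in> carrier K" "y \<in> carrier K" for x y
    using that by (simp add: conj_op_def T V_add U_add)
  moreover have "conj_op T (a \<odot>\<^bsub>K\<^esub> x) = a \<odot>\<^bsub>K\<^esub> conj_op T x" if "x \<in> carrier K" for a x
    using that by (simp add: conj_op_def T V_scale U_scale)
  ultimately show ?thesis unfolding bounded_op_def by blast
qed

lemma positive_op_conj: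
  assumes "positive_op H T"
  shows "positive_op K (conj_op T)"
proof -
  have b: "bounded_op H T" using assms by (simp add: positive_op_def)
  have "ip K (conj_op T y) y \<in> \<real>\<^sub>\<ge>\<^sub>0" if y: "y \<in> carrier K" for y
  proof -
    have "ip K (conj_op T y) (U (V y)) = ip H (T (V y)) (V y)"
      unfolding conj_op_def using y bounded_opD(1)[OF b] by (intro U_ip) auto
    then show ?thesis using y assms by (simp add: positive_op_def)
  qed
  then show ?thesis using bounded_op_conj[OF b] by (simp add: positive_op_def)
qed

lemma povm_conj:
  assumes "povm H I E"
  shows "povm K I (\<lambda>i. conj_op (E i))"
proof -
  have E: "finite I" "\<And>i. i \<in> I \<Longrightarrow> positive_op H (E i)"
    "\<And>x. x \<in> carrier H \<Longrightarrow> (\<Oplus>\<^bsub>H\<^esub>i\<in>I. E i x) = x"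
    using assms by (auto simp: povm_def)
  have cl: "(\<lambda>i. E i x) \<in> I \<rightarrow> carrier H" if "x \<in> carrier H" for x
    using E(2) that by (auto simp: positive_op_def bounded_op_def)
  have "(\<Oplus>\<^bsub>K\<^esub>i\<in>I. conj_op (E i) y) = y" if y: "y \<in> carrier K" for y
    using U_finsum[OF cl[OF V_closed[OF y]]] E(3)[OF V_closed[OF y]] y by (simp add: conj_op_def)
  then show ?thesis using E positive_op_conj by (simp add: povm_def)
qed

lemma povm_closed: "\<lbrakk>povm H I E; i \<in> I; x \<in> carrier H\<rbrakk> \<Longrightarrow> E i x \<in> carrier H"
  by (auto simp: povm_def positive_op_def bounded_op_def)

text \<open>Entries are inner products, so they survive the simultaneous conjugation of operators
  and unit vector. This is what moves models to sequence spaces and back.\<close>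

lemma qc_model_conj:
  assumes "qc_model V2 W1 V1 W2 \<Gamma> H \<xi> E F"
  shows "qc_model V2 W1 V1 W2 \<Gamma> K (U \<xi>) (\<lambda>v2 v1. conj_op (E v2 v1)) (\<lambda>w1 w2. conj_op (F w1 w2))"
proof -
  have \<xi>: "\<xi> \<in> carrier H" and E: "\<And>v2. v2 \<in> V2 \<Longrightarrow> povm H V1 (E v2)"
    and F: "\<And>w1. w1 \<in> W1 \<Longrightarrow> povm H W2 (F w1)"
    using assms by (auto simp: qc_model_def)
  note cl = povm_closed[OF E] povm_closed[OF F]
  show ?thesis
    using assms \<xi> cl by (auto simp: qc_model_def K.hilbert_space_axioms povm_conj U_ipnorm U_ip conj_op_def)
qed

end

text \<open>Transport of structure along g. The only demand on the target type is an injection from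
  the carrier, so that realising a tensor product inside \<open>'h\<close> becomes a question about
  cardinalities.\<close>

definition push :: "'h ip_module \<Rightarrow> ('h \<Rightarrow> 'k) \<Rightarrow> 'k ip_module" where
  "push H g = (let h = inv_into (carrier H) g in
     \<lparr>carrier = g ` carrier H, monoid.mult = (\<lambda>x y. g \<zero>\<^bsub>H\<^esub>), one = g \<zero>\<^bsub>H\<^esub>, ring.zero = g \<zero>\<^bsub>H\<^esub>,
      add = (\<lambda>x y. g (h x \<oplus>\<^bsub>H\<^esub> h y)), smult = (\<lambda>a x. g (a \<odot>\<^bsub>H\<^esub> h x)),
      ip = (\<lambda>x y. ip H (h x) (h y))\<rparr>)"

lemma push_iso:
  assumes "hilbert_space H" and inj: "inj_on g (carrier H)"
  shows "hilbert_iso H (push H g) g"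
proof -
  interpret hilbert_space H by fact
  let ?K = "push H g"
  have car: "carrier ?K = g ` carrier H" by (simp add: push_def Let_def)
  have zero: "\<zero>\<^bsub>?K\<^esub> = g \<zero>\<^bsub>H\<^esub>" by (simp add: push_def Let_def)
  have add: "g x \<oplus>\<^bsub>?K\<^esub> g y = g (x \<oplus>\<^bsub>H\<^esub> y)" if "x \<in> carrier H" "y \<in> carrier H" for x y
    using that inj by (simp add: push_def Let_def)
  have scale: "a \<odot>\<^bsub>?K\<^esub> g x = g (a \<odot>\<^bsub>H\<^esub> x)" if "x \<in> carrier H" for a x
    using that inj by (simp add: push_def Let_def)
  have ip: "ip ?K (g x) (g y) = ip H x y" if "x \<in> carrier H" "y \<in> carrier H" for x y
    using that inj by (simp add: push_def Let_def)
  have ab: "abelian_group ?K"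
  proof (rule abelian_groupI)
    fix x assume "x \<in> carrier ?K"
    then obtain a where a: "x = g a" "a \<in> carrier H" by (auto simp: car)
    then have "g (\<ominus>\<^bsub>H\<^esub> a) \<oplus>\<^bsub>?K\<^esub> x = \<zero>\<^bsub>?K\<^esub>" by (simp add: add zero M.l_neg)
    then show "\<exists>y\<in>carrier ?K. y \<oplus>\<^bsub>?K\<^esub> x = \<zero>\<^bsub>?K\<^esub>" using a by (auto simp: car)
  qed (auto simp: car add zero M.a_ac)
  have m: "module complex_ring ?K"
    by (rule moduleI[OF cring_complex_ring ab])
      (auto simp: car scale add scale_add_left scale_add_right scale_scale)
  have diff: "g x \<ominus>\<^bsub>?K\<^esub> g y = g (x \<ominus>\<^bsub>H\<^esub> y)" if "x \<in> carrier H" "y \<in> carrier H" for x y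
    using that module_minus_conv[OF m] by (simp add: car scale add minus_conv_scale)
  have nrm: "ipnorm ?K (g x) = ipnorm H x" if "x \<in> carrier H" for x
    using that by (simp add: ipnorm_def ip)
  have "hilbert_space_axioms ?K"
  proof
    fix X :: "nat \<Rightarrow> 'b"
    assume X: "\<forall>n. X n \<in> carrier ?K"
      and cau: "\<forall>e>0. \<exists>N. \<forall>m\<ge>N. \<forall>n\<ge>N. ipnorm ?K (X m \<ominus>\<^bsub>?K\<^esub> X n) < e"
    define Y where "Y n = inv_into (carrier H) g (X n)" for n
    have Y: "Y n \<in> carrier H" "X n = g (Y n)" for n
      using X by (auto simp: car Y_def inv_into_into f_inv_into_f)
    have "\<forall>e>0. \<exists>N. \<forall>m\<ge>N. \<forall>n\<ge>N. ipnorm H (Y m \<ominus>\<^bsub>H\<^esub> Y n) < e"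
      using cau Y(1) by (simp add: Y(2) diff nrm)
    then obtain x where "x \<in> carrier H" "(\<lambda>n. ipnorm H (Y n \<ominus>\<^bsub>H\<^esub> x)) \<longlonglongrightarrow> 0"
      using complete[of Y] Y(1) by auto
    then show "\<exists>x\<in>carrier ?K. (\<lambda>n. ipnorm ?K (X n \<ominus>\<^bsub>?K\<^esub> x)) \<longlonglongrightarrow> 0"
      using Y(1) by (auto simp: Y(2) car diff nrm)
  next
    fix x y assume "x \<in> carrier ?K" "y \<in> carrier ?K"
    then obtain a b where "x = g a" "y = g b" "a \<in> carrier H" "b \<in> carrier H"
      by (auto simp: car)
    then show "ip ?K y x = cnj (ip ?K x y)"
      using ip_cnj[of a b] by (simp add: ip)
  next
    show "\<And>x. \<lbrakk>x \<in> carrier ?K; ip ?K x x = 0\<rbrakk> \<Longrightarrow> x = \<zero>\<^bsub>?K\<^esub>"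
      using ip_definite by (auto simp: car ip zero)
  qed (auto simp: car ip add scale ip_add ip_scale ip_nonneg)
  then have "hilbert_space ?K" using m by (simp add: hilbert_space_def)
  moreover have "unitary H ?K g"
    using inj by (auto simp: unitary_def bij_betw_def car add scale ip)
  ultimately show ?thesis
    by (simp add: hilbert_iso_def hilbert_iso_axioms_def hilbert_space_axioms)
qed

section \<open>Square-summable families and their tensor products\<close>

text \<open>The index set enters as a support condition on functions of the whole type. Operations
  are then pointwise and sums run over \<open>UNIV\<close>, whatever I is.\<close>

definition ell2 :: "'i set \<Rightarrow> ('i \<Rightarrow> complex) ip_module" where
  "ell2 I = \<lparr>carrier = {f. (\<forall>i. i \<notin> I \<longrightarrow> f i = 0) \<and> (\<lambda>i. (norm (f i))\<^sup>2) summable_on UNIV},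
     monoid.mult = (\<lambda>f g i. 0), one = (\<lambda>i. 0), ring.zero = (\<lambda>i. 0),
     add = (\<lambda>f g i. f i + g i), smult = (\<lambda>a f i. a * f i),
     ip = (\<lambda>f g. \<Sum>\<^sub>\<infinity>i. f i * cnj (g i))\<rparr>"

abbreviation "L2 I \<equiv> carrier (ell2 I)"

lemma ell2_ops [simp]:
  "\<zero>\<^bsub>ell2 I\<^esub> = (\<lambda>i. 0)" "f \<oplus>\<^bsub>ell2 I\<^esub> g = (\<lambda>i. f i + g i)" "a \<odot>\<^bsub>ell2 I\<^esub> f = (\<lambda>i. a * f i)"
  by (simp_all add: ell2_def)

lemma ip_ell2: "ip (ell2 I) f g = (\<Sum>\<^sub>\<infinity>i. f i * cnj (g i))"
  by (simp add: ell2_def)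

lemma ell2_mem_iff:
  "f \<in> L2 I \<longleftrightarrow> (\<forall>i. i \<notin> I \<longrightarrow> f i = 0) \<and> (\<lambda>i. (norm (f i))\<^sup>2) summable_on UNIV"
  by (simp add: ell2_def)

lemma ell2_outside: "\<lbrakk>f \<in> L2 I; i \<notin> I\<rbrakk> \<Longrightarrow> f i = 0"
  by (simp add: ell2_mem_iff)

lemma ell2_finite_support:
  assumes "finite S" "\<And>i. i \<notin> S \<Longrightarrow> f i = 0" "S \<subseteq> I"
  shows "f \<in> L2 I"
proof -
  have "(\<lambda>i. (norm (f i))\<^sup>2) summable_on UNIV \<longleftrightarrow> (\<lambda>i. (norm (f i))\<^sup>2) summable_on S"
    using assms(2) by (intro summable_on_cong_neutral) auto
  then show ?thesis using assms by (auto simp: ell2_mem_iff)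
qed

lemma ell2_ip_summable:
  assumes "f \<in> L2 I" "g \<in> L2 I"
  shows "(\<lambda>i. f i * cnj (g i)) abs_summable_on UNIV"
proof (rule abs_summable_on_comparison_test')
  show "(\<lambda>i. (norm (f i))\<^sup>2 + (norm (g i))\<^sup>2) summable_on UNIV"
    using assms by (intro summable_on_add) (auto simp: ell2_mem_iff)
  show "norm (f i * cnj (g i)) \<le> (norm (f i))\<^sup>2 + (norm (g i))\<^sup>2" for i
    using sum_squares_bound[of "norm (f i)" "norm (g i)"] mult_nonneg_nonneg[OF norm_ge_zero norm_ge_zero, of "f i" "g i"]
    unfolding norm_mult complex_mod_cnj by linarith
qed

lemma ell2_add_closed:
  assumes f: "f \<in> L2 I" and g: "g \<in> L2 I"
  shows "(\<lambda>i. f i + g i) \<in> L2 I"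
proof -
  have "(\<lambda>i. (norm (f i + g i))\<^sup>2) summable_on UNIV"
  proof (rule summable_on_comparison_test)
    show "(\<lambda>i. 2 * (norm (f i))\<^sup>2 + 2 * (norm (g i))\<^sup>2) summable_on UNIV"
      using f g by (intro summable_on_add summable_on_cmult_right) (auto simp: ell2_mem_iff)
    fix i
    have "(norm (f i + g i))\<^sup>2 \<le> (norm (f i) + norm (g i))\<^sup>2"
      by (intro power_mono norm_triangle_ineq) auto
    also have "\<dots> \<le> 2 * (norm (f i))\<^sup>2 + 2 * (norm (g i))\<^sup>2"
      using sum_squares_bound[of "norm (f i)" "norm (g i)"] by (simp add: power2_sum)
    finally show "(norm (f i + g i))\<^sup>2 \<le> 2 * (norm (f i))\<^sup>2 + 2 * (norm (g i))\<^sup>2" .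
  qed auto
  then show ?thesis using f g by (simp add: ell2_mem_iff)
qed

lemma ell2_scale_closed:
  assumes "f \<in> L2 I"
  shows "(\<lambda>i. a * f i) \<in> L2 I"
  using assms summable_on_cmult_right[of "\<lambda>i. (norm (f i))\<^sup>2" UNIV "(norm a)\<^sup>2"]
  by (simp add: ell2_mem_iff norm_mult power_mult_distrib)

lemma module_ell2: "module complex_ring (ell2 I)"
proof (rule moduleI[OF cring_complex_ring])
  have zero: "(\<lambda>i. 0) \<in> L2 I" by (simp add: ell2_mem_iff)
  show "abelian_group (ell2 I)"
  proof (rule abelian_groupI)
    fix f assume "f \<in> L2 I"
    then have "(\<lambda>i. - 1 * f i) \<in> L2 I" by (rule ell2_scale_closed)
    then show "\<exists>g\<in>L2 I. g \<oplus>\<^bsub>ell2 I\<^esub> f = \<zero>\<^bsub>ell2 I\<^esub>"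
      by (rule rev_bexI) simp
  qed (use zero in \<open>auto simp: ell2_add_closed\<close>)
qed (auto simp: ell2_scale_closed algebra_simps)

lemma ell2_minus [simp]:
  "\<lbrakk>f \<in> L2 I; g \<in> L2 I\<rbrakk> \<Longrightarrow> f \<ominus>\<^bsub>ell2 I\<^esub> g = (\<lambda>i. f i - g i)"
  using module_minus_conv[OF module_ell2] by simp

lemma ell2_diff_closed:
  "\<lbrakk>f \<in> L2 I; g \<in> L2 I\<rbrakk> \<Longrightarrow> (\<lambda>i. f i - g i) \<in> L2 I"
  using ell2_add_closed[of f I "\<lambda>i. - 1 * g i"] ell2_scale_closed[of g I "- 1"] by simp

lemma ip_ell2_self: "f \<in> L2 I \<Longrightarrow> ip (ell2 I) f f = of_real (\<Sum>\<^sub>\<infinity>i. (norm (f i))\<^sup>2)"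
proof -
  assume "f \<in> L2 I"
  then have "((\<lambda>i. of_real ((norm (f i))\<^sup>2) :: complex) has_sum of_real (\<Sum>\<^sub>\<infinity>i. (norm (f i))\<^sup>2)) UNIV"
    by (intro has_sum_of_real has_sum_infsum) (simp add: ell2_mem_iff)
  then show ?thesis unfolding ip_ell2
    by (intro infsumI) (simp only: complex_norm_square)
qed

lemma ipnorm_ell2_sq:
  "f \<in> L2 I \<Longrightarrow> (ipnorm (ell2 I) f)\<^sup>2 = (\<Sum>\<^sub>\<infinity>i. (norm (f i))\<^sup>2)"
  unfolding ipnorm_def by (simp add: ip_ell2_self infsum_nonneg)

lemma ipnorm_ell2_nonneg: "f \<in> L2 I \<Longrightarrow> 0 \<le> ipnorm (ell2 I) f"
  unfolding ipnorm_def by (simp add: ip_ell2_self infsum_nonneg)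

lemma ell2_finite_sum_le:
  assumes "f \<in> L2 I" "finite F"
  shows "(\<Sum>i\<in>F. (norm (f i))\<^sup>2) \<le> (ipnorm (ell2 I) f)\<^sup>2"
  unfolding ipnorm_ell2_sq[OF assms(1)]
  using assms by (intro finite_sum_le_infsum) (auto simp: ell2_mem_iff)

lemma ell2_coord_le:
  assumes "f \<in> L2 I"
  shows "norm (f i) \<le> ipnorm (ell2 I) f"
  using ell2_finite_sum_le[OF assms, of "{i}"] ipnorm_ell2_nonneg[OF assms]
  by (simp add: power2_le_imp_le[of "norm (f i)"])

text \<open>Bounds on finite partial sums are what survives a pointwise limit and what Bessel's
  inequality provides; membership and norm estimate follow together.\<close>

lemma ell2_memI_bounded:
  assumes "\<And>i. i \<notin> I \<Longrightarrow> f i = 0" "\<And>F. finite F \<Longrightarrow> (\<Sum>i\<in>F. (norm (f i))\<^sup>2) \<le> C\<^sup>2" "0 \<le> C"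
  shows "f \<in> L2 I" "ipnorm (ell2 I) f \<le> C"
proof -
  have s: "(\<lambda>i. (norm (f i))\<^sup>2) summable_on UNIV"
    using assms(2) by (intro nonneg_bdd_above_summable_on bdd_aboveI[of _ "C\<^sup>2"]) auto
  then show f: "f \<in> L2 I" using assms by (simp add: ell2_mem_iff)
  have "(ipnorm (ell2 I) f)\<^sup>2 \<le> C\<^sup>2"
    unfolding ipnorm_ell2_sq[OF f] using s assms(2) by (intro infsum_le_finite_sums) auto
  then show "ipnorm (ell2 I) f \<le> C" using assms(3) by (rule power2_le_imp_le)
qed

lemma ell2_complete:
  fixes X :: "nat \<Rightarrow> _"
  assumes X: "\<And>n. X n \<in> L2 I"
    and cau: "\<forall>e>0. \<exists>N. \<forall>m\<ge>N. \<forall>n\<ge>N. ipnorm (ell2 I) (\<lambda>i. X m i - X n i) < e"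
  obtains L where "L \<in> L2 I" "(\<lambda>n. ipnorm (ell2 I) (\<lambda>i. X n i - L i)) \<longlonglongrightarrow> 0"
proof -
  have D: "(\<lambda>i. X m i - X n i) \<in> L2 I" for m n by (intro ell2_diff_closed X)
  have "Cauchy (\<lambda>n. X n i)" for i
  proof (rule metric_CauchyI)
    fix e :: real assume "e > 0"
    then obtain N where N: "\<And>m n. \<lbrakk>m \<ge> N; n \<ge> N\<rbrakk> \<Longrightarrow> ipnorm (ell2 I) (\<lambda>i. X m i - X n i) < e"
      using cau by blast
    have "dist (X m i) (X n i) < e" if "m \<ge> N" "n \<ge> N" for m n
      using N[OF that] ell2_coord_le[OF D[of m n], of i] by (simp add: dist_norm)
    then show "\<exists>N. \<forall>m\<ge>N. \<forall>n\<ge>N. dist (X m i) (X n i) < e" by blast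
  qed
  then have "\<forall>i. \<exists>l. (\<lambda>n. X n i) \<longlonglongrightarrow> l" by (simp add: Cauchy_convergent_iff convergent_def)
  then obtain L where L: "\<And>i. (\<lambda>n. X n i) \<longlonglongrightarrow> L i" by metis
  have L0: "L i = 0" if "i \<notin> I" for i
    using L[of i] X that LIMSEQ_unique[of "\<lambda>n. X n i" "L i" 0] by (simp add: ell2_mem_iff)
  \<comment> \<open>Over a finite set of indices the Cauchy bound passes to the pointwise limit L;
    these finite bounds then control the whole family.\<close>
  have tail: "(\<lambda>i. X m i - L i) \<in> L2 I \<and> ipnorm (ell2 I) (\<lambda>i. X m i - L i) \<le> e"
    if e: "e > 0" and small: "\<And>n. n \<ge> N \<Longrightarrow> ipnorm (ell2 I) (\<lambda>i. X m i - X n i) < e" for e m N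
  proof -
    have "(\<Sum>i\<in>F. (norm (X m i - L i))\<^sup>2) \<le> e\<^sup>2" if F: "finite F" for F
    proof (rule LIMSEQ_le_const2)
      show "(\<lambda>n. \<Sum>i\<in>F. (norm (X m i - X n i))\<^sup>2) \<longlonglongrightarrow> (\<Sum>i\<in>F. (norm (X m i - L i))\<^sup>2)"
        by (intro tendsto_intros L)
      have "(\<Sum>i\<in>F. (norm (X m i - X n i))\<^sup>2) \<le> e\<^sup>2" if n: "n \<ge> N" for n
        using ell2_finite_sum_le[OF D[of m n] F] ipnorm_ell2_nonneg[OF D[of m n]]
          power_strict_mono[OF small[OF n], of 2]
        by simp
      then show "\<exists>N. \<forall>n\<ge>N. (\<Sum>i\<in>F. (norm (X m i - X n i))\<^sup>2) \<le> e\<^sup>2" by blast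
    qed
    then show ?thesis
      using ell2_memI_bounded[of I "\<lambda>i. X m i - L i" e] L0 X e by (auto simp: ell2_mem_iff)
  qed
  obtain N where "\<And>n. n \<ge> N \<Longrightarrow> ipnorm (ell2 I) (\<lambda>i. X N i - X n i) < 1"
    using cau[rule_format, of 1] by auto
  then have "(\<lambda>i. X N i - L i) \<in> L2 I" using tail[of 1 N N] by simp
  \<comment> \<open>L is recovered as \<open>X N\<close> minus a difference already known to be
    square-summable.\<close>
  then have "(\<lambda>i. X N i - (X N i - L i)) \<in> L2 I" by (rule ell2_diff_closed[OF X])
  then have Lc: "L \<in> L2 I" by simp
  have "(\<lambda>n. ipnorm (ell2 I) (\<lambda>i. X n i - L i)) \<longlonglongrightarrow> 0"
  proof (rule LIMSEQ_I)
    fix e :: real assume "e > 0"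
    then obtain N where N: "\<And>m n. \<lbrakk>m \<ge> N; n \<ge> N\<rbrakk> \<Longrightarrow> ipnorm (ell2 I) (\<lambda>i. X m i - X n i) < e / 2"
      using cau[rule_format, of "e / 2"] by auto
    have "norm (ipnorm (ell2 I) (\<lambda>i. X m i - L i) - 0) < e" if "m \<ge> N" for m
      using tail[of "e / 2" N m] N[OF that] \<open>e > 0\<close> ipnorm_ell2_nonneg[of "\<lambda>i. X m i - L i" I]
      by fastforce
    then show "\<exists>N. \<forall>n\<ge>N. norm (ipnorm (ell2 I) (\<lambda>i. X n i - L i) - 0) < e" by blast
  qed
  then show thesis using that Lc by blast
qed

lemma hilbert_ell2: "hilbert_space (ell2 I)"
proof -
  have "hilbert_space_axioms (ell2 I)"
  proof
    show "ip (ell2 I) (f \<oplus>\<^bsub>ell2 I\<^esub> g) h = ip (ell2 I) f h + ip (ell2 I) g h"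
      if "f \<in> L2 I" "g \<in> L2 I" "h \<in> L2 I" for f g h
      using ell2_ip_summable[of _ I h] that
      by (simp add: ip_ell2 distrib_right infsum_add abs_summable_summable)
    show "ip (ell2 I) (a \<odot>\<^bsub>ell2 I\<^esub> f) h = a * ip (ell2 I) f h" for f h a
      by (simp add: ip_ell2 mult.assoc infsum_cmult_right')
    show "ip (ell2 I) g f = cnj (ip (ell2 I) f g)" for f g
      by (simp add: ip_ell2 mult.commute flip: infsum_cnj)
    show "ip (ell2 I) f f \<in> \<real>\<^sub>\<ge>\<^sub>0" if "f \<in> L2 I" for f
      by (simp add: ip_ell2_self[OF that] complex_nonneg_Reals_iff infsum_nonneg)
    show "f = \<zero>\<^bsub>ell2 I\<^esub>" if "f \<in> L2 I" "ip (ell2 I) f f = 0" for f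
    proof -
      have "ipnorm (ell2 I) f = 0" using that by (simp add: ipnorm_def)
      then show ?thesis using ell2_coord_le[OF that(1)] by auto
    qed
    show "\<exists>x\<in>L2 I. (\<lambda>n. ipnorm (ell2 I) (X n \<ominus>\<^bsub>ell2 I\<^esub> x)) \<longlonglongrightarrow> 0"
      if "\<forall>n. X n \<in> L2 I"
        "\<forall>e>0. \<exists>N. \<forall>m\<ge>N. \<forall>n\<ge>N. ipnorm (ell2 I) (X m \<ominus>\<^bsub>ell2 I\<^esub> X n) < e" for X :: "nat \<Rightarrow> _"
    proof -
      have X: "X n \<in> L2 I" for n using that(1) by blast
      have "\<forall>e>0. \<exists>N. \<forall>m\<ge>N. \<forall>n\<ge>N. ipnorm (ell2 I) (\<lambda>i. X m i - X n i) < e"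
        using that(2) by (simp only: ell2_minus[OF X X])
      from ell2_complete[OF X this] obtain L
        where "L \<in> L2 I" "(\<lambda>n. ipnorm (ell2 I) (\<lambda>i. X n i - L i)) \<longlonglongrightarrow> 0" .
      then show ?thesis by (intro bexI[of _ L]) (simp_all add: ell2_minus[OF X])
    qed
  qed
  then show ?thesis using module_ell2 by (simp add: hilbert_space_def)
qed

lemma finsum_ell2:
  assumes "\<And>a. a \<in> A \<Longrightarrow> f a \<in> L2 I"
  shows "(\<Oplus>\<^bsub>ell2 I\<^esub>a\<in>A. f a) = (\<lambda>i. \<Sum>a\<in>A. f a i)"
proof -
  interpret hilbert_space "ell2 I" by (rule hilbert_ell2)
  show ?thesis
    using assms
  proof (induction A rule: infinite_finite_induct)
    case (insert a A)
    then have "f \<in> A \<rightarrow> L2 I" "f a \<in> L2 I" by auto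
    then show ?case using insert by simp
  next
    case (infinite A)
    then show ?case by (simp add: finsum_def finprod_def)
  qed simp
qed

section \<open>Operators acting on one tensor factor\<close>

definition delta :: "'i \<Rightarrow> 'i \<Rightarrow> complex" where
  "delta i = (\<lambda>k. if k = i then 1 else 0)"

lemma delta_mem: "i \<in> I \<Longrightarrow> delta i \<in> L2 I"
  by (rule ell2_finite_support[of "{i}"]) (auto simp: delta_def)

lemma ip_delta: "ip (ell2 I) f (delta i) = f i"
proof -
  have "(\<Sum>\<^sub>\<infinity>k. f k * cnj (delta i k)) = (\<Sum>\<^sub>\<infinity>k\<in>{i}. f k * cnj (delta i k))"
    by (rule infsum_cong_neutral) (auto simp: delta_def)
  then show ?thesis by (simp add: ip_ell2 delta_def)
qed

definition ten :: "('i \<Rightarrow> complex) \<Rightarrow> ('j \<Rightarrow> complex) \<Rightarrow> 'i \<times> 'j \<Rightarrow> complex" where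
  "ten x y = (\<lambda>(i, j). x i * y j)"

text \<open>\<open>rgt B\<close> is I \<otimes> B and, below, \<open>lft A\<close> is A \<otimes> I:
  the operator is applied to every slice of f with the other variable fixed.\<close>

definition rgt :: "(('j \<Rightarrow> complex) \<Rightarrow> ('j \<Rightarrow> complex)) \<Rightarrow> ('i \<times> 'j \<Rightarrow> complex) \<Rightarrow> 'i \<times> 'j \<Rightarrow> complex" where
  "rgt B f = (\<lambda>(i, j). B (\<lambda>j'. f (i, j')) j)"

definition lft :: "(('i \<Rightarrow> complex) \<Rightarrow> ('i \<Rightarrow> complex)) \<Rightarrow> ('i \<times> 'j \<Rightarrow> complex) \<Rightarrow> 'i \<times> 'j \<Rightarrow> complex" where
  "lft A f = (\<lambda>(i, j). A (\<lambda>i'. f (i', j)) i)"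

text \<open>Tonelli's theorem for the squared moduli. The support condition in I is put as the
  vanishing of whole slices, since a linear operator applied to slices preserves this form.\<close>

lemma ell2_prod_mem_iff:
  fixes f :: "'i \<times> 'j \<Rightarrow> complex"
  shows "f \<in> L2 (I \<times> J) \<longleftrightarrow>
    (\<forall>i. i \<notin> I \<longrightarrow> (\<lambda>j. f (i, j)) = (\<lambda>j. 0)) \<and> (\<forall>i. (\<lambda>j. f (i, j)) \<in> L2 J) \<and>
    (\<lambda>i. \<Sum>\<^sub>\<infinity>j. (norm (f (i, j)))\<^sup>2) summable_on UNIV"
proof -
  have "(\<lambda>k. (norm (f k))\<^sup>2) summable_on (UNIV \<times> UNIV) \<longleftrightarrow>
      (\<forall>i. (\<lambda>j. (norm (f (i, j)))\<^sup>2) summable_on UNIV) \<and>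
      (\<lambda>i. \<Sum>\<^sub>\<infinity>j. (norm (f (i, j)))\<^sup>2) summable_on UNIV"
    using abs_summable_on_Sigma_iff[of "\<lambda>k. (norm (f k))\<^sup>2" UNIV "\<lambda>_. UNIV"]
    by (simp add: infsum_nonneg)
  then show ?thesis
    by (auto simp: ell2_mem_iff fun_eq_iff)
qed

lemma ell2_prod_norm:
  assumes "f \<in> L2 (I \<times> J)"
  shows "(\<Sum>\<^sub>\<infinity>i. \<Sum>\<^sub>\<infinity>j. (norm (f (i, j)))\<^sup>2) = (ipnorm (ell2 (I \<times> J)) f)\<^sup>2"
  unfolding ipnorm_ell2_sq[OF assms]
  using assms infsum_Sigma_banach[of "\<lambda>k. (norm (f k))\<^sup>2" UNIV "\<lambda>_. UNIV"]
  by (simp add: ell2_mem_iff)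

lemma ell2_prod_ip:
  assumes "f \<in> L2 (I \<times> J)" "g \<in> L2 (I \<times> J)"
  shows "ip (ell2 (I \<times> J)) f g = (\<Sum>\<^sub>\<infinity>i. ip (ell2 J) (\<lambda>j. f (i, j)) (\<lambda>j. g (i, j)))"
    "(\<lambda>i. ip (ell2 J) (\<lambda>j. f (i, j)) (\<lambda>j. g (i, j))) summable_on UNIV"
proof -
  have s: "(\<lambda>k. f k * cnj (g k)) summable_on (UNIV \<times> UNIV)"
    using abs_summable_summable[OF ell2_ip_summable[OF assms]] by simp
  show "ip (ell2 (I \<times> J)) f g = (\<Sum>\<^sub>\<infinity>i. ip (ell2 J) (\<lambda>j. f (i, j)) (\<lambda>j. g (i, j)))"
    unfolding ip_ell2 using infsum_Sigma_banach[OF s] by simp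
  show "(\<lambda>i. ip (ell2 J) (\<lambda>j. f (i, j)) (\<lambda>j. g (i, j))) summable_on UNIV"
    unfolding ip_ell2 by (rule summable_on_Sigma_banach) (use s in \<open>simp add: case_prod_beta'\<close>)
qed

lemma ten_mem:
  assumes x: "x \<in> L2 I" and y: "y \<in> L2 J"
  shows "ten x y \<in> L2 (I \<times> J)"
  unfolding ell2_prod_mem_iff
proof (intro conjI allI impI)
  show "(\<lambda>j. ten x y (i, j)) = (\<lambda>j. 0)" if "i \<notin> I" for i
    using x that by (simp add: ten_def ell2_mem_iff)
  show "(\<lambda>j. ten x y (i, j)) \<in> L2 J" for i
    using ell2_scale_closed[OF y] by (simp add: ten_def)
  show "(\<lambda>i. \<Sum>\<^sub>\<infinity>j. (norm (ten x y (i, j)))\<^sup>2) summable_on UNIV"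
    using x by (simp add: ten_def norm_mult power_mult_distrib infsum_cmult_right' ell2_mem_iff
      summable_on_cmult_left)
qed

lemma ip_ten:
  assumes "x \<in> L2 I" "y \<in> L2 J" "x' \<in> L2 I" "y' \<in> L2 J"
  shows "ip (ell2 (I \<times> J)) (ten x y) (ten x' y') = ip (ell2 I) x x' * ip (ell2 J) y y'"
proof -
  have "ip (ell2 (I \<times> J)) (ten x y) (ten x' y')
      = (\<Sum>\<^sub>\<infinity>i. \<Sum>\<^sub>\<infinity>j. (x i * cnj (x' i)) * (y j * cnj (y' j)))"
    unfolding ell2_prod_ip(1)[OF ten_mem[OF assms(1,2)] ten_mem[OF assms(3,4)]]
    by (simp add: ip_ell2 ten_def algebra_simps)
  then show ?thesis by (simp add: infsum_cmult_right' infsum_cmult_left' ip_ell2)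
qed

text \<open>The bound for B on each slice, squared and summed over the first index, gives the same
  constant for I \<otimes> B.\<close>

lemma bounded_op_rgt:
  assumes B: "bounded_op (ell2 J) B"
  shows "bounded_op (ell2 (I \<times> J)) (rgt B :: ('i \<times> 'j \<Rightarrow> complex) \<Rightarrow> _)"
proof -
  interpret J: hilbert_space "ell2 J" by (rule hilbert_ell2)
  note lB = bounded_opD[OF B]
  obtain C where C: "C > 0" "\<And>x. x \<in> L2 J \<Longrightarrow> ipnorm (ell2 J) (B x) \<le> C * ipnorm (ell2 J) x"
    using J.bounded_op_bound[OF B] by metis
  have *: "rgt B f \<in> L2 (I \<times> J) \<and>
      ipnorm (ell2 (I \<times> J)) (rgt B f) \<le> C * ipnorm (ell2 (I \<times> J)) f"
    if f: "f \<in> L2 (I \<times> J)" for f :: "'i \<times> 'j \<Rightarrow> complex"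
  proof -
    let ?f = "\<lambda>i j. f (i, j)"
    have fi: "?f i \<in> L2 J" for i using f by (simp add: ell2_prod_mem_iff)
    have rg: "(\<lambda>j. rgt B f (i, j)) = B (?f i)" for i by (simp add: rgt_def)
    have le: "(\<Sum>\<^sub>\<infinity>j. (norm (B (?f i) j))\<^sup>2) \<le> C\<^sup>2 * (\<Sum>\<^sub>\<infinity>j. (norm (?f i j))\<^sup>2)" for i
      using power_mono[OF C(2)[OF fi, of i] ipnorm_ell2_nonneg[OF lB(1)[OF fi]], of 2]
      by (simp add: ipnorm_ell2_sq[OF fi] ipnorm_ell2_sq[OF lB(1)[OF fi]] power_mult_distrib)
    have sf: "(\<lambda>i. C\<^sup>2 * (\<Sum>\<^sub>\<infinity>j. (norm (?f i j))\<^sup>2)) summable_on UNIV"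
      using f by (intro summable_on_cmult_right) (simp add: ell2_prod_mem_iff)
    have s: "(\<lambda>i. \<Sum>\<^sub>\<infinity>j. (norm (B (?f i) j))\<^sup>2) summable_on UNIV"
      by (rule summable_on_comparison_test[OF sf]) (auto simp: le infsum_nonneg)
    have mem: "rgt B f \<in> L2 (I \<times> J)"
      unfolding ell2_prod_mem_iff rg
    proof (intro conjI allI impI)
      show "B (?f i) = (\<lambda>j. 0)" if "i \<notin> I" for i
        using f that J.bounded_op_zero[OF B] by (simp add: ell2_prod_mem_iff)
      show "B (?f i) \<in> L2 J" for i using lB(1)[OF fi] .
      show "(\<lambda>i. \<Sum>\<^sub>\<infinity>j. (norm (rgt B f (i, j)))\<^sup>2) summable_on UNIV"
        using s by (simp add: rgt_def)
    qed
    have "(ipnorm (ell2 (I \<times> J)) (rgt B f))\<^sup>2 = (\<Sum>\<^sub>\<infinity>i. \<Sum>\<^sub>\<infinity>j. (norm (B (?f i) j))\<^sup>2)"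
      unfolding ell2_prod_norm[OF mem, symmetric] by (simp add: rgt_def)
    also have "\<dots> \<le> (\<Sum>\<^sub>\<infinity>i. C\<^sup>2 * (\<Sum>\<^sub>\<infinity>j. (norm (?f i j))\<^sup>2))"
      by (rule infsum_mono[OF s sf le])
    also have "\<dots> = (C * ipnorm (ell2 (I \<times> J)) f)\<^sup>2"
      unfolding infsum_cmult_right' ell2_prod_norm[OF f] power_mult_distrib ..
    finally have "ipnorm (ell2 (I \<times> J)) (rgt B f) \<le> C * ipnorm (ell2 (I \<times> J)) f"
      by (rule power2_le_imp_le) (use C(1) ipnorm_ell2_nonneg[OF f] in simp)
    then show ?thesis using mem by blast
  qed
  have fi: "(\<lambda>j. f (i, j)) \<in> L2 J" if "f \<in> L2 (I \<times> J)" for f and i :: 'i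
    using that by (simp add: ell2_prod_mem_iff)
  have "rgt B (f \<oplus>\<^bsub>ell2 (I \<times> J)\<^esub> g) = rgt B f \<oplus>\<^bsub>ell2 (I \<times> J)\<^esub> rgt B g"
    if "f \<in> L2 (I \<times> J)" "g \<in> L2 (I \<times> J)" for f g
  proof (rule ext)
    fix k :: "'i \<times> 'j"
    obtain i j where k: "k = (i, j)" by (cases k)
    show "rgt B (f \<oplus>\<^bsub>ell2 (I \<times> J)\<^esub> g) k = (rgt B f \<oplus>\<^bsub>ell2 (I \<times> J)\<^esub> rgt B g) k"
      using lB(2)[OF fi[OF that(1), of i] fi[OF that(2), of i]] by (simp add: rgt_def k)
  qed
  moreover have "rgt B (a \<odot>\<^bsub>ell2 (I \<times> J)\<^esub> f) = a \<odot>\<^bsub>ell2 (I \<times> J)\<^esub> rgt B f"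
    if "f \<in> L2 (I \<times> J)" for a f
  proof (rule ext)
    fix k :: "'i \<times> 'j"
    obtain i j where k: "k = (i, j)" by (cases k)
    show "rgt B (a \<odot>\<^bsub>ell2 (I \<times> J)\<^esub> f) k = (a \<odot>\<^bsub>ell2 (I \<times> J)\<^esub> rgt B f) k"
      using lB(3)[OF fi[OF that(1), of i], of a] by (simp add: rgt_def k)
  qed
  ultimately show ?thesis
    unfolding bounded_op_def using * by blast
qed

lemma nonneg_Reals_infsum:
  fixes f :: "'a \<Rightarrow> complex"
  assumes "f summable_on UNIV" "\<And>i. f i \<in> \<real>\<^sub>\<ge>\<^sub>0"
  shows "infsum f UNIV \<in> \<real>\<^sub>\<ge>\<^sub>0"
proof -
  have *: "f i = of_real (Re (f i))" "0 \<le> Re (f i)" for i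
    using assms(2)[of i] by (auto simp: complex_nonneg_Reals_iff complex_eq_iff)
  have "((\<lambda>i. of_real (Re (f i)) :: complex) has_sum of_real (\<Sum>\<^sub>\<infinity>i. Re (f i))) UNIV"
    using assms(1) by (intro has_sum_of_real has_sum_infsum summable_on_Re)
  then have "infsum f UNIV = of_real (\<Sum>\<^sub>\<infinity>i. Re (f i))"
    by (intro infsumI) (simp flip: *(1))
  then show ?thesis using *(2) by (simp add: infsum_nonneg)
qed

text \<open>By Fubini the quadratic form of I \<otimes> B at f is the sum of the forms of B at the
  slices of f.\<close>

lemma positive_op_rgt:
  assumes B: "positive_op (ell2 J) B"
  shows "positive_op (ell2 (I \<times> J)) (rgt B :: ('i \<times> 'j \<Rightarrow> complex) \<Rightarrow> _)"
proof -
  have b: "bounded_op (ell2 (I \<times> J)) (rgt B :: ('i \<times> 'j \<Rightarrow> complex) \<Rightarrow> _)"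
    using B by (intro bounded_op_rgt) (simp add: positive_op_def)
  have "ip (ell2 (I \<times> J)) (rgt B f) f \<in> \<real>\<^sub>\<ge>\<^sub>0" if f: "f \<in> L2 (I \<times> J)"
    for f :: "'i \<times> 'j \<Rightarrow> complex"
  proof -
    have rf: "rgt B f \<in> L2 (I \<times> J)" using bounded_opD(1)[OF b f] .
    show ?thesis
      unfolding ell2_prod_ip(1)[OF rf f]
    proof (rule nonneg_Reals_infsum[OF ell2_prod_ip(2)[OF rf f]])
      fix i
      have "(\<lambda>j. f (i, j)) \<in> L2 J" using f by (simp add: ell2_prod_mem_iff)
      then show "ip (ell2 J) (\<lambda>j. rgt B f (i, j)) (\<lambda>j. f (i, j)) \<in> \<real>\<^sub>\<ge>\<^sub>0"
        using B by (simp add: rgt_def positive_op_def)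
    qed
  qed
  then show ?thesis using b by (simp add: positive_op_def)
qed

section \<open>Reindexing, and commutation of the two tensor factors\<close>

lemma ell2_reindex:
  assumes \<pi>: "bij_betw \<pi> (UNIV :: 'a set) (UNIV :: 'b set)" and I: "I = \<pi> -` J"
  shows "hilbert_iso (ell2 J) (ell2 I) (\<lambda>f. f \<circ> \<pi>)"
proof -
  have mem: "f \<circ> \<pi> \<in> L2 I \<longleftrightarrow> f \<in> L2 J" for f
  proof -
    have "(\<forall>i. i \<notin> I \<longrightarrow> (f \<circ> \<pi>) i = 0) \<longleftrightarrow> (\<forall>j. j \<notin> J \<longrightarrow> f j = 0)"
      using \<pi> I by (metis UNIV_I bij_betw_def comp_apply imageE vimage_eq)
    moreover have "(\<lambda>i. (norm ((f \<circ> \<pi>) i))\<^sup>2) summable_on UNIV \<longleftrightarrow> (\<lambda>j. (norm (f j))\<^sup>2) summable_on UNIV"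
      using summable_on_reindex_bij_betw[OF \<pi>, of "\<lambda>j. (norm (f j))\<^sup>2"] by simp
    ultimately show ?thesis by (simp add: ell2_mem_iff)
  qed
  have "bij_betw (\<lambda>f. f \<circ> \<pi>) (L2 J) (L2 I)"
  proof (rule bij_betw_byWitness[where f' = "\<lambda>g. g \<circ> inv_into UNIV \<pi>"])
    have \<pi>': "inj \<pi>" "surj \<pi>" using \<pi> by (auto simp: bij_betw_def)
    then have c: "inv_into UNIV \<pi> \<circ> \<pi> = id" "\<pi> \<circ> inv_into UNIV \<pi> = id" by (auto simp: fun_eq_iff surj_f_inv_f)
    show "\<forall>f\<in>L2 J. (f \<circ> \<pi>) \<circ> inv_into UNIV \<pi> = f" by (simp add: comp_assoc c)
    show "\<forall>g\<in>L2 I. (g \<circ> inv_into UNIV \<pi>) \<circ> \<pi> = g" by (simp add: comp_assoc c)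
    show "(\<lambda>f. f \<circ> \<pi>) ` L2 J \<subseteq> L2 I" using mem by auto
    show "(\<lambda>g. g \<circ> inv_into UNIV \<pi>) ` L2 I \<subseteq> L2 J"
      using mem[of "_ \<circ> inv_into UNIV \<pi>"] by (auto simp: comp_assoc c)
  qed
  moreover have "ip (ell2 I) (f \<circ> \<pi>) (g \<circ> \<pi>) = ip (ell2 J) f g" for f g
    using infsum_reindex_bij_betw[OF \<pi>, of "\<lambda>j. f j * cnj (g j)"] by (simp add: ip_ell2)
  ultimately show ?thesis
    by (auto simp: hilbert_iso_def hilbert_iso_axioms_def unitary_def hilbert_ell2)
qed

lemma swap_iso: "hilbert_iso (ell2 (J \<times> I)) (ell2 (I \<times> J)) (\<lambda>f. f \<circ> prod.swap)"
  by (rule ell2_reindex) (auto simp: bij_swap)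

text \<open>Exchanging the two variables turns one slicewise action into the other, so positivity
  has to be proved for \<open>rgt\<close> only.\<close>

lemma lft_conv_rgt:
  assumes "f \<in> L2 (I \<times> J)"
  shows "hilbert_iso.conj_op (ell2 (J \<times> I)) (\<lambda>f. f \<circ> prod.swap) (rgt A) f = lft A f"
proof -
  interpret hilbert_iso "ell2 (J \<times> I)" "ell2 (I \<times> J)" "\<lambda>f. f \<circ> prod.swap" by (rule swap_iso)
  have "V f \<circ> prod.swap = f" using U_V[OF assms] .
  then have "V f = f \<circ> prod.swap" by (metis comp_assoc comp_id swap_comp_swap)
  then show ?thesis by (auto simp: conj_op_def lft_def rgt_def fun_eq_iff)
qed

lemma positive_op_lft:
  assumes A: "positive_op (ell2 I) A"
  shows "positive_op (ell2 (I \<times> J)) (lft A :: ('i \<times> 'j \<Rightarrow> complex) \<Rightarrow> _)"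
proof -
  interpret hilbert_iso "ell2 (J \<times> I)" "ell2 (I \<times> J)" "\<lambda>f. f \<circ> prod.swap" by (rule swap_iso)
  show ?thesis
    by (rule K.positive_op_cong[OF positive_op_conj[OF positive_op_rgt[OF A]]])
      (simp add: lft_conv_rgt)
qed

lemma ell2_slice:
  assumes "f \<in> L2 (I \<times> J)"
  shows "(\<lambda>j. f (i, j)) \<in> L2 J" "(\<lambda>i. f (i, j)) \<in> L2 I"
proof -
  interpret hilbert_iso "ell2 (I \<times> J)" "ell2 (J \<times> I)" "\<lambda>f. f \<circ> prod.swap" by (rule swap_iso)
  show "(\<lambda>j. f (i, j)) \<in> L2 J" using assms by (simp add: ell2_prod_mem_iff)
  show "(\<lambda>i. f (i, j)) \<in> L2 I"
    using U_closed[OF assms] by (simp add: ell2_prod_mem_iff)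
qed

text \<open>Symmetry moves A onto the basis vector. The resulting matrix form of A reduces the
  commutation of \<open>lft\<close> and \<open>rgt\<close> to an exchange of sums.\<close>

lemma positive_op_coord:
  assumes A: "positive_op (ell2 I) A" and x: "x \<in> L2 I" and i: "i \<in> I"
  shows "A x i = (\<Sum>\<^sub>\<infinity>k. x k * cnj (A (delta i) k))"
proof -
  interpret hilbert_space "ell2 I" by (rule hilbert_ell2)
  show ?thesis
    using positive_op_symmetric[OF A x delta_mem[OF i]] by (simp only: ip_delta) (simp add: ip_ell2)
qed

lemma lft_rgt_commute:
  assumes A: "positive_op (ell2 I) A" and B: "positive_op (ell2 J) B"
    and f: "f \<in> L2 (I \<times> J)"
  shows "lft A (rgt B f) = rgt B (lft A f)"
proof
  have A': "\<And>x. x \<in> L2 I \<Longrightarrow> A x \<in> L2 I"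
    and B': "\<And>x. x \<in> L2 J \<Longrightarrow> B x \<in> L2 J"
    using A B by (auto simp: positive_op_def bounded_op_def)
  have rf: "rgt B f \<in> L2 (I \<times> J)" and lf: "lft A f \<in> L2 (I \<times> J)"
    using bounded_opD(1)[OF _ f] positive_op_lft[OF A, of J] positive_op_rgt[OF B, of I]
    by (auto simp: positive_op_def)
  have lrf: "lft A (rgt B f) \<in> L2 (I \<times> J)" and rlf: "rgt B (lft A f) \<in> L2 (I \<times> J)"
    using bounded_opD(1)[OF _ rf] bounded_opD(1)[OF _ lf] positive_op_lft[OF A, of J] positive_op_rgt[OF B, of I]
    by (auto simp: positive_op_def)
  fix k :: "'a \<times> 'b"
  obtain i j where k: "k = (i, j)" by (cases k)
  show "lft A (rgt B f) k = rgt B (lft A f) k"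
  proof (cases "i \<in> I \<and> j \<in> J")
    case False
    then show ?thesis
      using ell2_outside[OF lrf, of k] ell2_outside[OF rlf, of k] k by auto
  next
    case True
    then have i: "i \<in> I" and j: "j \<in> J" by auto
    txt \<open>Both sides are the inner product of \<open>f\<close> with \<open>A (delta i) \<otimes> B (delta j)\<close>.\<close>
    define a b where "a = A (delta i)" and "b = B (delta j)"
    have ab: "ten a b \<in> L2 (I \<times> J)"
      unfolding a_def b_def using delta_mem[OF i] delta_mem[OF j] A' B' by (intro ten_mem)
    have "lft A (rgt B f) (i, j) = (\<Sum>\<^sub>\<infinity>k. rgt B f (k, j) * cnj (a k))"
      unfolding a_def using positive_op_coord[OF A ell2_slice(2)[OF rf] i] by (simp add: lft_def)
    also have "\<dots> = (\<Sum>\<^sub>\<infinity>k. \<Sum>\<^sub>\<infinity>l. f (k, l) * cnj (b l) * cnj (a k))"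
      unfolding b_def using positive_op_coord[OF B ell2_slice(1)[OF f] j]
      by (simp add: rgt_def infsum_cmult_left')
    also have "\<dots> = (\<Sum>\<^sub>\<infinity>l. \<Sum>\<^sub>\<infinity>k. f (k, l) * cnj (b l) * cnj (a k))"
    proof (rule infsum_swap_banach)
      \<comment> \<open>This is the series of the inner product of f with \<open>ten a b\<close>,
        hence absolutely summable.\<close>
      show "(\<lambda>(k, l). f (k, l) * cnj (b l) * cnj (a k)) summable_on UNIV \<times> UNIV"
        using abs_summable_summable[OF ell2_ip_summable[OF f ab]]
        by (simp add: ten_def case_prod_beta' mult_ac)
    qed
    also have "\<dots> = (\<Sum>\<^sub>\<infinity>l. lft A f (i, l) * cnj (b l))"
      unfolding a_def using positive_op_coord[OF A ell2_slice(2)[OF f] i]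
      by (simp add: lft_def mult.commute mult.left_commute infsum_cmult_right' flip: infsum_cmult_left')
    also have "\<dots> = rgt B (lft A f) (i, j)"
      unfolding b_def using positive_op_coord[OF B ell2_slice(1)[OF lf] j] by (simp add: rgt_def)
    finally show ?thesis by (simp add: k)
  qed
qed

lemma lft_ten:
  assumes "bounded_op (ell2 I) A" "x \<in> L2 I"
  shows "lft A (ten x y) = ten (A x) y"
proof -
  have "A (\<lambda>i. x i * y j) = (\<lambda>i. A x i * y j)" for j
    using bounded_opD(3)[OF assms, of "y j"] by (simp add: mult.commute[of "y j"])
  then show ?thesis by (simp add: lft_def ten_def)
qed

lemma rgt_ten:
  assumes "bounded_op (ell2 J) B" "y \<in> L2 J"
  shows "rgt B (ten x y) = ten x (B y)"
proof -
  have "B (\<lambda>j. x i * y j) = (\<lambda>j. x i * B y j)" for i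
    using bounded_opD(3)[OF assms, of "x i"] by simp
  then show ?thesis by (simp add: rgt_def ten_def)
qed

section \<open>Orthonormal bases\<close>

text \<open>Polarisation: the real part of the inner product is determined by norms of sums, the
  imaginary part by the real part with \<i> y in place of y. In \<open>coords_iso\<close> this
  derives the preservation of inner products from that of norms.\<close>

lemma isometry_ip:
  assumes "hilbert_space H" "hilbert_space K"
    and U: "\<And>x. x \<in> carrier H \<Longrightarrow> U x \<in> carrier K"
      "\<And>x y. \<lbrakk>x \<in> carrier H; y \<in> carrier H\<rbrakk> \<Longrightarrow> U (x \<oplus>\<^bsub>H\<^esub> y) = U x \<oplus>\<^bsub>K\<^esub> U y"
      "\<And>a x. x \<in> carrier H \<Longrightarrow> U (a \<odot>\<^bsub>H\<^esub> x) = a \<odot>\<^bsub>K\<^esub> U x"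
      "\<And>x. x \<in> carrier H \<Longrightarrow> ipnorm K (U x) = ipnorm H x"
    and x: "x \<in> carrier H" and y: "y \<in> carrier H"
  shows "ip K (U x) (U y) = ip H x y"
proof -
  interpret H: hilbert_space H by fact
  interpret K: hilbert_space K by fact
  have re: "2 * Re (ip H a b) = (ipnorm H (a \<oplus>\<^bsub>H\<^esub> b))\<^sup>2 - (ipnorm H a)\<^sup>2 - (ipnorm H b)\<^sup>2"
    if "a \<in> carrier H" "b \<in> carrier H" for a b
    using that H.ip_cnj[of a b] by (simp add: H.ipnorm_sq H.ip_add H.ip_add_right)
  have re': "2 * Re (ip K a b) = (ipnorm K (a \<oplus>\<^bsub>K\<^esub> b))\<^sup>2 - (ipnorm K a)\<^sup>2 - (ipnorm K b)\<^sup>2"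
    if "a \<in> carrier K" "b \<in> carrier K" for a b
    using that K.ip_cnj[of a b] by (simp add: K.ipnorm_sq K.ip_add K.ip_add_right)
  have eq: "Re (ip K (U a) (U b)) = Re (ip H a b)" if a: "a \<in> carrier H" and b: "b \<in> carrier H" for a b
  proof -
    have "ipnorm K (U a \<oplus>\<^bsub>K\<^esub> U b) = ipnorm H (a \<oplus>\<^bsub>H\<^esub> b)"
      using U(2)[OF a b] U(4)[of "a \<oplus>\<^bsub>H\<^esub> b"] a b by simp
    then show ?thesis using re[OF a b] re'[OF U(1)[OF a] U(1)[OF b]] U(4) a b by simp
  qed
  have "Im (ip K (U x) (U y)) = Im (ip H x y)"
    using eq[of x "\<i> \<odot>\<^bsub>H\<^esub> y"] x y by (simp add: U H.ip_scale_right K.ip_scale_right)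
  then show ?thesis using eq[OF x y] by (simp add: complex_eq_iff)
qed

context hilbert_space
begin

definition orthonormal :: "'i set \<Rightarrow> ('i \<Rightarrow> 'h) \<Rightarrow> bool" where
  "orthonormal K e \<longleftrightarrow> (\<forall>i\<in>K. e i \<in> carrier H) \<and>
     (\<forall>i\<in>K. \<forall>j\<in>K. ip H (e i) (e j) = (if i = j then 1 else 0))"

text \<open>Completeness is put as a trivial orthogonal complement, which is what maximality in
  Zorn's lemma yields. Families instead of sets are allowed because the basis of a tensor product is
  indexed by pairs.\<close>

definition onb :: "'i set \<Rightarrow> ('i \<Rightarrow> 'h) \<Rightarrow> bool" where
  "onb K e \<longleftrightarrow> orthonormal K e \<and> (\<forall>x\<in>carrier H. (\<forall>i\<in>K. ip H x (e i) = 0) \<longrightarrow> x = \<zero>)"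

definition comb :: "('i \<Rightarrow> 'h) \<Rightarrow> 'i set \<Rightarrow> ('i \<Rightarrow> complex) \<Rightarrow> 'h" where
  "comb e F c = (\<Oplus>i\<in>F. c i \<odot> e i)"

definition coords :: "'i set \<Rightarrow> ('i \<Rightarrow> 'h) \<Rightarrow> 'h \<Rightarrow> 'i \<Rightarrow> complex" where
  "coords K e x = (\<lambda>i. if i \<in> K then ip H x (e i) else 0)"

lemma ip_commute_0: "\<lbrakk>x \<in> carrier H; y \<in> carrier H; ip H x y = 0\<rbrakk> \<Longrightarrow> ip H y x = 0"
  using ip_cnj[of x y] by simp

lemma comb_closed: "\<lbrakk>orthonormal K e; F \<subseteq> K\<rbrakk> \<Longrightarrow> comb e F c \<in> carrier H"
  unfolding comb_def by (rule finsum_closedH) (auto simp: orthonormal_def)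

lemma ip_comb:
  assumes "orthonormal K e" "F \<subseteq> K" "z \<in> carrier H"
  shows "ip H (comb e F c) z = (\<Sum>i\<in>F. c i * ip H (e i) z)"
proof -
  have e: "\<And>i. i \<in> F \<Longrightarrow> e i \<in> carrier H" using assms by (auto simp: orthonormal_def)
  have "ip H (comb e F c) z = (\<Sum>i\<in>F. ip H (c i \<odot> e i) z)"
    unfolding comb_def using assms(3) e by (intro ip_finsum) auto
  also have "\<dots> = (\<Sum>i\<in>F. c i * ip H (e i) z)"
    using assms(3) e by (intro sum.cong) (auto simp: ip_scale)
  finally show ?thesis .
qed

lemma ip_comb_basis:
  assumes "orthonormal K e" "finite F" "F \<subseteq> K" "j \<in> K"
  shows "ip H (comb e F c) (e j) = (if j \<in> F then c j else 0)"
proof -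
  have "ip H (comb e F c) (e j) = (\<Sum>i\<in>F. c i * ip H (e i) (e j))"
    using assms by (intro ip_comb) (auto simp: orthonormal_def)
  also have "\<dots> = (\<Sum>i\<in>F. if j = i then c i else 0)"
    using assms by (intro sum.cong) (auto simp: orthonormal_def)
  finally show ?thesis using assms(2) by simp
qed

lemma ip_comb_comb:
  assumes o: "orthonormal K e" and F: "finite F" "F \<subseteq> K" and G: "finite G" "G \<subseteq> K"
  shows "ip H (comb e F c) (comb e G d) = (\<Sum>i\<in>F \<inter> G. c i * cnj (d i))"
proof -
  have *: "ip H (e i) (comb e G d) = (if i \<in> G then cnj (d i) else 0)" if "i \<in> F" for i
  proof -
    have i: "i \<in> K" "e i \<in> carrier H" using that F(2) o by (auto simp: orthonormal_def)
    show ?thesis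
      using ip_cnj[OF comb_closed[OF o G(2)] i(2), of d] ip_comb_basis[OF o G i(1), of d] by simp
  qed
  have "ip H (comb e F c) (comb e G d) = (\<Sum>i\<in>F. if i \<in> G then c i * cnj (d i) else 0)"
    unfolding ip_comb[OF o F(2) comb_closed[OF o G(2)]] by (intro sum.cong) (auto simp: *)
  then show ?thesis using F(1) by (simp add: sum.inter_restrict)
qed

lemma ipnorm_comb:
  assumes "orthonormal K e" "finite F" "F \<subseteq> K"
  shows "(ipnorm H (comb e F c))\<^sup>2 = (\<Sum>i\<in>F. (norm (c i))\<^sup>2)"
proof -
  have "ip H (comb e F c) (comb e F c) = of_real (\<Sum>i\<in>F. (norm (c i))\<^sup>2)"
    using ip_comb_comb[OF assms assms(2,3)] by (simp only: Int_absorb of_real_sum complex_norm_square)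
  then show ?thesis using ipnorm_sq[OF comb_closed[OF assms(1,3)]] by simp
qed

text \<open>The difference of the two sides is the squared distance from x to its projection
  y.\<close>

lemma Bessel:
  assumes o: "orthonormal K e" and F: "finite F" "F \<subseteq> K" and x: "x \<in> carrier H"
  shows "(\<Sum>i\<in>F. (norm (ip H x (e i)))\<^sup>2) \<le> (ipnorm H x)\<^sup>2"
proof -
  let ?s = "\<Sum>i\<in>F. (norm (ip H x (e i)))\<^sup>2"
  define y where "y = comb e F (\<lambda>i. ip H x (e i))"
  have y: "y \<in> carrier H" using comb_closed[OF o F(2)] by (simp add: y_def)
  have "ip H y x = (\<Sum>i\<in>F. ip H x (e i) * cnj (ip H x (e i)))"
    unfolding y_def ip_comb[OF o F(2) x]
    using F(2) o x by (intro sum.cong refl arg_cong2[where f = "(*)"] ip_cnj) (auto simp: orthonormal_def)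
  then have yx: "ip H y x = of_real ?s" by (simp only: of_real_sum complex_norm_square)
  have "ip H y y = of_real ?s"
    using ipnorm_comb[OF o F, of "\<lambda>i. ip H x (e i)"] ip_self[OF y] by (simp add: y_def)
  then have "(ipnorm H (x \<ominus> y))\<^sup>2 = (ipnorm H x)\<^sup>2 - ?s"
    using x y yx ip_cnj[OF y x] by (simp add: ipnorm_sq ip_diff ip_diff_right)
  then show ?thesis by (metis diff_ge_0_iff_ge zero_le_power2)
qed

lemma coords_mem:
  fixes K :: "'i set"
  assumes o: "orthonormal K e" and x: "x \<in> carrier H"
  shows "coords K e x \<in> L2 K"
proof (rule ell2_memI_bounded)
  fix F :: "'i set" assume "finite F"
  then have "(\<Sum>i\<in>F. (norm (coords K e x i))\<^sup>2) = (\<Sum>i\<in>F \<inter> K. (norm (ip H x (e i)))\<^sup>2)"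
    unfolding sum.inter_restrict[OF \<open>finite F\<close>] by (intro sum.cong) (auto simp: coords_def)
  also have "\<dots> \<le> (ipnorm H x)\<^sup>2" using \<open>finite F\<close> by (intro Bessel[OF o _ _ x]) auto
  finally show "(\<Sum>i\<in>F. (norm (coords K e x i))\<^sup>2) \<le> (ipnorm H x)\<^sup>2" .
qed (use x in \<open>auto simp: coords_def\<close>)

text \<open>The vector x is a limit of finite combinations over sets \<open>F n\<close> outside
  which f has squared mass at most \<open>\<epsilon> n\<close>. The sets need not increase with n,
  so the distance of two approximants is measured on both set differences.\<close>

lemma Riesz_Fischer:
  assumes o: "orthonormal K e" and f: "f \<in> L2 K"
  obtains x where "x \<in> carrier H" "\<And>i. i \<in> K \<Longrightarrow> ip H x (e i) = f i" "ipnorm H x = ipnorm (ell2 K) f"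
proof -
  let ?a = "\<lambda>i. (norm (f i))\<^sup>2"
  define \<epsilon> where "\<epsilon> n = inverse (real (Suc n))" for n
  have \<epsilon>: "\<epsilon> n > 0" for n by (simp add: \<epsilon>_def)
  have \<epsilon>_lim: "\<epsilon> \<longlonglongrightarrow> 0" unfolding \<epsilon>_def by (rule LIMSEQ_inverse_real_of_nat)
  have s: "?a summable_on UNIV" using f by (simp add: ell2_mem_iff)
  have "\<exists>F. finite F \<and> F \<subseteq> K \<and> dist (sum ?a F) (infsum ?a UNIV) \<le> \<epsilon> n" for n
  proof -
    obtain F where F: "finite F" "dist (sum ?a F) (infsum ?a UNIV) \<le> \<epsilon> n"
      using infsum_finite_approximation[OF s \<epsilon>] by blast
    have "sum ?a (F \<inter> K) = sum ?a F"
      using F(1) f by (intro sum.mono_neutral_left) (auto simp: ell2_mem_iff)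
    then show ?thesis using F by (intro exI[of _ "F \<inter> K"]) auto
  qed
  then obtain F where F: "\<And>n. finite (F n)" "\<And>n. F n \<subseteq> K"
    "\<And>n. dist (sum ?a (F n)) (infsum ?a UNIV) \<le> \<epsilon> n"
    by metis
  have tail: "sum ?a G \<le> \<epsilon> n" if G: "finite G" "G \<inter> F n = {}" for G n
  proof -
    have "sum ?a (F n) + sum ?a G = sum ?a (F n \<union> G)"
      using F(1) G by (intro sum.union_disjoint[symmetric]) auto
    also have "\<dots> \<le> infsum ?a UNIV"
      using s F(1) G by (intro finite_sum_le_infsum) auto
    finally show ?thesis using F(3)[of n] by (simp add: dist_real_def)
  qed
  define X where "X n = comb e (F n) f" for n
  have X: "X n \<in> carrier H" for n unfolding X_def by (rule comb_closed[OF o F(2)])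
  have dist: "(ipnorm H (X m \<ominus> X n))\<^sup>2 \<le> \<epsilon> n + \<epsilon> m" for m n
  proof -
    have ipX: "ip H (X p) (X q) = of_real (sum ?a (F p \<inter> F q))" for p q
      unfolding X_def ip_comb_comb[OF o F(1,2) F(1,2)] by (simp only: of_real_sum complex_norm_square)
    have "(ipnorm H (X m \<ominus> X n))\<^sup>2 = sum ?a (F m) + sum ?a (F n) - 2 * sum ?a (F m \<inter> F n)"
      using X by (simp add: ipnorm_sq ip_diff ip_diff_right ipX Int_commute)
    also have "\<dots> = sum ?a (F m - F n) + sum ?a (F n - F m)"
      using sum.Int_Diff[OF F(1), of ?a m "F n"] sum.Int_Diff[OF F(1), of ?a n "F m"]
      by (simp add: Int_commute)
    also have "\<dots> \<le> \<epsilon> n + \<epsilon> m" using F(1) by (intro add_mono tail) auto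
    finally show ?thesis .
  qed
  have "\<exists>N. \<forall>m\<ge>N. \<forall>n\<ge>N. ipnorm H (X m \<ominus> X n) < r" if "r > 0" for r
  proof -
    have "r\<^sup>2 / 2 > 0" using that by simp
    then obtain N where N: "\<And>n. n \<ge> N \<Longrightarrow> \<epsilon> n < r\<^sup>2 / 2"
      using order_tendstoD(2)[OF \<epsilon>_lim] unfolding eventually_sequentially by blast
    have "ipnorm H (X m \<ominus> X n) < r" if "m \<ge> N" "n \<ge> N" for m n
    proof (rule power2_less_imp_less)
      show "(ipnorm H (X m \<ominus> X n))\<^sup>2 < r\<^sup>2"
        using dist[of m n] N[OF that(1)] N[OF that(2)] by linarith
    qed (use \<open>r > 0\<close> in simp)
    then show ?thesis by blast
  qed
  then obtain x where x: "x \<in> carrier H" and lim: "(\<lambda>n. ipnorm H (X n \<ominus> x)) \<longlonglongrightarrow> 0"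
    using complete[of X] X by blast
  have "ip H x (e j) = f j" if j: "j \<in> K" for j
  proof -
    have ej: "e j \<in> carrier H" "ipnorm H (e j) = 1" using o j by (auto simp: orthonormal_def ipnorm_def)
    have "(\<lambda>n. ip H (X n) (e j) - ip H x (e j)) \<longlonglongrightarrow> 0"
    proof (rule tendsto_0_le[OF lim, of _ 1])
      have "norm (ip H (X n) (e j) - ip H x (e j)) \<le> norm (ipnorm H (X n \<ominus> x)) * 1" for n
        using Cauchy_Schwarz[of "X n \<ominus> x" "e j"] X x ej by (simp add: ip_diff)
      then show "\<forall>\<^sub>F n in sequentially.
          norm (ip H (X n) (e j) - ip H x (e j)) \<le> norm (ipnorm H (X n \<ominus> x)) * 1" by simp
    qed
    then have 1: "(\<lambda>n. ip H (X n) (e j)) \<longlonglongrightarrow> ip H x (e j)" by (simp add: LIM_zero_iff)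
    have "(\<lambda>n. sqrt (\<epsilon> n)) \<longlonglongrightarrow> sqrt 0" by (intro tendsto_real_sqrt \<epsilon>_lim)
    then have "(\<lambda>n. sqrt (\<epsilon> n)) \<longlonglongrightarrow> 0" by simp
    then have "(\<lambda>n. ip H (X n) (e j) - f j) \<longlonglongrightarrow> 0"
    proof (rule tendsto_0_le[where K = 1])
      \<comment> \<open>The coordinate is exact if j lies in \<open>F n\<close>; otherwise it is
        zero, and j belongs to the tail, which bounds the modulus of \<open>f j\<close> by the root
        of \<open>\<epsilon> n\<close>.\<close>
      have "norm (ip H (X n) (e j) - f j) \<le> norm (sqrt (\<epsilon> n)) * 1" for n
        using tail[of "{j}" n] \<epsilon>[of n]
        by (auto simp: X_def ip_comb_basis[OF o F(1,2) j] real_le_rsqrt)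
      then show "\<forall>\<^sub>F n in sequentially. norm (ip H (X n) (e j) - f j) \<le> norm (sqrt (\<epsilon> n)) * 1"
        by simp
    qed
    then have "(\<lambda>n. ip H (X n) (e j)) \<longlonglongrightarrow> f j" by (simp add: LIM_zero_iff)
    with 1 show ?thesis by (rule LIMSEQ_unique)
  qed
  moreover have "ipnorm H x = ipnorm (ell2 K) f"
  proof -
    have "(\<lambda>n. ipnorm H (X n) - ipnorm H x) \<longlonglongrightarrow> 0"
    proof (rule tendsto_0_le[OF lim, of _ 1])
      have "norm (ipnorm H (X n) - ipnorm H x) \<le> norm (ipnorm H (X n \<ominus> x)) * 1" for n
        using ipnorm_diff_ge[OF X x, of n] X x by simp
      then show "\<forall>\<^sub>F n in sequentially.
          norm (ipnorm H (X n) - ipnorm H x) \<le> norm (ipnorm H (X n \<ominus> x)) * 1" by simp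
    qed
    then have "(\<lambda>n. ipnorm H (X n)) \<longlonglongrightarrow> ipnorm H x" by (simp add: LIM_zero_iff)
    then have 1: "(\<lambda>n. (ipnorm H (X n))\<^sup>2) \<longlonglongrightarrow> (ipnorm H x)\<^sup>2" by (intro tendsto_intros)
    have "(\<lambda>n. (ipnorm H (X n))\<^sup>2 - infsum ?a UNIV) \<longlonglongrightarrow> 0"
    proof (rule tendsto_0_le[OF \<epsilon>_lim, of _ 1])
      have "norm ((ipnorm H (X n))\<^sup>2 - infsum ?a UNIV) \<le> norm (\<epsilon> n) * 1" for n
        using F(3)[of n] \<epsilon>[of n] by (simp add: X_def ipnorm_comb[OF o F(1,2)] dist_real_def)
      then show "\<forall>\<^sub>F n in sequentially.
          norm ((ipnorm H (X n))\<^sup>2 - infsum ?a UNIV) \<le> norm (\<epsilon> n) * 1" by simp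
    qed
    then have "(\<lambda>n. (ipnorm H (X n))\<^sup>2) \<longlonglongrightarrow> infsum ?a UNIV" by (simp add: LIM_zero_iff)
    with 1 have "(ipnorm H x)\<^sup>2 = (ipnorm (ell2 K) f)\<^sup>2"
      unfolding ipnorm_ell2_sq[OF f] by (rule LIMSEQ_unique)
    then show ?thesis using x ipnorm_ell2_nonneg[OF f] by (simp add: power2_eq_iff_nonneg)
  qed
  ultimately show thesis using that x by blast
qed

lemma onb_eqI:
  assumes "onb K e" "x \<in> carrier H" "y \<in> carrier H" "\<And>i. i \<in> K \<Longrightarrow> ip H x (e i) = ip H y (e i)"
  shows "x = y"
proof (rule eq_if_diff_zero[OF assms(2,3)])
  have "\<forall>i\<in>K. ip H (x \<ominus> y) (e i) = 0"
    using assms by (auto simp: ip_diff onb_def orthonormal_def)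
  then show "x \<ominus> y = \<zero>" using assms(1-3) unfolding onb_def by blast
qed

text \<open>Surjectivity is Riesz-Fischer, injectivity the trivial complement. Parseval's identity
  then needs no further limit: Riesz-Fischer gives a vector with the coordinates of x and the right
  norm, and by injectivity it is x.\<close>

lemma coords_iso:
  assumes "onb K e"
  shows "hilbert_iso H (ell2 K) (coords K e)"
proof -
  have o: "orthonormal K e" using assms by (simp add: onb_def)
  have e: "e i \<in> carrier H" if "i \<in> K" for i using o that by (simp add: orthonormal_def)
  have pre: "\<exists>x\<in>carrier H. coords K e x = f \<and> ipnorm H x = ipnorm (ell2 K) f"
    if f: "f \<in> L2 K" for f
  proof -
    obtain x where "x \<in> carrier H" "\<And>i. i \<in> K \<Longrightarrow> ip H x (e i) = f i" "ipnorm H x = ipnorm (ell2 K) f"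
      using Riesz_Fischer[OF o f] by blast
    then show ?thesis using f by (intro bexI[of _ x]) (auto simp: coords_def ell2_mem_iff)
  qed
  have inj: "x = y" if "x \<in> carrier H" "y \<in> carrier H" "coords K e x = coords K e y" for x y
  proof (rule onb_eqI[OF assms that(1,2)])
    show "ip H x (e i) = ip H y (e i)" if "i \<in> K" for i
      using fun_cong[OF \<open>coords K e x = coords K e y\<close>, of i] that by (simp add: coords_def)
  qed
  have add: "coords K e (x \<oplus> y) = coords K e x \<oplus>\<^bsub>ell2 K\<^esub> coords K e y"
    if "x \<in> carrier H" "y \<in> carrier H" for x y
    using that e by (auto simp: coords_def ip_add)
  have scale: "coords K e (a \<odot> x) = a \<odot>\<^bsub>ell2 K\<^esub> coords K e x" if "x \<in> carrier H" for a x
    using that e by (auto simp: coords_def ip_scale)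
  have norm: "ipnorm (ell2 K) (coords K e x) = ipnorm H x" if x: "x \<in> carrier H" for x
  proof -
    obtain y where "y \<in> carrier H" "coords K e y = coords K e x"
      "ipnorm H y = ipnorm (ell2 K) (coords K e x)"
      using pre[OF coords_mem[OF o x]] by blast
    then show ?thesis using inj x by metis
  qed
  have "ip (ell2 K) (coords K e x) (coords K e y) = ip H x y"
    if "x \<in> carrier H" "y \<in> carrier H" for x y
    using that by (intro isometry_ip hilbert_ell2 hilbert_space_axioms coords_mem[OF o] add scale norm)
  moreover have "bij_betw (coords K e) (carrier H) (L2 K)"
    unfolding bij_betw_def
  proof (intro conjI inj_onI)
    show "coords K e ` carrier H = L2 K" using pre coords_mem[OF o] by blast
  qed (use inj in blast)
  ultimately show ?thesis
    using add scale
    by (auto simp: hilbert_iso_def hilbert_iso_axioms_def unitary_def hilbert_ell2 hilbert_space_axioms)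
qed

section \<open>Existence of orthonormal bases\<close>

lemma normalize:
  assumes "x \<in> carrier H" "x \<noteq> \<zero>"
  defines "y \<equiv> of_real (1 / ipnorm H x) \<odot> x"
  shows "y \<in> carrier H" "ip H y y = 1"
proof -
  show "y \<in> carrier H" using assms by simp
  have "ipnorm H x \<noteq> 0" using assms ipnorm_eq_0D by blast
  then have "ipnorm H y = 1" using assms(1)
    by (simp add: y_def ipnorm_scale norm_divide)
  then show "ip H y y = 1" using ip_self[OF \<open>y \<in> carrier H\<close>] by simp
qed

lemma orthonormal_insert:
  assumes "orthonormal B (\<lambda>x. x)" "y \<in> carrier H" "ip H y y = 1" "\<And>b. b \<in> B \<Longrightarrow> ip H y b = 0"
  shows "orthonormal (insert y B) (\<lambda>x. x)"
proof -
  have "ip H b y = 0" if "b \<in> B" for b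
    using that assms ip_commute_0[of y b] by (auto simp: orthonormal_def)
  then show ?thesis using assms by (auto simp: orthonormal_def)
qed

text \<open>A nonzero vector orthogonal to a maximal orthonormal set could be normalised and
  adjoined; by maximality it would already belong to the set and be orthogonal to itself.\<close>

lemma onb_exists: "\<exists>B \<subseteq> carrier H. onb B (\<lambda>x. x)"
proof -
  define \<A> where "\<A> = {B. orthonormal B (\<lambda>x. x)}"
  have "\<exists>U\<in>\<A>. \<forall>X\<in>C. X \<subseteq> U" if C: "subset.chain \<A> C" for C
  proof (intro bexI)
    show "\<Union>C \<in> \<A>"
      unfolding \<A>_def orthonormal_def
    proof (intro CollectI conjI ballI)
      show "i \<in> carrier H" if "i \<in> \<Union>C" for i
        using that C by (auto simp: subset_chain_def \<A>_def orthonormal_def)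
      show "ip H i j = (if i = j then 1 else 0)" if ij: "i \<in> \<Union>C" "j \<in> \<Union>C" for i j
      proof -
        obtain X where "X \<in> C" "i \<in> X" "j \<in> X"
          using ij C unfolding subset_chain_def by blast
        then show ?thesis using C by (auto simp: subset_chain_def \<A>_def orthonormal_def)
      qed
    qed
  qed auto
  then obtain B where B: "B \<in> \<A>" "\<And>X. \<lbrakk>X \<in> \<A>; B \<subseteq> X\<rbrakk> \<Longrightarrow> X = B"
    using subset_Zorn[of \<A>] by metis
  have o: "orthonormal B (\<lambda>x. x)" using B(1) by (simp add: \<A>_def)
  have "x = \<zero>" if x: "x \<in> carrier H" "\<forall>b\<in>B. ip H x b = 0" for x
  proof (rule ccontr)
    assume "x \<noteq> \<zero>"
    note y = normalize[OF x(1) this]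
    let ?y = "of_real (1 / ipnorm H x) \<odot> x"
    have yb: "ip H ?y b = 0" if "b \<in> B" for b
      using x o that by (simp add: ip_scale orthonormal_def)
    have "insert ?y B = B"
      using orthonormal_insert[OF o y yb] by (intro B(2)) (auto simp: \<A>_def)
    then have "?y \<in> B" by blast
    then show False using yb[of ?y] y(2) by simp
  qed
  then have "onb B (\<lambda>x. x)" using o by (simp add: onb_def)
  then show ?thesis using o by (auto simp: orthonormal_def)
qed

text \<open>That F spans at least as much as S is expressed by orthogonal complements, the form in
  which completeness of a basis is defined here.\<close>

lemma Gram_Schmidt:
  assumes "finite S" "S \<subseteq> carrier H"
  shows "\<exists>F. finite F \<and> orthonormal F (\<lambda>x. x) \<and>
    (\<forall>x\<in>carrier H. (\<forall>b\<in>F. ip H x b = 0) \<longrightarrow> (\<forall>s\<in>S. ip H x s = 0))"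
  using assms
proof (induction S rule: finite_induct)
  case empty
  show ?case by (intro exI[of _ "{}"]) (simp add: orthonormal_def)
next
  case (insert s S)
  then obtain F where F: "finite F" "orthonormal F (\<lambda>x. x)"
    "\<And>x. \<lbrakk>x \<in> carrier H; \<forall>b\<in>F. ip H x b = 0\<rbrakk> \<Longrightarrow> \<forall>s\<in>S. ip H x s = 0"
    by auto
  have s: "s \<in> carrier H" using insert by simp
  have Fc: "b \<in> carrier H" if "b \<in> F" for b using F(2) that by (simp add: orthonormal_def)
  \<comment> \<open>p is the projection of s to the span of F. If s = p, nothing has to be adjoined;
    otherwise the normalised difference is.\<close>
  define p where "p = comb (\<lambda>x. x) F (ip H s)"
  have p: "p \<in> carrier H" using comb_closed[OF F(2)] by (simp add: p_def)
  have perp: "ip H x p = 0" if "x \<in> carrier H" "\<forall>b\<in>F. ip H x b = 0" for x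
  proof (rule ip_commute_0[OF p that(1)])
    have "ip H b x = 0" if "b \<in> F" for b using that Fc ip_commute_0 \<open>x \<in> carrier H\<close> \<open>\<forall>b\<in>F. ip H x b = 0\<close> by blast
    then show "ip H p x = 0" unfolding p_def ip_comb[OF F(2) order_refl that(1)] by simp
  qed
  have orth: "ip H (s \<ominus> p) b = 0" if "b \<in> F" for b
    using ip_comb_basis[OF F(2,1) order_refl that] that Fc s p by (simp add: ip_diff p_def)
  show ?case
  proof (cases "s \<ominus> p = \<zero>")
    case True
    then have "s = p" using eq_if_diff_zero s p by blast
    then show ?thesis using F perp by (intro exI[of _ F]) auto
  next
    case False
    have d: "s \<ominus> p \<in> carrier H" using s p by simp
    let ?y = "of_real (1 / ipnorm H (s \<ominus> p)) \<odot> (s \<ominus> p)"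
    note y = normalize[OF d False]
    have nz: "ipnorm H (s \<ominus> p) \<noteq> 0" using d False ipnorm_eq_0D by blast
    have "orthonormal (insert ?y F) (\<lambda>x. x)"
      using orth d Fc by (intro orthonormal_insert[OF F(2) y]) (simp add: ip_scale)
    moreover have "ip H x s = 0" if x: "x \<in> carrier H" "\<forall>b\<in>insert ?y F. ip H x b = 0" for x
    proof -
      have "ip H x ?y = 0" using x(2) by blast
      then have "ip H x (s \<ominus> p) = 0" using x(1) d nz by (simp add: ip_scale_right)
      then show ?thesis using perp[OF x(1)] x s p by (simp add: ip_diff_right)
    qed
    ultimately show ?thesis using F by (intro exI[of _ "insert ?y F"]) auto
  qed
qed

text \<open>Zorn's lemma gives no finiteness, so Gram-Schmidt is applied to a finite spanning set S.
  A vector orthogonal to S is a combination of S and hence orthogonal to itself.\<close>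

lemma finite_onb_exists:
  assumes "finite_dim H"
  shows "\<exists>B. finite B \<and> B \<subseteq> carrier H \<and> onb B (\<lambda>x. x)"
proof -
  obtain S where S: "finite S" "S \<subseteq> carrier H"
    "\<And>x. x \<in> carrier H \<Longrightarrow> \<exists>c. x = (\<Oplus>b\<in>S. c b \<odot> b)"
    using assms unfolding finite_dim_def by auto
  obtain F where F: "finite F" "orthonormal F (\<lambda>x. x)"
    "\<And>x. \<lbrakk>x \<in> carrier H; \<forall>b\<in>F. ip H x b = 0\<rbrakk> \<Longrightarrow> \<forall>s\<in>S. ip H x s = 0"
    using Gram_Schmidt[OF S(1,2)] by blast
  have "x = \<zero>" if x: "x \<in> carrier H" "\<forall>b\<in>F. ip H x b = 0" for x
  proof -
    obtain c where c: "x = (\<Oplus>b\<in>S. c b \<odot> b)" using S(3)[OF x(1)] by blast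
    have *: "ip H b x = 0" if "b \<in> S" for b
      using F(3)[OF x] that S(2) x(1) ip_commute_0 by blast
    have "ip H (\<Oplus>b\<in>S. c b \<odot> b) x = (\<Sum>b\<in>S. ip H (c b \<odot> b) x)"
      using S(2) x(1) by (intro ip_finsum) auto
    also have "\<dots> = 0" using S(2) x(1) * by (intro sum.neutral) (auto simp: ip_scale)
    finally show ?thesis using c ip_definite[OF x(1)] by simp
  qed
  then show ?thesis using F by (intro exI[of _ F]) (auto simp: onb_def orthonormal_def)
qed

lemma onb_expand:
  assumes "onb K e" "finite K" "x \<in> carrier H"
  shows "x = (\<Oplus>i\<in>K. ip H x (e i) \<odot> e i)"
proof -
  have o: "orthonormal K e" using assms by (simp add: onb_def)
  have "x = comb e K (\<lambda>i. ip H x (e i))"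
    using assms ip_comb_basis[OF o assms(2) order_refl]
    by (intro onb_eqI[OF assms(1,3) comb_closed[OF o order_refl]]) simp
  then show ?thesis by (simp add: comb_def)
qed

lemma finsum_induct:
  assumes "P \<zero>" "\<And>x y. \<lbrakk>x \<in> carrier H; y \<in> carrier H; P x; P y\<rbrakk> \<Longrightarrow> P (x \<oplus> y)"
    "\<And>i. i \<in> A \<Longrightarrow> f i \<in> carrier H" "\<And>i. i \<in> A \<Longrightarrow> P (f i)" "finite A"
  shows "P (\<Oplus>i\<in>A. f i)"
  using assms(5,3,4)
proof (induction A rule: finite_induct)
  case (insert a A)
  then have "f \<in> A \<rightarrow> carrier H" "f a \<in> carrier H" by auto
  then show ?case using insert by (simp add: assms(2))
qed (simp add: assms(1))

end

section \<open>Cardinalities and composed measurements\<close>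

text \<open>In contrast to \<open>ell2_reindex\<close> the bijection concerns index sets and not
  whole types, so functions are extended by zero. For counting, an injection of the carriers is
  enough.\<close>

lemma ell2_lepoll_eqpoll:
  assumes "A \<approx> B"
  shows "L2 A \<lesssim> L2 B"
proof -
  obtain \<pi> where \<pi>: "bij_betw \<pi> B A" using assms eqpoll_sym unfolding eqpoll_def by blast
  define T where "T f = (\<lambda>b. if b \<in> B then f (\<pi> b) else 0 :: complex)" for f
  have "T f \<in> L2 B" if f: "f \<in> L2 A" for f
  proof -
    have "(\<lambda>a. (norm (f a))\<^sup>2) summable_on UNIV \<longleftrightarrow> (\<lambda>a. (norm (f a))\<^sup>2) summable_on A"
      using f by (intro summable_on_cong_neutral) (auto simp: ell2_mem_iff)
    then have "(\<lambda>a. (norm (f a))\<^sup>2) summable_on A" using f by (simp add: ell2_mem_iff)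
    then have "(\<lambda>b. (norm (f (\<pi> b)))\<^sup>2) summable_on B"
      using summable_on_reindex_bij_betw[OF \<pi>, of "\<lambda>a. (norm (f a))\<^sup>2"] by simp
    moreover have "(\<lambda>b. (norm (T f b))\<^sup>2) summable_on UNIV \<longleftrightarrow> (\<lambda>b. (norm (f (\<pi> b)))\<^sup>2) summable_on B"
      by (intro summable_on_cong_neutral) (auto simp: T_def)
    ultimately show ?thesis by (simp add: ell2_mem_iff) (simp add: T_def)
  qed
  moreover have "inj_on T (L2 A)"
  proof (rule inj_onI)
    fix f g assume fg: "f \<in> L2 A" "g \<in> L2 A" and eq: "T f = T g"
    show "f = g"
    proof
      fix a show "f a = g a"
      proof (cases "a \<in> A")
        case True
        then obtain b where "b \<in> B" "a = \<pi> b" using \<pi> by (auto simp: bij_betw_def)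
        then show ?thesis using fun_cong[OF eq, of b] by (simp add: T_def)
      qed (use fg in \<open>simp add: ell2_mem_iff\<close>)
    qed
  qed
  ultimately show ?thesis unfolding lepoll_def by blast
qed

lemma complex_times_complex_lepoll: "(UNIV :: (complex \<times> complex) set) \<lesssim> (UNIV :: complex set)"
proof -
  have "infinite (UNIV :: complex set)" by (rule infinite_UNIV_char_0)
  from card_of_Times_same_infinite[OF this] show ?thesis
    by (simp add: eqpoll_imp_lepoll flip: eqpoll_iff_card_of_ordIso)
qed

lemma ell2_finite_lepoll:
  fixes S :: "'i set"
  assumes "finite S"
  shows "L2 S \<lesssim> (UNIV :: complex set)"
  using assms
proof (induction S rule: finite_induct)
  case empty
  have "L2 ({} :: 'i set) \<subseteq> {\<lambda>_. 0}" by (auto simp: ell2_mem_iff)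
  then have "L2 ({} :: 'i set) \<lesssim> {\<lambda>_ :: 'i. 0 :: complex}" by (rule subset_imp_lepoll)
  also have "{\<lambda>_ :: 'i. 0 :: complex} \<lesssim> (UNIV :: complex set)" unfolding lepoll_def by (auto intro: exI[of _ "\<lambda>_. 0"])
  finally show ?case .
next
  case (insert x S)
  have "L2 (insert x S) \<lesssim> L2 S \<times> (UNIV :: complex set)"
    unfolding lepoll_def
  proof (intro exI conjI)
    show "inj_on (\<lambda>f. (f(x := 0), f x)) (L2 (insert x S))"
      by (rule inj_onI) (metis Pair_inject fun_upd_triv fun_upd_upd)
    show "(\<lambda>f. (f(x := 0), f x)) ` L2 (insert x S) \<subseteq> L2 S \<times> UNIV"
    proof safe
      fix f assume f: "f \<in> L2 (insert x S)"
      show "f(x := 0) \<in> L2 S"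
        by (rule ell2_finite_support[OF insert.hyps(1)]) (use f in \<open>auto simp: ell2_mem_iff\<close>)
    qed simp
  qed
  also have "\<dots> \<lesssim> (UNIV :: complex set) \<times> (UNIV :: complex set)"
    by (rule times_lepoll_mono[OF insert.IH lepoll_refl])
  also have "\<dots> \<lesssim> (UNIV :: complex set)" using complex_times_complex_lepoll by simp
  finally show ?case .
qed

lemma ell2_times_lepoll:
  assumes c: "(UNIV :: complex set) \<lesssim> (UNIV :: 'h set)"
    and A: "L2 A \<lesssim> (UNIV :: 'h set)" and B: "L2 B \<lesssim> (UNIV :: 'h set)"
  shows "L2 (A \<times> B) \<lesssim> (UNIV :: 'h set)"
proof (cases "finite (A \<times> B)")
  case True
  then show ?thesis using lepoll_trans[OF ell2_finite_lepoll c] by blast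
next
  case False
  then have ne: "A \<noteq> {}" "B \<noteq> {}" by auto
  have "A \<times> B \<approx> A \<or> A \<times> B \<approx> B"
  proof (cases "(card_of B, card_of A) \<in> ordLeq")
    case True
    \<comment> \<open>The larger factor is infinite, since otherwise both would be finite, and it
      absorbs the nonempty smaller one.\<close>
    then have "infinite A" using False card_of_ordLeq_finite finite_cartesian_product by blast
    from card_of_Times_infinite[OF this ne(2) True] show ?thesis
      unfolding eqpoll_iff_card_of_ordIso by blast
  next
    case nle: False
    then have le: "(card_of A, card_of B) \<in> ordLeq" using ordLeq_total[OF card_of_Well_order card_of_Well_order] by blast
    then have "infinite B" using False card_of_ordLeq_finite finite_cartesian_product by blast
    from card_of_Times_infinite[OF this ne(1) le] show ?thesis
      unfolding eqpoll_iff_card_of_ordIso by blast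
  qed
  then show ?thesis
    using lepoll_trans[OF ell2_lepoll_eqpoll A] lepoll_trans[OF ell2_lepoll_eqpoll B] by metis
qed

section \<open>Sums of tensor products of operators: \<open>tsum M A B\<close> is \<Sum> A m
  \<otimes> B m\<close>

definition tsum :: "'m set \<Rightarrow> ('m \<Rightarrow> ('i \<Rightarrow> complex) \<Rightarrow> 'i \<Rightarrow> complex) \<Rightarrow>
    ('m \<Rightarrow> ('j \<Rightarrow> complex) \<Rightarrow> 'j \<Rightarrow> complex) \<Rightarrow> ('i \<times> 'j \<Rightarrow> complex) \<Rightarrow> 'i \<times> 'j \<Rightarrow> complex" where
  "tsum M A B f = (\<lambda>k. \<Sum>m\<in>M. lft (A m) (rgt (B m) f) k)"

lemma positive_closed: "\<lbrakk>positive_op H T; x \<in> carrier H\<rbrakk> \<Longrightarrow> T x \<in> carrier H"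
  by (auto simp: positive_op_def bounded_op_def)

lemma positive_bounded: "positive_op H T \<Longrightarrow> bounded_op H T"
  by (simp add: positive_op_def)

lemma lft_lft: "lft A (lft B f) = lft (\<lambda>x. A (B x)) f"
  by (simp add: lft_def)

lemma rgt_rgt: "rgt A (rgt B f) = rgt (\<lambda>x. A (B x)) f"
  by (simp add: rgt_def)

lemma lft_closed: "\<lbrakk>positive_op (ell2 I) A; f \<in> L2 (I \<times> J)\<rbrakk> \<Longrightarrow> lft A f \<in> L2 (I \<times> J)"
  using positive_closed[OF positive_op_lft] by blast

lemma rgt_closed: "\<lbrakk>positive_op (ell2 J) B; f \<in> L2 (I \<times> J)\<rbrakk> \<Longrightarrow> rgt B f \<in> L2 (I \<times> J)"
  using positive_closed[OF positive_op_rgt] by blast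

lemma lft_cong:
  assumes "\<And>x. x \<in> L2 I \<Longrightarrow> A x = A' x" "f \<in> L2 (I \<times> J)"
  shows "lft A f = lft A' f"
  using assms(1)[OF ell2_slice(2)[OF assms(2)]] by (simp add: lft_def)

lemma rgt_cong:
  assumes "\<And>x. x \<in> L2 J \<Longrightarrow> B x = B' x" "f \<in> L2 (I \<times> J)"
  shows "rgt B f = rgt B' f"
  using assms(1)[OF ell2_slice(1)[OF assms(2)]] by (simp add: rgt_def)

text \<open>A \<otimes> B is the product of A \<otimes> I and I \<otimes> B, which are positive and
  commute; this is where the result on commuting positive operators enters.\<close>

lemma positive_op_lft_rgt:
  assumes "positive_op (ell2 I) A" "positive_op (ell2 J) B"
  shows "positive_op (ell2 (I \<times> J)) (\<lambda>f. lft A (rgt B f))"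
proof -
  interpret hilbert_space "ell2 (I \<times> J)" by (rule hilbert_ell2)
  show ?thesis
    using lft_rgt_commute[OF assms]
    by (intro positive_op_compose_commute[OF positive_op_lft[OF assms(1)] positive_op_rgt[OF assms(2)]])
qed

lemma positive_op_tsum:
  assumes "finite M" "\<And>m. m \<in> M \<Longrightarrow> positive_op (ell2 I) (A m)" "\<And>m. m \<in> M \<Longrightarrow> positive_op (ell2 J) (B m)"
  shows "positive_op (ell2 (I \<times> J)) (tsum M A B)"
proof -
  interpret hilbert_space "ell2 (I \<times> J)" by (rule hilbert_ell2)
  have pos: "positive_op (ell2 (I \<times> J)) (\<lambda>f. lft (A m) (rgt (B m) f))" if "m \<in> M" for m
    using positive_op_lft_rgt[OF assms(2,3)[OF that]] .
  show ?thesis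
  proof (rule positive_op_cong[OF positive_op_finsum[OF assms(1) pos]])
    show "tsum M A B f = (\<Oplus>\<^bsub>ell2 (I \<times> J)\<^esub>m\<in>M. lft (A m) (rgt (B m) f))" if "f \<in> L2 (I \<times> J)" for f
      using positive_closed[OF pos that] by (subst finsum_ell2) (auto simp: tsum_def)
  qed
qed

lemma bounded_op_sum:
  assumes "bounded_op (ell2 I) T" "\<And>a. a \<in> A \<Longrightarrow> f a \<in> L2 I"
  shows "T (\<lambda>i. \<Sum>a\<in>A. f a i) = (\<lambda>i. \<Sum>a\<in>A. T (f a) i)"
proof -
  interpret hilbert_space "ell2 I" by (rule hilbert_ell2)
  have "T (\<Oplus>\<^bsub>ell2 I\<^esub>a\<in>A. f a) = (\<Oplus>\<^bsub>ell2 I\<^esub>a\<in>A. T (f a))"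
    using assms(2) by (intro bounded_op_finsum[OF assms(1)]) auto
  then show ?thesis
    using assms(2) bounded_opD(1)[OF assms(1)] by (simp add: finsum_ell2)
qed

lemma lft_rgt_commute2:
  assumes "positive_op (ell2 I) A" "positive_op (ell2 I) A'" "positive_op (ell2 J) B" "positive_op (ell2 J) B'"
    and cA: "\<And>x. x \<in> L2 I \<Longrightarrow> A (A' x) = A' (A x)"
    and cB: "\<And>x. x \<in> L2 J \<Longrightarrow> B (B' x) = B' (B x)"
    and f: "f \<in> L2 (I \<times> J)"
  shows "lft A (rgt B (lft A' (rgt B' f))) = lft A' (rgt B' (lft A (rgt B f)))"
proof -
  have "lft A (rgt B (lft A' (rgt B' f))) = lft (\<lambda>x. A (A' x)) (rgt (\<lambda>x. B (B' x)) f)"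
    by (simp add: lft_rgt_commute[OF assms(2,3) rgt_closed[OF assms(4) f], symmetric] lft_lft rgt_rgt)
  also have "\<dots> = lft (\<lambda>x. A (A' x)) (rgt B' (rgt B f))"
    using rgt_cong[of J "\<lambda>x. B (B' x)" "\<lambda>x. B' (B x)", OF cB f] by (simp add: rgt_rgt)
  also have "\<dots> = lft A' (lft A (rgt B' (rgt B f)))"
    using lft_cong[of I "\<lambda>x. A (A' x)" "\<lambda>x. A' (A x)", OF cA rgt_closed[OF assms(4) rgt_closed[OF assms(3) f]]]
    by (simp add: lft_lft)
  also have "\<dots> = lft A' (rgt B' (lft A (rgt B f)))"
    by (simp add: lft_rgt_commute[OF assms(1,4) rgt_closed[OF assms(3) f]])
  finally show ?thesis .
qed

lemma tsum_tsum:
  assumes A: "\<And>m. m \<in> M \<Longrightarrow> positive_op (ell2 I) (A m)" and B: "\<And>m. m \<in> M \<Longrightarrow> positive_op (ell2 J) (B m)"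
    and A': "\<And>m. m \<in> M' \<Longrightarrow> positive_op (ell2 I) (A' m)" and B': "\<And>m. m \<in> M' \<Longrightarrow> positive_op (ell2 J) (B' m)"
    and f: "f \<in> L2 (I \<times> J)"
  shows "tsum M A B (tsum M' A' B' f) =
    (\<lambda>k. \<Sum>m\<in>M. \<Sum>m'\<in>M'. lft (A m) (rgt (B m) (lft (A' m') (rgt (B' m') f))) k)"
proof -
  have "lft (A m) (rgt (B m) (tsum M' A' B' f)) =
      (\<lambda>k. \<Sum>m'\<in>M'. lft (A m) (rgt (B m) (lft (A' m') (rgt (B' m') f))) k)" if "m \<in> M" for m
    unfolding tsum_def
    by (rule bounded_op_sum[OF positive_bounded[OF positive_op_lft_rgt[OF A[OF that] B[OF that]]]])
      (rule positive_closed[OF positive_op_lft_rgt[OF A' B'] f])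
  then show ?thesis unfolding tsum_def[of M A B] by simp
qed

lemma tsum_commute:
  assumes A: "\<And>m. m \<in> M \<Longrightarrow> positive_op (ell2 I) (A m)" and B: "\<And>m. m \<in> M \<Longrightarrow> positive_op (ell2 J) (B m)"
    and A': "\<And>m. m \<in> M' \<Longrightarrow> positive_op (ell2 I) (A' m)" and B': "\<And>m. m \<in> M' \<Longrightarrow> positive_op (ell2 J) (B' m)"
    and cA: "\<And>m m' x. \<lbrakk>m \<in> M; m' \<in> M'; x \<in> L2 I\<rbrakk> \<Longrightarrow> A m (A' m' x) = A' m' (A m x)"
    and cB: "\<And>m m' x. \<lbrakk>m \<in> M; m' \<in> M'; x \<in> L2 J\<rbrakk> \<Longrightarrow> B m (B' m' x) = B' m' (B m x)"
    and f: "f \<in> L2 (I \<times> J)"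
  shows "tsum M A B (tsum M' A' B' f) = tsum M' A' B' (tsum M A B f)"
proof -
  have eq: "lft (A m) (rgt (B m) (lft (A' m') (rgt (B' m') f)))
      = lft (A' m') (rgt (B' m') (lft (A m) (rgt (B m) f)))" if "m \<in> M" "m' \<in> M'" for m m'
    using that f by (intro lft_rgt_commute2[where I = I and J = J] A A' B B' cA cB)
  have "tsum M A B (tsum M' A' B' f) =
    (\<lambda>k. \<Sum>m\<in>M. \<Sum>m'\<in>M'. lft (A m) (rgt (B m) (lft (A' m') (rgt (B' m') f))) k)"
    by (rule tsum_tsum) (fact A B A' B' f)+
  also have "\<dots> = (\<lambda>k. \<Sum>m\<in>M. \<Sum>m'\<in>M'. lft (A' m') (rgt (B' m') (lft (A m) (rgt (B m) f))) k)"
    by (simp add: eq cong: sum.cong)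
  also have "\<dots> = (\<lambda>k. \<Sum>m'\<in>M'. \<Sum>m\<in>M. lft (A' m') (rgt (B' m') (lft (A m) (rgt (B m) f))) k)"
    by (rule ext, rule sum.swap)
  also have "\<dots> = tsum M' A' B' (tsum M A B f)"
    by (rule tsum_tsum[symmetric]) (fact A B A' B' f)+
  finally show ?thesis .
qed

text \<open>On a product vector each inner product factorises. With the composed measurements in
  place of the operators, the right-hand side becomes the sum of products of entries that defines
  the composed correlation.\<close>

lemma tsum_tsum_ten:
  assumes A: "\<And>m. m \<in> M \<Longrightarrow> positive_op (ell2 I) (A m)" and B: "\<And>m. m \<in> M \<Longrightarrow> positive_op (ell2 J) (B m)"
    and A': "\<And>m. m \<in> M' \<Longrightarrow> positive_op (ell2 I) (A' m)" and B': "\<And>m. m \<in> M' \<Longrightarrow> positive_op (ell2 J) (B' m)"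
    and x: "x \<in> L2 I" and y: "y \<in> L2 J"
  shows "ip (ell2 (I \<times> J)) (tsum M A B (tsum M' A' B' (ten x y))) (ten x y) =
    (\<Sum>m\<in>M. \<Sum>m'\<in>M'. ip (ell2 I) (A m (A' m' x)) x * ip (ell2 J) (B m (B' m' y)) y)"
proof -
  interpret hilbert_space "ell2 (I \<times> J)" by (rule hilbert_ell2)
  let ?t = "\<lambda>(m, m'). ten (A m (A' m' x)) (B m (B' m' y))"
  have cl': "A' m' x \<in> L2 I" "B' m' y \<in> L2 J" if "m' \<in> M'" for m'
    using positive_closed[OF A'[OF that] x] positive_closed[OF B'[OF that] y] by auto
  have cl: "A m (A' m' x) \<in> L2 I" "B m (B' m' y) \<in> L2 J"
    if "m \<in> M" "m' \<in> M'" for m m'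
    using positive_closed[OF A[OF that(1)] cl'(1)[OF that(2)]]
      positive_closed[OF B[OF that(1)] cl'(2)[OF that(2)]] by auto
  have t': "lft (A m) (rgt (B m) (lft (A' m') (rgt (B' m') (ten x y)))) = ten (A m (A' m' x)) (B m (B' m' y))"
    if m: "m \<in> M" "m' \<in> M'" for m m'
    by (simp only: rgt_ten[OF positive_bounded[OF B'[OF m(2)]] y]
      lft_ten[OF positive_bounded[OF A'[OF m(2)]] x]
      rgt_ten[OF positive_bounded[OF B[OF m(1)]] cl'(2)[OF m(2)]]
      lft_ten[OF positive_bounded[OF A[OF m(1)]] cl'(1)[OF m(2)]])
  have t: "?t p \<in> L2 (I \<times> J)" if "p \<in> M \<times> M'" for p
    using cl that by (auto intro: ten_mem)
  have "tsum M A B (tsum M' A' B' (ten x y)) =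
    (\<lambda>k. \<Sum>m\<in>M. \<Sum>m'\<in>M'. lft (A m) (rgt (B m) (lft (A' m') (rgt (B' m') (ten x y)))) k)"
    by (rule tsum_tsum) (fact A B A' B' ten_mem[OF x y])+
  also have "\<dots> = (\<lambda>k. \<Sum>m\<in>M. \<Sum>m'\<in>M'. ten (A m (A' m' x)) (B m (B' m' y)) k)"
    by (simp add: t' cong: sum.cong)
  also have "\<dots> = (\<lambda>k. \<Sum>p\<in>M \<times> M'. ?t p k)"
    by (simp add: sum.cartesian_product case_prod_beta')
  also have "\<dots> = (\<Oplus>\<^bsub>ell2 (I \<times> J)\<^esub>p\<in>M \<times> M'. ?t p)"
    by (rule finsum_ell2[symmetric]) (rule t)
  finally have "ip (ell2 (I \<times> J)) (tsum M A B (tsum M' A' B' (ten x y))) (ten x y)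
      = (\<Sum>p\<in>M \<times> M'. ip (ell2 (I \<times> J)) (?t p) (ten x y))"
    using ip_finsum[OF ten_mem[OF x y] Pi_I[OF t]] by simp
  also have "\<dots> = (\<Sum>(m, m')\<in>M \<times> M'. ip (ell2 I) (A m (A' m' x)) x * ip (ell2 J) (B m (B' m' y)) y)"
    using cl x y by (intro sum.cong) (auto simp: ip_ten)
  finally show ?thesis by (simp add: sum.cartesian_product)
qed

lemma povm_sum:
  assumes "povm (ell2 I) V P" "x \<in> L2 I"
  shows "(\<Sum>i\<in>V. P i x k) = x k"
proof -
  have "(\<Oplus>\<^bsub>ell2 I\<^esub>i\<in>V. P i x) = (\<lambda>k. \<Sum>i\<in>V. P i x k)"
    using assms by (intro finsum_ell2) (auto simp: povm_def positive_op_def bounded_op_def)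
  then show ?thesis using assms by (simp add: povm_def fun_eq_iff)
qed

lemma povm_ell2I:
  assumes "finite V" "\<And>i. i \<in> V \<Longrightarrow> positive_op (ell2 I) (P i)"
    "\<And>x k. x \<in> L2 I \<Longrightarrow> (\<Sum>i\<in>V. P i x k) = x k"
  shows "povm (ell2 I) V P"
  using assms by (simp add: povm_def finsum_ell2 positive_closed)

lemma povm_lft:
  assumes "povm (ell2 I) V P" "f \<in> L2 (I \<times> J)"
  shows "(\<Sum>i\<in>V. lft (P i) f k) = f k"
  using povm_sum[OF assms(1) ell2_slice(2)[OF assms(2)]] by (cases k) (simp add: lft_def)

lemma povm_rgt:
  assumes "povm (ell2 J) V P" "f \<in> L2 (I \<times> J)"
  shows "(\<Sum>i\<in>V. rgt (P i) f k) = f k"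
  using povm_sum[OF assms(1) ell2_slice(1)[OF assms(2)]] by (cases k) (simp add: rgt_def)

lemma povm_positive: "\<lbrakk>povm H V P; i \<in> V\<rbrakk> \<Longrightarrow> positive_op H (P i)"
  by (simp add: povm_def)

text \<open>The outcome m of B serves as the setting of A. Summing over the outcomes of A first
  collapses each \<open>A m\<close> to the identity, and then the sum over m collapses B.\<close>

lemma povm_tsum_left:
  assumes A: "\<And>m. m \<in> M \<Longrightarrow> povm (ell2 I) V (A m)" and B: "povm (ell2 J) M B" and V: "finite V"
  shows "povm (ell2 (I \<times> J)) V (\<lambda>i. tsum M (\<lambda>m. A m i) B)"
proof (rule povm_ell2I[OF V])
  have M: "finite M" using B by (simp add: povm_def)
  show "positive_op (ell2 (I \<times> J)) (tsum M (\<lambda>m. A m i) B)" if "i \<in> V" for i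
    using A B that by (intro positive_op_tsum M) (auto intro: povm_positive)
  fix f k assume f: "f \<in> L2 (I \<times> J)"
  have "(\<Sum>i\<in>V. tsum M (\<lambda>m. A m i) B f k) = (\<Sum>m\<in>M. \<Sum>i\<in>V. lft (A m i) (rgt (B m) f) k)"
    unfolding tsum_def by (rule sum.swap)
  also have "\<dots> = (\<Sum>m\<in>M. rgt (B m) f k)"
    by (intro sum.cong refl povm_lft[OF A rgt_closed[OF povm_positive[OF B] f]])
  also have "\<dots> = f k" by (rule povm_rgt[OF B f])
  finally show "(\<Sum>i\<in>V. tsum M (\<lambda>m. A m i) B f k) = f k" .
qed

lemma povm_tsum_right:
  assumes A: "povm (ell2 I) M A" and B: "\<And>m. m \<in> M \<Longrightarrow> povm (ell2 J) V (B m)" and V: "finite V"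
  shows "povm (ell2 (I \<times> J)) V (\<lambda>i. tsum M A (\<lambda>m. B m i))"
proof (rule povm_ell2I[OF V])
  have M: "finite M" using A by (simp add: povm_def)
  show "positive_op (ell2 (I \<times> J)) (tsum M A (\<lambda>m. B m i))" if "i \<in> V" for i
    using A B that by (intro positive_op_tsum M) (auto intro: povm_positive)
  fix f k assume f: "f \<in> L2 (I \<times> J)"
  have "(\<Sum>i\<in>V. tsum M A (\<lambda>m. B m i) f k) = (\<Sum>m\<in>M. \<Sum>i\<in>V. lft (A m) (rgt (B m i) f) k)"
    unfolding tsum_def by (rule sum.swap)
  \<comment> \<open>Here the inner sum is over the outcomes of the right factor, so that factor has
    to be brought to the outside before its sum can collapse.\<close>
  also have "\<dots> = (\<Sum>m\<in>M. \<Sum>i\<in>V. rgt (B m i) (lft (A m) f) k)"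
    by (intro sum.cong refl fun_cong[OF lft_rgt_commute[OF povm_positive[OF A] povm_positive[OF B] f]])
  also have "\<dots> = (\<Sum>m\<in>M. lft (A m) f k)"
    by (intro sum.cong refl povm_rgt[OF B lft_closed[OF povm_positive[OF A] f]])
  also have "\<dots> = f k" by (rule povm_lft[OF A f])
  finally show "(\<Sum>i\<in>V. tsum M A (\<lambda>m. B m i) f k) = f k" .
qed

text \<open>Wiring of measurements: on the left the outcome v2 of \<open>E2 v3\<close> becomes the
  setting of \<open>E1\<close>, on the right the outcome w2 of \<open>F1 w1\<close> becomes the
  setting of \<open>F2\<close>. Commutation is inherited factor by factor, and \<Gamma> enters
  through its entries only.\<close>

lemma qc_model_compose:
  assumes fin: "finite V1" "finite W3"
    and 1: "qc_model V2 W1 V1 W2 \<Gamma>1 (ell2 I) \<xi> E1 F1"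
    and 2: "qc_model V3 W2 V2 W3 \<Gamma>2 (ell2 J) \<eta> E2 F2"
    and \<Gamma>: "\<And>v1 w1 v3 w3. \<lbrakk>v1 \<in> V1; w1 \<in> W1; v3 \<in> V3; w3 \<in> W3\<rbrakk> \<Longrightarrow>
      entry \<Gamma> (v1, w3) (v3, w1) =
        (\<Sum>v2\<in>V2. \<Sum>w2\<in>W2. entry \<Gamma>1 (v1, w2) (v2, w1) * entry \<Gamma>2 (v2, w3) (v3, w2))"
  shows "qc_model V3 W1 V1 W3 \<Gamma> (ell2 (I \<times> J)) (ten \<xi> \<eta>)
    (\<lambda>v3 v1. tsum V2 (\<lambda>v2. E1 v2 v1) (E2 v3)) (\<lambda>w1 w3. tsum W2 (F1 w1) (\<lambda>w2. F2 w2 w3))"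
proof -
  interpret I: hilbert_space "ell2 I" by (rule hilbert_ell2)
  interpret J: hilbert_space "ell2 J" by (rule hilbert_ell2)
  interpret IJ: hilbert_space "ell2 (I \<times> J)" by (rule hilbert_ell2)
  have E1: "povm (ell2 I) V1 (E1 v2)" if "v2 \<in> V2" for v2 using 1 that by (simp add: qc_model_def)
  have F1: "povm (ell2 I) W2 (F1 w1)" if "w1 \<in> W1" for w1 using 1 that by (simp add: qc_model_def)
  have E2: "povm (ell2 J) V2 (E2 v3)" if "v3 \<in> V3" for v3 using 2 that by (simp add: qc_model_def)
  have F2: "povm (ell2 J) W3 (F2 w2)" if "w2 \<in> W2" for w2 using 2 that by (simp add: qc_model_def)
  note pos = povm_positive[OF E1] povm_positive[OF F1] povm_positive[OF E2] povm_positive[OF F2]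
  have \<xi>: "\<xi> \<in> L2 I" "ipnorm (ell2 I) \<xi> = 1" and \<eta>: "\<eta> \<in> L2 J" "ipnorm (ell2 J) \<eta> = 1"
    using 1 2 by (auto simp: qc_model_def)
  have "ip (ell2 (I \<times> J)) (ten \<xi> \<eta>) (ten \<xi> \<eta>) = 1"
    using \<xi> \<eta> by (simp add: ip_ten I.ip_self J.ip_self)
  then have "ipnorm (ell2 (I \<times> J)) (ten \<xi> \<eta>) = 1" by (simp add: ipnorm_def)
  moreover have "tsum V2 (\<lambda>v2. E1 v2 v1) (E2 v3) (tsum W2 (F1 w1) (\<lambda>w2. F2 w2 w3) f) =
      tsum W2 (F1 w1) (\<lambda>w2. F2 w2 w3) (tsum V2 (\<lambda>v2. E1 v2 v1) (E2 v3) f)"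
    if "v3 \<in> V3" "v1 \<in> V1" "w1 \<in> W1" "w3 \<in> W3" "f \<in> L2 (I \<times> J)" for v3 v1 w1 w3 f
    using that 1 2 by (intro tsum_commute[where I = I and J = J] pos) (auto simp: qc_model_def)
  moreover have "entry \<Gamma> (v1, w3) (v3, w1) = ip (ell2 (I \<times> J))
      (tsum V2 (\<lambda>v2. E1 v2 v1) (E2 v3) (tsum W2 (F1 w1) (\<lambda>w2. F2 w2 w3) (ten \<xi> \<eta>))) (ten \<xi> \<eta>)"
    if m: "v3 \<in> V3" "v1 \<in> V1" "w1 \<in> W1" "w3 \<in> W3" for v3 v1 w1 w3
  proof -
    have "ip (ell2 (I \<times> J))
        (tsum V2 (\<lambda>v2. E1 v2 v1) (E2 v3) (tsum W2 (F1 w1) (\<lambda>w2. F2 w2 w3) (ten \<xi> \<eta>))) (ten \<xi> \<eta>)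
        = (\<Sum>v2\<in>V2. \<Sum>w2\<in>W2. ip (ell2 I) (E1 v2 v1 (F1 w1 w2 \<xi>)) \<xi> * ip (ell2 J) (E2 v3 v2 (F2 w2 w3 \<eta>)) \<eta>)"
      using m by (intro tsum_tsum_ten pos \<xi> \<eta>)
    also have "\<dots> = (\<Sum>v2\<in>V2. \<Sum>w2\<in>W2. entry \<Gamma>1 (v1, w2) (v2, w1) * entry \<Gamma>2 (v2, w3) (v3, w2))"
      using 1 2 m by (intro sum.cong refl) (auto simp: qc_model_def)
    finally show ?thesis using \<Gamma> m by simp
  qed
  ultimately show ?thesis
    using povm_tsum_left[OF E1 E2 fin(1)] povm_tsum_right[OF F1 F2 fin(2)] ten_mem[OF \<xi>(1) \<eta>(1)]
    by (simp add: qc_model_def IJ.hilbert_space_axioms)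
qed

section \<open>Composition of quantum models\<close>

text \<open>Bounds the size of the sequence space by the type that carried the original space, as
  \<open>ell2_times_lepoll\<close> requires.\<close>

lemma (in hilbert_iso) lepoll_target: "carrier K \<lesssim> (UNIV :: 'h set)"
  unfolding lepoll_def
  using bij_betw_inv_into[OF bij] by (intro exI[of _ V]) (auto simp: bij_betw_def)

lemma qc_model_push:
  fixes H :: "'k ip_module"
  assumes "carrier H \<lesssim> (UNIV :: 'h set)" "qc_model V2 W1 V1 W2 \<Gamma> H \<xi> E F"
  shows "\<exists>(K :: 'h ip_module) \<eta> E' F'. qc_model V2 W1 V1 W2 \<Gamma> K \<eta> E' F'"
proof -
  obtain g :: "'k \<Rightarrow> 'h" where "inj_on g (carrier H)" using assms(1) by (auto simp: lepoll_def)
  moreover have "hilbert_space H" using assms(2) by (simp add: qc_model_def)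
  ultimately have "hilbert_iso H (push H g) g" by (intro push_iso)
  from hilbert_iso.qc_model_conj[OF this assms(2)] show ?thesis by blast
qed

lemma qc_model_to_ell2:
  fixes H :: "'h ip_module"
  assumes "qc_model V2 W1 V1 W2 \<Gamma> H \<xi> E F"
  shows "\<exists>(B :: 'h set) \<eta> E' F'. L2 B \<lesssim> (UNIV :: 'h set) \<and>
    qc_model V2 W1 V1 W2 \<Gamma> (ell2 B) \<eta> E' F'"
proof -
  interpret hilbert_space H using assms by (simp add: qc_model_def)
  obtain B where B: "onb B (\<lambda>x. x)" using onb_exists by blast
  interpret U: hilbert_iso H "ell2 B" "coords B (\<lambda>x. x)" by (rule coords_iso[OF B])
  show ?thesis using U.lepoll_target U.qc_model_conj[OF assms] by blast
qed

lemma qc_model_compose_exists: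
  assumes c: "(UNIV :: complex set) \<lesssim> (UNIV :: 'h set)"
    and fin: "finite V1" "finite W3"
    and 1: "qc_model V2 W1 V1 W2 \<Gamma>1 (H1 :: 'h ip_module) \<xi> E1 F1"
    and 2: "qc_model V3 W2 V2 W3 \<Gamma>2 (H2 :: 'h ip_module) \<eta> E2 F2"
    and \<Gamma>: "\<And>v1 w1 v3 w3. \<lbrakk>v1 \<in> V1; w1 \<in> W1; v3 \<in> V3; w3 \<in> W3\<rbrakk> \<Longrightarrow>
      entry \<Gamma> (v1, w3) (v3, w1) =
        (\<Sum>v2\<in>V2. \<Sum>w2\<in>W2. entry \<Gamma>1 (v1, w2) (v2, w1) * entry \<Gamma>2 (v2, w3) (v3, w2))"
  shows "\<exists>(H :: 'h ip_module) \<zeta> E F. qc_model V3 W1 V1 W3 \<Gamma> H \<zeta> E F"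
proof -
  obtain I :: "'h set" and \<xi>' E1' F1' where I: "L2 I \<lesssim> (UNIV :: 'h set)"
    "qc_model V2 W1 V1 W2 \<Gamma>1 (ell2 I) \<xi>' E1' F1'"
    using qc_model_to_ell2[OF 1] by blast
  obtain J :: "'h set" and \<eta>' E2' F2' where J: "L2 J \<lesssim> (UNIV :: 'h set)"
    "qc_model V3 W2 V2 W3 \<Gamma>2 (ell2 J) \<eta>' E2' F2'"
    using qc_model_to_ell2[OF 2] by blast
  show ?thesis
    by (rule qc_model_push[OF ell2_times_lepoll[OF c I(1) J(1)] qc_model_compose[OF fin I(2) J(2) \<Gamma>]])
qed

text \<open>The bijection \<open>\<pi>\<close> identifies the index set of the joint space with \<open>I \<times> J\<close>. It is the identity for a
  single model; composing two models requires reading \<open>(I1 \<times> J1) \<times> (I2 \<times> J2)\<close> as \<open>(I1 \<times> I2) \<times> (J1 \<times> J2)\<close>.\<close>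

definition q_ell2 ::
  "'v set \<Rightarrow> 'w set \<Rightarrow> 'v set \<Rightarrow> 'w set \<Rightarrow> ('v, 'w) corr \<Rightarrow> 'i set \<Rightarrow> 'j set \<Rightarrow> ('k \<Rightarrow> 'i \<times> 'j) \<Rightarrow> bool"
where
  "q_ell2 V2 W1 V1 W2 \<Gamma> I J \<pi> \<longleftrightarrow> finite I \<and> finite J \<and> bij \<pi> \<and>
     (\<exists>\<xi> E F E' F'. qc_model V2 W1 V1 W2 \<Gamma> (ell2 (\<pi> -` (I \<times> J))) \<xi> E F \<and>
        (\<forall>v2\<in>V2. povm (ell2 I) V1 (E' v2)) \<and> (\<forall>w1\<in>W1. povm (ell2 J) W2 (F' w1)) \<and>
        (\<forall>v2\<in>V2. \<forall>v1\<in>V1. \<forall>x\<in>L2 I. \<forall>y\<in>L2 J.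
           E v2 v1 (ten x y \<circ> \<pi>) = ten (E' v2 v1 x) y \<circ> \<pi>) \<and>
        (\<forall>w1\<in>W1. \<forall>w2\<in>W2. \<forall>x\<in>L2 I. \<forall>y\<in>L2 J.
           F w1 w2 (ten x y \<circ> \<pi>) = ten x (F' w1 w2 y) \<circ> \<pi>))"

text \<open>For completeness, orthogonality to the basis tensors is extended by expanding first the
  left and then the right factor, up to all elementary tensors. As z is a finite sum of these, it is
  orthogonal to itself.\<close>

lemma onb_tensor:
  assumes t: "hilbert_tensor HV HW H \<tau>"
    and I: "finite I" "hilbert_space.onb HV I (\<lambda>x. x)" and J: "finite J" "hilbert_space.onb HW J (\<lambda>x. x)"
  shows "hilbert_space.onb H (I \<times> J) (\<lambda>(b, c). \<tau> b c)"
proof -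
  interpret V: hilbert_space HV using t by (simp add: hilbert_tensor_def)
  interpret W: hilbert_space HW using t by (simp add: hilbert_tensor_def)
  interpret H: hilbert_space H using t by (simp add: hilbert_tensor_def)
  have cl: "\<tau> x y \<in> carrier H" if "x \<in> carrier HV" "y \<in> carrier HW" for x y
    using t that unfolding hilbert_tensor_def by blast
  have add1: "\<tau> (x \<oplus>\<^bsub>HV\<^esub> x') y = \<tau> x y \<oplus>\<^bsub>H\<^esub> \<tau> x' y" if "x \<in> carrier HV" "x' \<in> carrier HV" "y \<in> carrier HW" for x x' y
    using t that unfolding hilbert_tensor_def by blast
  have add2: "\<tau> x (y \<oplus>\<^bsub>HW\<^esub> y') = \<tau> x y \<oplus>\<^bsub>H\<^esub> \<tau> x y'" if "x \<in> carrier HV" "y \<in> carrier HW" "y' \<in> carrier HW" for x y y'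
    using t that unfolding hilbert_tensor_def by blast
  have sc1: "\<tau> (a \<odot>\<^bsub>HV\<^esub> x) y = a \<odot>\<^bsub>H\<^esub> \<tau> x y" and sc2: "\<tau> x (a \<odot>\<^bsub>HW\<^esub> y) = a \<odot>\<^bsub>H\<^esub> \<tau> x y"
    if "x \<in> carrier HV" "y \<in> carrier HW" for a x y
    using t that unfolding hilbert_tensor_def by blast+
  have ipt: "ip H (\<tau> x y) (\<tau> x' y') = ip HV x x' * ip HW y y'"
    if "x \<in> carrier HV" "x' \<in> carrier HV" "y \<in> carrier HW" "y' \<in> carrier HW" for x x' y y'
    using t that unfolding hilbert_tensor_def by blast
  have Ic: "b \<in> carrier HV" if "b \<in> I" for b using I(2) that by (simp add: V.onb_def V.orthonormal_def)
  have Jc: "c \<in> carrier HW" if "c \<in> J" for c using J(2) that by (simp add: W.onb_def W.orthonormal_def)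
  have "H.orthonormal (I \<times> J) (\<lambda>(b, c). \<tau> b c)"
    unfolding H.orthonormal_def
  proof (intro conjI ballI)
    show "(case p of (b, c) \<Rightarrow> \<tau> b c) \<in> carrier H" if "p \<in> I \<times> J" for p
      using that by (auto intro: cl Ic Jc)
    show "ip H (case p of (b, c) \<Rightarrow> \<tau> b c) (case q of (b, c) \<Rightarrow> \<tau> b c) = (if p = q then 1 else 0)"
      if "p \<in> I \<times> J" "q \<in> I \<times> J" for p q
    proof -
      obtain b c b' c' where "p = (b, c)" "q = (b', c')" by (cases p, cases q)
      then show ?thesis
        using that ipt[OF Ic Ic Jc Jc] I(2) J(2)
        by (auto simp: V.onb_def V.orthonormal_def W.onb_def W.orthonormal_def)
    qed
  qed
  moreover have "z = \<zero>\<^bsub>H\<^esub>" if z: "z \<in> carrier H" and perp: "\<forall>p\<in>I \<times> J. ip H z (case p of (b, c) \<Rightarrow> \<tau> b c) = 0" for z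
  proof -
    have 1: "ip H z (\<tau> x c) = 0" if x: "x \<in> carrier HV" and c: "c \<in> J" for x c
    proof -
      have "ip H z (\<tau> (\<Oplus>\<^bsub>HV\<^esub>b\<in>I. ip HV x b \<odot>\<^bsub>HV\<^esub> b) c) = 0"
      proof (rule V.finsum_induct)
        \<comment> \<open>\<tau> vanishes at a zero argument because it is homogeneous in each
          variable.\<close>
        have "\<tau> (0 \<odot>\<^bsub>HV\<^esub> \<zero>\<^bsub>HV\<^esub>) c = 0 \<odot>\<^bsub>H\<^esub> \<tau> \<zero>\<^bsub>HV\<^esub> c" using Jc[OF c] by (intro sc1) auto
        then have "\<tau> \<zero>\<^bsub>HV\<^esub> c = \<zero>\<^bsub>H\<^esub>" using cl[of "\<zero>\<^bsub>HV\<^esub>" c] Jc[OF c] by simp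
        then show "ip H z (\<tau> \<zero>\<^bsub>HV\<^esub> c) = 0" using z by simp
        show "ip H z (\<tau> (u \<oplus>\<^bsub>HV\<^esub> v) c) = 0"
          if "u \<in> carrier HV" "v \<in> carrier HV" "ip H z (\<tau> u c) = 0" "ip H z (\<tau> v c) = 0" for u v
          using that z Jc[OF c] cl by (simp add: add1 H.ip_add_right)
        show "ip H z (\<tau> (ip HV x b \<odot>\<^bsub>HV\<^esub> b) c) = 0" if "b \<in> I" for b
          using that z Jc[OF c] Ic[OF that] cl perp c by (auto simp: sc1 H.ip_scale_right)
      qed (use I Ic in auto)
      then show ?thesis using V.onb_expand[OF I(2,1) x] by simp
    qed
    have 2: "ip H z (\<tau> x y) = 0" if x: "x \<in> carrier HV" and y: "y \<in> carrier HW" for x y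
    proof -
      have "ip H z (\<tau> x (\<Oplus>\<^bsub>HW\<^esub>c\<in>J. ip HW y c \<odot>\<^bsub>HW\<^esub> c)) = 0"
      proof (rule W.finsum_induct)
        have "\<tau> x (0 \<odot>\<^bsub>HW\<^esub> \<zero>\<^bsub>HW\<^esub>) = 0 \<odot>\<^bsub>H\<^esub> \<tau> x \<zero>\<^bsub>HW\<^esub>" using x by (intro sc2) auto
        then have "\<tau> x \<zero>\<^bsub>HW\<^esub> = \<zero>\<^bsub>H\<^esub>" using cl[of x "\<zero>\<^bsub>HW\<^esub>"] x by simp
        then show "ip H z (\<tau> x \<zero>\<^bsub>HW\<^esub>) = 0" using z by simp
        show "ip H z (\<tau> x (u \<oplus>\<^bsub>HW\<^esub> v)) = 0"
          if "u \<in> carrier HW" "v \<in> carrier HW" "ip H z (\<tau> x u) = 0" "ip H z (\<tau> x v) = 0" for u v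
          using that z x cl by (simp add: add2 H.ip_add_right)
        show "ip H z (\<tau> x (ip HW y c \<odot>\<^bsub>HW\<^esub> c)) = 0" if "c \<in> J" for c
          using that z x Jc[OF that] cl 1 by (auto simp: sc2 H.ip_scale_right)
      qed (use J Jc in auto)
      then show ?thesis using W.onb_expand[OF J(2,1) y] by simp
    qed
    obtain n :: nat and X Y where XY: "\<And>i. i < n \<Longrightarrow> X i \<in> carrier HV \<and> Y i \<in> carrier HW"
      "z = (\<Oplus>\<^bsub>H\<^esub>i\<in>{..<n}. \<tau> (X i) (Y i))"
      using t z unfolding hilbert_tensor_def by metis
    have "ip H (\<Oplus>\<^bsub>H\<^esub>i\<in>{..<n}. \<tau> (X i) (Y i)) z = (\<Sum>i<n. ip H (\<tau> (X i) (Y i)) z)"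
      using XY(1) cl by (intro H.ip_finsum[OF z]) auto
    also have "\<dots> = 0"
      using XY(1) 2 cl z by (intro sum.neutral) (auto intro: H.ip_commute_0)
    finally have "ip H z z = 0" by (simp only: XY(2)[symmetric])
    then show ?thesis using H.ip_definite z by blast
  qed
  ultimately show ?thesis by (auto simp: H.onb_def)
qed

text \<open>The basis of H has to be the product of the bases of the factors: only then does the
  coordinate map send \<tau> x y to \<open>ten\<close> of the coordinates, so that the product form
  of the operators survives.\<close>

lemma q_corr_to_ell2:
  assumes "q_corr TYPE('h) V2 W1 V1 W2 \<Gamma>"
  shows "\<exists>(I :: 'h set) (J :: 'h set). q_ell2 V2 W1 V1 W2 \<Gamma> I J id"
proof -
  obtain H :: "'h ip_module" and \<xi> E F HV HW \<tau> E' F' where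
    qc: "qc_model V2 W1 V1 W2 \<Gamma> H \<xi> E F" and t: "hilbert_tensor HV HW H \<tau>"
    and fd: "finite_dim HV" "finite_dim HW"
    and E': "\<forall>v2\<in>V2. povm HV V1 (E' v2)" and F': "\<forall>w1\<in>W1. povm HW W2 (F' w1)"
    and E: "\<forall>v2\<in>V2. \<forall>v1\<in>V1. \<forall>x\<in>carrier HV. \<forall>y\<in>carrier HW. E v2 v1 (\<tau> x y) = \<tau> (E' v2 v1 x) y"
    and F: "\<forall>w1\<in>W1. \<forall>w2\<in>W2. \<forall>x\<in>carrier HV. \<forall>y\<in>carrier HW. F w1 w2 (\<tau> x y) = \<tau> x (F' w1 w2 y)"
    using assms unfolding q_corr_def by blast
  note E' = E'[rule_format] and F' = F'[rule_format] and E = E[rule_format] and F = F[rule_format]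
  interpret V: hilbert_space HV using t by (simp add: hilbert_tensor_def)
  interpret W: hilbert_space HW using t by (simp add: hilbert_tensor_def)
  interpret H: hilbert_space H using t by (simp add: hilbert_tensor_def)
  have cl: "\<tau> x y \<in> carrier H" if "x \<in> carrier HV" "y \<in> carrier HW" for x y
    using t that unfolding hilbert_tensor_def by blast
  have ipt: "ip H (\<tau> x y) (\<tau> x' y') = ip HV x x' * ip HW y y'"
    if "x \<in> carrier HV" "x' \<in> carrier HV" "y \<in> carrier HW" "y' \<in> carrier HW" for x x' y y'
    using t that unfolding hilbert_tensor_def by blast
  obtain I where I: "finite I" "I \<subseteq> carrier HV" "V.onb I (\<lambda>x. x)" using V.finite_onb_exists[OF fd(1)] by blast
  obtain J where J: "finite J" "J \<subseteq> carrier HW" "W.onb J (\<lambda>x. x)" using W.finite_onb_exists[OF fd(2)] by blast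
  note IJ = onb_tensor[OF t I(1,3) J(1,3)]
  interpret UV: hilbert_iso HV "ell2 I" "V.coords I (\<lambda>x. x)" by (rule V.coords_iso[OF I(3)])
  interpret UW: hilbert_iso HW "ell2 J" "W.coords J (\<lambda>x. x)" by (rule W.coords_iso[OF J(3)])
  interpret U: hilbert_iso H "ell2 (I \<times> J)" "H.coords (I \<times> J) (\<lambda>(b, c). \<tau> b c)" by (rule H.coords_iso[OF IJ])
  let ?U = "H.coords (I \<times> J) (\<lambda>(b, c). \<tau> b c)" and ?UV = "V.coords I (\<lambda>x. x)" and ?UW = "W.coords J (\<lambda>x. x)"
  have U\<tau>: "?U (\<tau> x y) = ten (?UV x) (?UW y)" if xy: "x \<in> carrier HV" "y \<in> carrier HW" for x y
  proof
    fix p :: "'h \<times> 'h"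
    obtain b c where p: "p = (b, c)" by (cases p)
    show "?U (\<tau> x y) p = ten (?UV x) (?UW y) p"
      using ipt[OF xy(1) _ xy(2)] I(2) J(2)
      by (auto simp: p H.coords_def V.coords_def W.coords_def ten_def)
  qed
  have V\<tau>: "U.V (ten x y) = \<tau> (UV.V x) (UW.V y)" if xy: "x \<in> L2 I" "y \<in> L2 J" for x y
    using U\<tau>[OF UV.V_closed[OF xy(1)] UW.V_closed[OF xy(2)]] xy
      U.V_U[OF cl[OF UV.V_closed[OF xy(1)] UW.V_closed[OF xy(2)]]] by simp
  have cE: "U.conj_op (E v2 v1) (ten x y) = ten (UV.conj_op (E' v2 v1) x) y"
    if m: "v2 \<in> V2" "v1 \<in> V1" and xy: "x \<in> L2 I" "y \<in> L2 J" for v2 v1 x y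
  proof -
    have "E' v2 v1 (UV.V x) \<in> carrier HV"
      using UV.povm_closed[OF E'[OF m(1)] m(2)] xy by simp
    then show ?thesis
      using xy m by (simp add: U.conj_op_def UV.conj_op_def V\<tau> E U\<tau>)
  qed
  have cF: "U.conj_op (F w1 w2) (ten x y) = ten x (UW.conj_op (F' w1 w2) y)"
    if m: "w1 \<in> W1" "w2 \<in> W2" and xy: "x \<in> L2 I" "y \<in> L2 J" for w1 w2 x y
  proof -
    have "F' w1 w2 (UW.V y) \<in> carrier HW"
      using UW.povm_closed[OF F'[OF m(1)] m(2)] xy by simp
    then show ?thesis
      using xy m by (simp add: U.conj_op_def UW.conj_op_def V\<tau> F U\<tau>)
  qed
  have "q_ell2 V2 W1 V1 W2 \<Gamma> I J id"
    unfolding q_ell2_def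
  proof (intro conjI exI)
    show "qc_model V2 W1 V1 W2 \<Gamma> (ell2 (id -` (I \<times> J))) (?U \<xi>)
        (\<lambda>v2 v1. U.conj_op (E v2 v1)) (\<lambda>w1 w2. U.conj_op (F w1 w2))"
      using U.qc_model_conj[OF qc] by simp
    show "\<forall>v2\<in>V2. povm (ell2 I) V1 (\<lambda>v1. UV.conj_op (E' v2 v1))" using UV.povm_conj E' by blast
    show "\<forall>w1\<in>W1. povm (ell2 J) W2 (\<lambda>w2. UW.conj_op (F' w1 w2))" using UW.povm_conj F' by blast
  qed (use I J cE cF in auto)
  then show ?thesis by blast
qed

lemma delta_expand:
  assumes "finite I" "x \<in> L2 I"
  shows "x = (\<lambda>k. \<Sum>i\<in>I. x i * delta i k)"
proof
  fix k
  have "(\<Sum>i\<in>I. x i * delta i k) = (\<Sum>i\<in>I. if k = i then x i else 0)"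
    by (intro sum.cong) (auto simp: delta_def)
  then show "x k = (\<Sum>i\<in>I. x i * delta i k)" using assms by (simp add: ell2_mem_iff)
qed

text \<open>\<open>finite_dim\<close> indexes coefficients by the spanning vectors themselves,
  whereas d is a family; its injectivity lets the coefficients be read back from the
  vectors.\<close>

lemma (in hilbert_iso) finite_dim_target:
  fixes I :: "'i set"
  assumes "finite I" "\<And>i. i \<in> I \<Longrightarrow> d i \<in> carrier H"
    and span: "\<And>x. x \<in> carrier H \<Longrightarrow> \<exists>c. x = (\<Oplus>\<^bsub>H\<^esub>i\<in>I. c i \<odot>\<^bsub>H\<^esub> d i)" and inj: "inj_on d I"
  shows "finite_dim K"
  unfolding finite_dim_def
proof (intro exI[of _ "(\<lambda>i. U (d i)) ` I"] conjI ballI)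
  show "finite ((\<lambda>i. U (d i)) ` I)" using assms by simp
  show "(\<lambda>i. U (d i)) ` I \<subseteq> carrier K" using assms by auto
  fix y assume y: "y \<in> carrier K"
  obtain c where c: "V y = (\<Oplus>\<^bsub>H\<^esub>i\<in>I. c i \<odot>\<^bsub>H\<^esub> d i)" using span[OF V_closed[OF y]] by blast
  have inj': "inj_on (\<lambda>i. U (d i)) I"
    using inj assms(2) bij by (auto simp: inj_on_def bij_betw_def)
  let ?c = "\<lambda>b. c (inv_into I (\<lambda>i. U (d i)) b)"
  have "(\<Oplus>\<^bsub>K\<^esub>b\<in>(\<lambda>i. U (d i)) ` I. ?c b \<odot>\<^bsub>K\<^esub> b) = (\<Oplus>\<^bsub>K\<^esub>i\<in>I. ?c (U (d i)) \<odot>\<^bsub>K\<^esub> U (d i))"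
    using assms(2) by (intro K.M.finsum_reindex inj') auto
  also have "\<dots> = (\<Oplus>\<^bsub>K\<^esub>i\<in>I. U (c i \<odot>\<^bsub>H\<^esub> d i))"
    using assms(2) by (intro K.M.finsum_cong') (auto simp: U_scale inv_into_f_f[OF inj'])
  also have "\<dots> = U (V y)"
    unfolding c using assms(2) by (intro U_finsum[symmetric]) auto
  finally show "\<exists>c. y = (\<Oplus>\<^bsub>K\<^esub>b\<in>(\<lambda>i. U (d i)) ` I. c b \<odot>\<^bsub>K\<^esub> b)" using y by (intro exI[of _ ?c]) simp
qed

lemma finite_dim_ell2_iso:
  assumes "hilbert_iso (ell2 I) K U" "finite I"
  shows "finite_dim K"
proof (rule hilbert_iso.finite_dim_target[OF assms(1,2)])
  show d: "delta i \<in> L2 I" if "i \<in> I" for i using that by (rule delta_mem)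
  show "\<exists>c. x = (\<Oplus>\<^bsub>ell2 I\<^esub>i\<in>I. c i \<odot>\<^bsub>ell2 I\<^esub> delta i)" if "x \<in> L2 I" for x
    using delta_expand[OF assms(2) that] finsum_ell2[of I "\<lambda>i k. x i * delta i k" I] ell2_scale_closed[OF d]
    by (intro exI[of _ x]) simp
  show "inj_on delta I" by (auto simp: inj_on_def delta_def fun_eq_iff split: if_splits)
qed

lemma q_corr_from_ell2:
  fixes I :: "'i set" and J :: "'j set" and \<pi> :: "'k \<Rightarrow> 'i \<times> 'j"
  assumes c: "(UNIV :: complex set) \<lesssim> (UNIV :: 'h set)" and ns: "ns_corr V2 W1 V1 W2 \<Gamma>"
    and q: "q_ell2 V2 W1 V1 W2 \<Gamma> I J \<pi>"
  shows "q_corr TYPE('h) V2 W1 V1 W2 \<Gamma>"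
proof -
  obtain \<xi> E F E' F' where fin: "finite I" "finite J" and \<pi>: "bij \<pi>"
    and qc: "qc_model V2 W1 V1 W2 \<Gamma> (ell2 (\<pi> -` (I \<times> J))) \<xi> E F"
    and E': "\<forall>v2\<in>V2. povm (ell2 I) V1 (E' v2)" and F': "\<forall>w1\<in>W1. povm (ell2 J) W2 (F' w1)"
    and E: "\<forall>v2\<in>V2. \<forall>v1\<in>V1. \<forall>x\<in>L2 I. \<forall>y\<in>L2 J. E v2 v1 (ten x y \<circ> \<pi>) = ten (E' v2 v1 x) y \<circ> \<pi>"
    and F: "\<forall>w1\<in>W1. \<forall>w2\<in>W2. \<forall>x\<in>L2 I. \<forall>y\<in>L2 J. F w1 w2 (ten x y \<circ> \<pi>) = ten x (F' w1 w2 y) \<circ> \<pi>"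
    using q unfolding q_ell2_def by blast
  note E' = E'[rule_format] and F' = F'[rule_format] and E = E[rule_format] and F = F[rule_format]
  let ?K = "\<pi> -` (I \<times> J)"
  have finK: "finite ?K" using \<pi> fin by (intro finite_vimageI) (auto simp: bij_def)
  have "L2 I \<lesssim> (UNIV :: 'h set)" "L2 J \<lesssim> (UNIV :: 'h set)" "L2 ?K \<lesssim> (UNIV :: 'h set)"
    using lepoll_trans[OF ell2_finite_lepoll c] fin finK by blast+
  \<comment> \<open>\<open>hilbert_tensor\<close> wants all three spaces on one type. They are
    embedded in \<open>'h\<close> independently of each other, and \<tau> is computed by going back
    to the sequence spaces.\<close>
  then obtain gV :: "_ \<Rightarrow> 'h" and gW :: "_ \<Rightarrow> 'h" and gH :: "_ \<Rightarrow> 'h" where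
    g: "inj_on gV (L2 I)" "inj_on gW (L2 J)" "inj_on gH (L2 ?K)"
    unfolding lepoll_def by blast
  define HV where "HV = push (ell2 I) gV"
  define HW where "HW = push (ell2 J) gW"
  define H where "H = push (ell2 ?K) gH"
  interpret UV: hilbert_iso "ell2 I" HV gV unfolding HV_def by (rule push_iso[OF hilbert_ell2 g(1)])
  interpret UW: hilbert_iso "ell2 J" HW gW unfolding HW_def by (rule push_iso[OF hilbert_ell2 g(2)])
  interpret U: hilbert_iso "ell2 ?K" H gH unfolding H_def by (rule push_iso[OF hilbert_ell2 g(3)])
  interpret R: hilbert_iso "ell2 (I \<times> J)" "ell2 ?K" "\<lambda>f. f \<circ> \<pi>"
    using \<pi> by (intro ell2_reindex) auto
  define \<tau> where "\<tau> x y = gH (ten (UV.V x) (UW.V y) \<circ> \<pi>)" for x y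
  have tc: "ten x y \<circ> \<pi> \<in> L2 ?K" if "x \<in> L2 I" "y \<in> L2 J" for x y
    using R.U_closed[OF ten_mem[OF that]] .
  have tensor: "hilbert_tensor HV HW H \<tau>"
    unfolding hilbert_tensor_def
  proof (intro conjI ballI allI)
    show "hilbert_space HV" "hilbert_space HW" "hilbert_space H"
      by (rule UV.K.hilbert_space_axioms UW.K.hilbert_space_axioms U.K.hilbert_space_axioms)+
    fix x x' y y' a assume xy: "x \<in> carrier HV" "y \<in> carrier HW"
    note xyc = UV.V_closed[OF xy(1)] UW.V_closed[OF xy(2)]
    show "\<tau> x y \<in> carrier H" unfolding \<tau>_def by (rule U.U_closed[OF tc[OF xyc]])
    show "\<tau> (a \<odot>\<^bsub>HV\<^esub> x) y = a \<odot>\<^bsub>H\<^esub> \<tau> x y" "\<tau> x (a \<odot>\<^bsub>HW\<^esub> y) = a \<odot>\<^bsub>H\<^esub> \<tau> x y"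
      unfolding \<tau>_def U.U_scale[OF tc[OF xyc], symmetric]
      using xy by (simp_all add: UV.V_scale UW.V_scale ten_def comp_def case_prod_beta' mult.assoc mult.left_commute)
    show "\<tau> (x \<oplus>\<^bsub>HV\<^esub> x') y = \<tau> x y \<oplus>\<^bsub>H\<^esub> \<tau> x' y" if x': "x' \<in> carrier HV"
      unfolding \<tau>_def U.U_add[OF tc[OF xyc] tc[OF UV.V_closed[OF x'] xyc(2)], symmetric]
      using xy x' by (simp add: UV.V_add ten_def comp_def case_prod_beta' distrib_right)
    show "\<tau> x (y \<oplus>\<^bsub>HW\<^esub> y') = \<tau> x y \<oplus>\<^bsub>H\<^esub> \<tau> x y'" if y': "y' \<in> carrier HW"
      unfolding \<tau>_def U.U_add[OF tc[OF xyc] tc[OF xyc(1) UW.V_closed[OF y']], symmetric]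
      using xy y' by (simp add: UW.V_add ten_def comp_def case_prod_beta' distrib_left)
    show "ip H (\<tau> x y) (\<tau> x' y') = ip HV x x' * ip HW y y'" if "x' \<in> carrier HV" "y' \<in> carrier HW"
    proof -
      note xyc' = UV.V_closed[OF that(1)] UW.V_closed[OF that(2)]
      have "ip H (\<tau> x y) (\<tau> x' y') = ip (ell2 (I \<times> J)) (ten (UV.V x) (UW.V y)) (ten (UV.V x') (UW.V y'))"
        unfolding \<tau>_def U.U_ip[OF tc[OF xyc] tc[OF xyc']] R.U_ip[OF ten_mem[OF xyc] ten_mem[OF xyc']] ..
      then show ?thesis using xy that by (simp add: ip_ten[OF xyc xyc'] UV.V_ip UW.V_ip)
    qed
  next
    fix z assume z: "z \<in> carrier H"
    define f where "f = R.V (U.V z)"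
    have f: "f \<in> L2 (I \<times> J)" using z by (simp add: f_def)
    have zf: "z = gH (f \<circ> \<pi>)" using z by (simp add: f_def)
    obtain h where h: "bij_betw h {..<card (I \<times> J)} (I \<times> J)"
      using ex_bij_betw_nat_finite[of "I \<times> J"] fin by (auto simp: atLeast0LessThan)
    define n where "n = card (I \<times> J)"
    have h: "h m \<in> I \<times> J" if "m < n" for m using h that by (auto simp: bij_betw_def n_def)
    have hb: "bij_betw h {..<n} (I \<times> J)" unfolding n_def by fact
    \<comment> \<open>The unit function at a pair is the elementary tensor of two unit functions.
      The coefficient of f is put into the second factor, as elementary tensors are summed without
      coefficients.\<close>
    let ?x = "\<lambda>m. delta (fst (h m)) :: 'i \<Rightarrow> complex" and ?y = "\<lambda>m j. f (h m) * delta (snd (h m)) j"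
    have xc: "?x m \<in> L2 I" and yc: "?y m \<in> L2 J" if "m < n" for m
      using h[OF that] by (auto intro!: delta_mem ell2_scale_closed)
    have "f = (\<lambda>k. \<Sum>p\<in>I \<times> J. f p * delta p k)" by (rule delta_expand[OF _ f]) (use fin in simp)
    also have "\<dots> = (\<lambda>k. \<Sum>m<n. f (h m) * delta (h m) k)"
      by (rule ext, rule sum.reindex_bij_betw[OF hb, symmetric])
    also have "\<dots> = (\<lambda>k. \<Sum>m<n. ten (?x m) (?y m) k)"
      by (rule ext, rule sum.cong[OF refl]) (auto simp: ten_def delta_def prod_eq_iff split: prod.splits)
    finally have fe: "f = (\<lambda>k. \<Sum>m<n. ten (?x m) (?y m) k)" .
    have "f \<circ> \<pi> = (\<lambda>k. \<Sum>m<n. (ten (?x m) (?y m) \<circ> \<pi>) k)"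
      unfolding comp_def by (rule ext) (rule fun_cong[OF fe])
    also have "\<dots> = (\<Oplus>\<^bsub>ell2 ?K\<^esub>m\<in>{..<n}. ten (?x m) (?y m) \<circ> \<pi>)"
      by (rule finsum_ell2[symmetric], rule tc) (simp_all add: xc yc)
    finally have "z = gH (\<Oplus>\<^bsub>ell2 ?K\<^esub>m\<in>{..<n}. ten (?x m) (?y m) \<circ> \<pi>)" using zf by simp
    also have "\<dots> = (\<Oplus>\<^bsub>H\<^esub>m\<in>{..<n}. gH (ten (?x m) (?y m) \<circ> \<pi>))"
      by (rule U.U_finsum, rule Pi_I, rule tc) (simp_all add: xc yc)
    also have "\<dots> = (\<Oplus>\<^bsub>H\<^esub>m\<in>{..<n}. \<tau> (gV (?x m)) (gW (?y m)))"
      using xc yc tc by (intro U.K.M.finsum_cong') (auto simp: \<tau>_def)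
    finally show "\<exists>(n::nat) X Y. (\<forall>i<n. X i \<in> carrier HV \<and> Y i \<in> carrier HW) \<and>
        z = (\<Oplus>\<^bsub>H\<^esub>i\<in>{..<n}. \<tau> (X i) (Y i))"
      using xc yc by (intro exI[of _ n] exI[of _ "\<lambda>m. gV (?x m)"] exI[of _ "\<lambda>m. gW (?y m)"]) auto
  qed
  have cE: "U.conj_op (E v2 v1) (\<tau> x y) = \<tau> (UV.conj_op (E' v2 v1) x) y"
    if m: "v2 \<in> V2" "v1 \<in> V1" and xy: "x \<in> carrier HV" "y \<in> carrier HW" for v2 v1 x y
  proof -
    have "E' v2 v1 (UV.V x) \<in> L2 I"
      using UV.povm_closed[OF E'[OF m(1)] m(2)] xy by simp
    then show ?thesis
      using xy m by (simp add: U.conj_op_def UV.conj_op_def \<tau>_def tc E)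
  qed
  have cF: "U.conj_op (F w1 w2) (\<tau> x y) = \<tau> x (UW.conj_op (F' w1 w2) y)"
    if m: "w1 \<in> W1" "w2 \<in> W2" and xy: "x \<in> carrier HV" "y \<in> carrier HW" for w1 w2 x y
  proof -
    have "F' w1 w2 (UW.V y) \<in> L2 J"
      using UW.povm_closed[OF F'[OF m(1)] m(2)] xy by simp
    then show ?thesis
      using xy m by (simp add: U.conj_op_def UW.conj_op_def \<tau>_def tc F)
  qed
  have "finite_dim HV" "finite_dim HW"
    using finite_dim_ell2_iso[OF UV.hilbert_iso_axioms fin(1)] finite_dim_ell2_iso[OF UW.hilbert_iso_axioms fin(2)] .
  then show ?thesis
    unfolding q_corr_def
    using ns tensor U.qc_model_conj[OF qc] UV.povm_conj[OF E'] UW.povm_conj[OF F'] cE cF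
    by (intro conjI exI[of _ H] exI[of _ "gH \<xi>"] exI[of _ "\<lambda>v2 v1. U.conj_op (E v2 v1)"]
      exI[of _ "\<lambda>w1 w2. U.conj_op (F w1 w2)"] exI[of _ HV] exI[of _ HW] exI[of _ \<tau>]
      exI[of _ "\<lambda>v2 v1. UV.conj_op (E' v2 v1)"] exI[of _ "\<lambda>w1 w2. UW.conj_op (F' w1 w2)"]) auto
qed

section \<open>Regrouping four tensor factors\<close>

definition mid_swap :: "('a \<times> 'b) \<times> ('c \<times> 'd) \<Rightarrow> ('a \<times> 'c) \<times> ('b \<times> 'd)" where
  "mid_swap = (\<lambda>((a, b), (c, d)). ((a, c), (b, d)))"

lemma bij_mid_swap: "bij mid_swap"
  by (rule bij_betw_byWitness[where f' = "\<lambda>((a, c), (b, d)). ((a, b), (c, d))"])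
    (auto simp: mid_swap_def)

lemma mid_swap_vimage: "mid_swap -` ((I1 \<times> I2) \<times> (J1 \<times> J2)) = (I1 \<times> J1) \<times> (I2 \<times> J2)"
  by (auto simp: mid_swap_def)

text \<open>With i2 and j2 fixed, \<open>ten x y\<close> read through \<open>mid_swap\<close> is
  again an elementary tensor, in the variables i1 and j1, so the factorisation of A applies to every
  slice.\<close>

lemma lft_mid_swap:
  fixes x :: "'i1 \<times> 'i2 \<Rightarrow> complex" and y :: "'j1 \<times> 'j2 \<Rightarrow> complex"
  assumes "\<And>u v. \<lbrakk>u \<in> L2 I1; v \<in> L2 J1\<rbrakk> \<Longrightarrow> A (ten u v) = ten (B u) (C v)"
    "x \<in> L2 (I1 \<times> I2)" "y \<in> L2 (J1 \<times> J2)"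
  shows "lft A (ten x y \<circ> mid_swap) = ten (lft B x) (lft C y) \<circ> mid_swap"
proof
  fix k :: "('i1 \<times> 'j1) \<times> ('i2 \<times> 'j2)"
  obtain i1 j1 i2 j2 where k: "k = ((i1, j1), (i2, j2))" by (metis prod.exhaust)
  have "(\<lambda>p. (ten x y \<circ> mid_swap) (p, (i2, j2))) = ten (\<lambda>i. x (i, i2)) (\<lambda>j. y (j, j2))"
    by (auto simp: ten_def mid_swap_def)
  then show "lft A (ten x y \<circ> mid_swap) k = (ten (lft B x) (lft C y) \<circ> mid_swap) k"
    using assms(1)[OF ell2_slice(2)[OF assms(2)] ell2_slice(2)[OF assms(3)]]
    by (simp add: k lft_def) (simp add: ten_def mid_swap_def lft_def)
qed

lemma rgt_mid_swap:
  fixes x :: "'i1 \<times> 'i2 \<Rightarrow> complex" and y :: "'j1 \<times> 'j2 \<Rightarrow> complex"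
  assumes "\<And>u v. \<lbrakk>u \<in> L2 I2; v \<in> L2 J2\<rbrakk> \<Longrightarrow> A (ten u v) = ten (B u) (C v)"
    "x \<in> L2 (I1 \<times> I2)" "y \<in> L2 (J1 \<times> J2)"
  shows "rgt A (ten x y \<circ> mid_swap) = ten (rgt B x) (rgt C y) \<circ> mid_swap"
proof
  fix k :: "('i1 \<times> 'j1) \<times> ('i2 \<times> 'j2)"
  obtain i1 j1 i2 j2 where k: "k = ((i1, j1), (i2, j2))" by (metis prod.exhaust)
  have "(\<lambda>p. (ten x y \<circ> mid_swap) ((i1, j1), p)) = ten (\<lambda>i. x (i1, i)) (\<lambda>j. y (j1, j))"
    by (auto simp: ten_def mid_swap_def)
  then show "rgt A (ten x y \<circ> mid_swap) k = (ten (rgt B x) (rgt C y) \<circ> mid_swap) k"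
    using assms(1)[OF ell2_slice(1)[OF assms(2)] ell2_slice(1)[OF assms(3)]]
    by (simp add: k rgt_def) (simp add: ten_def mid_swap_def rgt_def)
qed

lemma lft_id: "lft (\<lambda>x. x) f = f" and rgt_id: "rgt (\<lambda>x. x) f = f"
  by (simp_all add: lft_def rgt_def)

text \<open>The joint operators are exactly those of \<open>qc_model_compose\<close>. What has to be
  seen is that, regrouped by \<open>mid_swap\<close>, the composed left measurements act on I1
  \<times> I2 only and the right ones on J1 \<times> J2 only.\<close>

lemma q_ell2_compose:
  assumes fin: "finite V1" "finite W3"
    and 1: "q_ell2 V2 W1 V1 W2 \<Gamma>1 I1 J1 id" and 2: "q_ell2 V3 W2 V2 W3 \<Gamma>2 I2 J2 id"
    and \<Gamma>: "\<And>v1 w1 v3 w3. \<lbrakk>v1 \<in> V1; w1 \<in> W1; v3 \<in> V3; w3 \<in> W3\<rbrakk> \<Longrightarrow>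
      entry \<Gamma> (v1, w3) (v3, w1) =
        (\<Sum>v2\<in>V2. \<Sum>w2\<in>W2. entry \<Gamma>1 (v1, w2) (v2, w1) * entry \<Gamma>2 (v2, w3) (v3, w2))"
  shows "q_ell2 V3 W1 V1 W3 \<Gamma> (I1 \<times> I2) (J1 \<times> J2) mid_swap"
proof -
  obtain \<xi>1 E1 F1 E1' F1' where f1: "finite I1" "finite J1"
    and qc1: "qc_model V2 W1 V1 W2 \<Gamma>1 (ell2 (I1 \<times> J1)) \<xi>1 E1 F1"
    and E1': "\<forall>v2\<in>V2. povm (ell2 I1) V1 (E1' v2)" and F1': "\<forall>w1\<in>W1. povm (ell2 J1) W2 (F1' w1)"
    and E1: "\<forall>v2\<in>V2. \<forall>v1\<in>V1. \<forall>x\<in>L2 I1. \<forall>y\<in>L2 J1. E1 v2 v1 (ten x y) = ten (E1' v2 v1 x) y"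
    and F1: "\<forall>w1\<in>W1. \<forall>w2\<in>W2. \<forall>x\<in>L2 I1. \<forall>y\<in>L2 J1. F1 w1 w2 (ten x y) = ten x (F1' w1 w2 y)"
    using 1 unfolding q_ell2_def vimage_id comp_id id_apply by blast
  note E1' = E1'[rule_format] and F1' = F1'[rule_format] and E1 = E1[rule_format] and F1 = F1[rule_format]
  obtain \<xi>2 E2 F2 E2' F2' where f2: "finite I2" "finite J2"
    and qc2: "qc_model V3 W2 V2 W3 \<Gamma>2 (ell2 (I2 \<times> J2)) \<xi>2 E2 F2"
    and E2': "\<forall>v3\<in>V3. povm (ell2 I2) V2 (E2' v3)" and F2': "\<forall>w2\<in>W2. povm (ell2 J2) W3 (F2' w2)"
    and E2: "\<forall>v3\<in>V3. \<forall>v2\<in>V2. \<forall>x\<in>L2 I2. \<forall>y\<in>L2 J2. E2 v3 v2 (ten x y) = ten (E2' v3 v2 x) y"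
    and F2: "\<forall>w2\<in>W2. \<forall>w3\<in>W3. \<forall>x\<in>L2 I2. \<forall>y\<in>L2 J2. F2 w2 w3 (ten x y) = ten x (F2' w2 w3 y)"
    using 2 unfolding q_ell2_def vimage_id comp_id id_apply by blast
  note E2' = E2'[rule_format] and F2' = F2'[rule_format] and E2 = E2[rule_format] and F2 = F2[rule_format]
  have cE: "tsum V2 (\<lambda>v2. E1 v2 v1) (E2 v3) (ten x y \<circ> mid_swap)
      = ten (tsum V2 (\<lambda>v2. E1' v2 v1) (E2' v3) x) y \<circ> mid_swap"
    if m: "v3 \<in> V3" "v1 \<in> V1" and xy: "x \<in> L2 (I1 \<times> I2)" "y \<in> L2 (J1 \<times> J2)" for v3 v1 x y
  proof -
    have *: "lft (E1 v2 v1) (rgt (E2 v3 v2) (ten x y \<circ> mid_swap))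
        = ten (lft (E1' v2 v1) (rgt (E2' v3 v2) x)) y \<circ> mid_swap" if v2: "v2 \<in> V2" for v2
    proof -
      have r: "rgt (E2 v3 v2) (ten x y \<circ> mid_swap) = ten (rgt (E2' v3 v2) x) y \<circ> mid_swap"
        by (rule rgt_mid_swap[where C = "\<lambda>v. v", unfolded rgt_id, OF _ xy], rule E2[OF m(1) v2])
      show ?thesis unfolding r
        by (rule lft_mid_swap[where C = "\<lambda>v. v", unfolded lft_id, OF _ rgt_closed[OF povm_positive[OF E2'[OF m(1)] v2] xy(1)] xy(2)],
          rule E1[OF v2 m(2)])
    qed
    show ?thesis
      by (simp add: tsum_def * fun_eq_iff cong: sum.cong) (simp add: ten_def case_prod_beta' sum_distrib_right)
  qed
  have cF: "tsum W2 (F1 w1) (\<lambda>w2. F2 w2 w3) (ten x y \<circ> mid_swap)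
      = ten x (tsum W2 (F1' w1) (\<lambda>w2. F2' w2 w3) y) \<circ> mid_swap"
    if m: "w1 \<in> W1" "w3 \<in> W3" and xy: "x \<in> L2 (I1 \<times> I2)" "y \<in> L2 (J1 \<times> J2)" for w1 w3 x y
  proof -
    have *: "lft (F1 w1 w2) (rgt (F2 w2 w3) (ten x y \<circ> mid_swap))
        = ten x (lft (F1' w1 w2) (rgt (F2' w2 w3) y)) \<circ> mid_swap" if w2: "w2 \<in> W2" for w2
    proof -
      have r: "rgt (F2 w2 w3) (ten x y \<circ> mid_swap) = ten x (rgt (F2' w2 w3) y) \<circ> mid_swap"
        by (rule rgt_mid_swap[where B = "\<lambda>u. u", unfolded rgt_id, OF _ xy], rule F2[OF w2 m(2)])
      show ?thesis unfolding r
        by (rule lft_mid_swap[where B = "\<lambda>u. u", unfolded lft_id, OF _ xy(1) rgt_closed[OF povm_positive[OF F2'[OF w2] m(2)] xy(2)]],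
          rule F1[OF m(1) w2])
    qed
    show ?thesis
      by (simp add: tsum_def * fun_eq_iff cong: sum.cong) (simp add: ten_def case_prod_beta' sum_distrib_left)
  qed
  show ?thesis
    unfolding q_ell2_def mid_swap_vimage
  proof (intro conjI exI)
    show "qc_model V3 W1 V1 W3 \<Gamma> (ell2 ((I1 \<times> J1) \<times> (I2 \<times> J2))) (ten \<xi>1 \<xi>2)
      (\<lambda>v3 v1. tsum V2 (\<lambda>v2. E1 v2 v1) (E2 v3)) (\<lambda>w1 w3. tsum W2 (F1 w1) (\<lambda>w2. F2 w2 w3))"
      by (rule qc_model_compose[OF fin qc1 qc2 \<Gamma>])
    show "\<forall>v3\<in>V3. povm (ell2 (I1 \<times> I2)) V1 (\<lambda>v1. tsum V2 (\<lambda>v2. E1' v2 v1) (E2' v3))"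
      by (intro ballI povm_tsum_left[OF E1' E2' fin(1)])
    show "\<forall>w1\<in>W1. povm (ell2 (J1 \<times> J2)) W3 (\<lambda>w3. tsum W2 (F1' w1) (\<lambda>w2. F2' w2 w3))"
      by (intro ballI povm_tsum_right[OF F1' F2' fin(2)])
  qed (use f1 f2 cE cF bij_mid_swap in auto)
qed

section \<open>Channels and composition of correlations\<close>

text \<open>The classical channel with transition kernel k, the output being the first argument as
  in \<open>entry\<close>.\<close>

definition chan :: "'a set \<Rightarrow> 'b set \<Rightarrow> ('b \<Rightarrow> 'a \<Rightarrow> complex) \<Rightarrow> 'a cmat \<Rightarrow> 'b cmat" where
  "chan V W k A = (\<lambda>x y. if x = y \<and> x \<in> W then \<Sum>v\<in>V. A v v * k x v else 0)"

lemma diag_matsD: "\<lbrakk>A \<in> diag_mats V; x \<noteq> y \<or> x \<notin> V\<rbrakk> \<Longrightarrow> A x y = 0"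
  by (auto simp: diag_mats_def)

lemma diag_unit_mem: "v \<in> V \<Longrightarrow> diag_unit v \<in> diag_mats V"
  by (auto simp: diag_unit_def diag_mats_def)

lemma kron_mem: "\<lbrakk>A \<in> diag_mats V; B \<in> diag_mats W\<rbrakk> \<Longrightarrow> kron A B \<in> diag_mats (V \<times> W)"
  by (auto simp: kron_def diag_mats_def prod_eq_iff mem_Times_iff)

lemma kron_diag_unit: "kron (diag_unit v) (diag_unit w) = diag_unit (v, w)"
  by (auto simp: kron_def diag_unit_def fun_eq_iff)

lemma psd_on_diag:
  assumes "finite V" "A \<in> diag_mats V"
  shows "psd_on V A \<longleftrightarrow> (\<forall>v\<in>V. A v v \<in> \<real>\<^sub>\<ge>\<^sub>0)"
proof -
  have eq: "(\<Sum>x\<in>V. \<Sum>y\<in>V. cnj (z x) * A x y * z y) = (\<Sum>x\<in>V. of_real ((norm (z x))\<^sup>2) * A x x)" for z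
  proof (rule sum.cong[OF refl])
    fix x assume x: "x \<in> V"
    have "(\<Sum>y\<in>V. cnj (z x) * A x y * z y) = (\<Sum>y\<in>V. if x = y then cnj (z x) * A x x * z x else 0)"
      using assms(2) by (intro sum.cong) (auto dest: diag_matsD)
    also have "\<dots> = of_real ((norm (z x))\<^sup>2) * A x x"
      unfolding complex_norm_square using assms(1) x by simp
    finally show "(\<Sum>y\<in>V. cnj (z x) * A x y * z y) = of_real ((norm (z x))\<^sup>2) * A x x" .
  qed
  show ?thesis
  proof
    assume psd: "psd_on V A"
    show "\<forall>v\<in>V. A v v \<in> \<real>\<^sub>\<ge>\<^sub>0"
    proof
      fix v assume v: "v \<in> V"
      let ?z = "\<lambda>x. if x = v then 1 else 0 :: complex"
      have "(\<Sum>x\<in>V. of_real ((norm (?z x))\<^sup>2) * A x x) = (\<Sum>x\<in>V. if x = v then A v v else 0)"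
        by (intro sum.cong) auto
      also have "\<dots> = A v v" using v assms(1) by simp
      finally have "(\<Sum>x\<in>V. of_real ((norm (?z x))\<^sup>2) * A x x) = A v v" .
      moreover have "(\<Sum>x\<in>V. of_real ((norm (?z x))\<^sup>2) * A x x) \<in> \<real>\<^sub>\<ge>\<^sub>0"
        using psd unfolding psd_on_def eq by (rule spec)
      ultimately show "A v v \<in> \<real>\<^sub>\<ge>\<^sub>0" by (simp only:)
    qed
  next
    assume "\<forall>v\<in>V. A v v \<in> \<real>\<^sub>\<ge>\<^sub>0"
    then have "of_real ((norm (z x))\<^sup>2) * A x x \<in> \<real>\<^sub>\<ge>\<^sub>0" if "x \<in> V" for z x
      using that by (intro nonneg_Reals_mult_I) auto
    then show "psd_on V A" unfolding psd_on_def eq complex_nonneg_Reals_iff Re_sum Im_sum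
      by (intro allI conjI sum_nonneg sum.neutral) auto
  qed
qed

lemma channelD:
  assumes "channel V W \<Phi>"
  shows "A \<in> diag_mats V \<Longrightarrow> \<Phi> A \<in> diag_mats W"
    and "\<lbrakk>A \<in> diag_mats V; B \<in> diag_mats V\<rbrakk> \<Longrightarrow>
      \<Phi> (\<lambda>x y. a * A x y + b * B x y) = (\<lambda>x y. a * \<Phi> A x y + b * \<Phi> B x y)"
    and "\<lbrakk>A \<in> diag_mats V; psd_on V A\<rbrakk> \<Longrightarrow> psd_on W (\<Phi> A)"
    and "A \<in> diag_mats V \<Longrightarrow> trace_on W (\<Phi> A) = trace_on V A"
  using assms unfolding channel_def by blast+

lemma channel_chan:
  assumes "finite V" "finite W" and nonneg: "\<And>x v. \<lbrakk>x \<in> W; v \<in> V\<rbrakk> \<Longrightarrow> k x v \<in> \<real>\<^sub>\<ge>\<^sub>0"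
    and total: "\<And>v. v \<in> V \<Longrightarrow> (\<Sum>x\<in>W. k x v) = 1"
  shows "channel V W (chan V W k)"
  unfolding channel_def
proof (intro conjI ballI allI impI)
  fix A assume A: "A \<in> diag_mats V"
  show B: "chan V W k A \<in> diag_mats W" by (auto simp: chan_def diag_mats_def)
  show "psd_on W (chan V W k A)" if "psd_on V A"
  proof -
    have "\<forall>v\<in>V. A v v \<in> \<real>\<^sub>\<ge>\<^sub>0" using that psd_on_diag[OF assms(1) A] by blast
    then have "A v v * k x v \<in> \<real>\<^sub>\<ge>\<^sub>0" if "v \<in> V" "x \<in> W" for v x
      using that nonneg by (intro nonneg_Reals_mult_I) auto
    then show ?thesis
      unfolding psd_on_diag[OF assms(2) B] unfolding chan_def complex_nonneg_Reals_iff
      by (auto intro!: sum_nonneg sum.neutral)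
  qed
  have "trace_on W (chan V W k A) = (\<Sum>v\<in>V. \<Sum>x\<in>W. A v v * k x v)"
    unfolding trace_on_def chan_def by (simp add: sum.swap[of _ W])
  also have "\<dots> = trace_on V A" using total by (simp add: trace_on_def flip: sum_distrib_left)
  finally show "trace_on W (chan V W k A) = trace_on V A" .
  fix B a b assume "B \<in> diag_mats V"
  show "chan V W k (\<lambda>x y. a * A x y + b * B x y) = (\<lambda>x y. a * chan V W k A x y + b * chan V W k B x y)"
    by (auto simp: chan_def fun_eq_iff sum_distrib_left sum.distrib algebra_simps)
qed

lemma entry_chan:
  assumes "finite V" "v \<in> V" "x \<in> W"
  shows "entry (chan V W k) x v = k x v"
proof -
  have "(\<Sum>u\<in>V. diag_unit v u u * k x u) = (\<Sum>u\<in>V. if v = u then k x v else 0)"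
    by (intro sum.cong) (auto simp: diag_unit_def)
  then show ?thesis using assms by (simp add: entry_def chan_def)
qed

lemma channel_entry_nonneg:
  assumes "channel V W \<Phi>" "finite V" "finite W" "v \<in> V" "x \<in> W"
  shows "entry \<Phi> x v \<in> \<real>\<^sub>\<ge>\<^sub>0"
proof -
  note d = diag_unit_mem[OF assms(4)]
  have "psd_on V (diag_unit v)"
    unfolding psd_on_diag[OF assms(2) d] by (auto simp: diag_unit_def complex_nonneg_Reals_iff)
  then have "psd_on W (\<Phi> (diag_unit v))" by (rule channelD(3)[OF assms(1) d])
  then show ?thesis
    unfolding psd_on_diag[OF assms(3) channelD(1)[OF assms(1) d]] entry_def using assms(5) by blast
qed

lemma channel_entry_sum:
  assumes "channel V W \<Phi>" "finite V" "v \<in> V"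
  shows "(\<Sum>x\<in>W. entry \<Phi> x v) = 1"
proof -
  have "(\<Sum>x\<in>W. entry \<Phi> x v) = trace_on V (diag_unit v)"
    using channelD(4)[OF assms(1) diag_unit_mem[OF assms(3)]] by (simp add: trace_on_def entry_def)
  also have "\<dots> = (\<Sum>u\<in>V. if v = u then 1 else 0)"
    unfolding trace_on_def by (intro sum.cong) (auto simp: diag_unit_def)
  finally show ?thesis using assms by simp
qed

text \<open>Diagonal units span the diagonal matrices, so a channel amounts to its stochastic matrix
  of entries. This justifies treating correlations through entries alone.\<close>

lemma channel_expand:
  assumes ch: "channel V W \<Phi>" and V: "finite V" and A: "A \<in> diag_mats V"
  shows "\<Phi> A = chan V W (entry \<Phi>) A"
proof -
  have sum_mem: "(\<lambda>x y. \<Sum>v\<in>F. A v v * diag_unit v x y) \<in> diag_mats V" if "F \<subseteq> V" for F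
    using that by (auto simp: diag_mats_def diag_unit_def intro!: sum.neutral)
      (metis (mono_tags, lifting) sum.neutral mult_zero_right subsetD)+
  have "\<Phi> (\<lambda>x y. \<Sum>v\<in>F. A v v * diag_unit v x y) = (\<lambda>x y. \<Sum>v\<in>F. A v v * \<Phi> (diag_unit v) x y)"
    if "finite F" "F \<subseteq> V" for F
    using that
  proof (induction F rule: finite_induct)
    case empty
    \<comment> \<open>With both coefficients zero, linearity gives the value at the zero
      matrix.\<close>
    show ?case using channelD(2)[OF ch A A, of 0 0] by simp
  next
    case (insert u F)
    then show ?case
      using channelD(2)[OF ch diag_unit_mem[of u V] sum_mem[of F], of "A u u" 1] by simp
  qed
  from this[OF V order_refl] have 1:
    "\<Phi> (\<lambda>x y. \<Sum>v\<in>V. A v v * diag_unit v x y) = (\<lambda>x y. \<Sum>v\<in>V. A v v * \<Phi> (diag_unit v) x y)" .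
  have 2: "(\<lambda>x y. \<Sum>v\<in>V. A v v * diag_unit v x y) = A"
  proof (intro ext)
    fix x y
    have "(\<Sum>v\<in>V. A v v * diag_unit v x y) = (\<Sum>v\<in>V. if x = v then (if x = y then A x x else 0) else 0)"
      by (intro sum.cong) (auto simp: diag_unit_def)
    also have "\<dots> = A x y" using V diag_matsD[OF A, of x y] by auto
    finally show "(\<Sum>v\<in>V. A v v * diag_unit v x y) = A x y" .
  qed
  have 3: "\<Phi> (diag_unit v) x y = (if x = y \<and> x \<in> W then entry \<Phi> x v else 0)" if "v \<in> V" for v x y
    using diag_matsD[OF channelD(1)[OF ch diag_unit_mem[OF that]], of x y] by (auto simp: entry_def)
  show ?thesis
    using 1 unfolding 2 by (auto simp: chan_def fun_eq_iff 3 intro!: sum.neutral cong: sum.cong)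
qed

lemma channel_compose:
  "\<lbrakk>channel U V \<Phi>; channel V W \<Psi>\<rbrakk> \<Longrightarrow> channel U W (\<lambda>A. \<Psi> (\<Phi> A))"
  unfolding channel_def by simp

lemma entry_compose:
  assumes "channel U V \<Phi>" "channel V W \<Psi>" "finite V" "u \<in> U" "x \<in> W"
  shows "entry (\<lambda>A. \<Psi> (\<Phi> A)) x u = (\<Sum>v\<in>V. entry \<Psi> x v * entry \<Phi> v u)"
  using channel_expand[OF assms(2,3) channelD(1)[OF assms(1) diag_unit_mem[OF assms(4)]]] assms(5)
  by (simp add: entry_def[of _ x u] entry_def[of \<Phi>] chan_def mult.commute)

text \<open>In the kernel, x stands for (v1, w3) and u for (v3, w1).\<close>

definition comp_corr :: "'v set \<Rightarrow> 'w set \<Rightarrow> 'v set \<Rightarrow> 'w set \<Rightarrow> 'v set \<Rightarrow> 'w set \<Rightarrow>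
    ('v, 'w) corr \<Rightarrow> ('v, 'w) corr \<Rightarrow> ('v, 'w) corr" where
  "comp_corr V1 W1 V2 W2 V3 W3 \<Gamma> \<Delta> = chan (V3 \<times> W1) (V1 \<times> W3)
     (\<lambda>x u. \<Sum>v2\<in>V2. \<Sum>w2\<in>W2. entry \<Gamma> (fst x, w2) (v2, snd u) * entry \<Delta> (v2, snd x) (fst u, w2))"

section \<open>Composition of ns, qc, q and qa correlations\<close>

context
  fixes V1 V2 V3 :: "'v set" and W1 W2 W3 :: "'w set"
  assumes fin: "finite V1" "finite V2" "finite V3" "finite W1" "finite W2" "finite W3"
begin

lemma entry_comp_corr:
  assumes "v1 \<in> V1" "w1 \<in> W1" "v3 \<in> V3" "w3 \<in> W3"
  shows "entry (comp_corr V1 W1 V2 W2 V3 W3 \<Gamma> \<Delta>) (v1, w3) (v3, w1) =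
    (\<Sum>v2\<in>V2. \<Sum>w2\<in>W2. entry \<Gamma> (v1, w2) (v2, w1) * entry \<Delta> (v2, w3) (v3, w2))"
  unfolding comp_corr_def using fin assms by (subst entry_chan) auto

lemma ns_comp:
  assumes \<Gamma>: "ns_corr V2 W1 V1 W2 \<Gamma>" and \<Delta>: "ns_corr V3 W2 V2 W3 \<Delta>"
    and ne: "\<lbrakk>V2 = {}; W2 = {}\<rbrakk> \<Longrightarrow> V3 = {} \<or> W1 = {}"
  shows "ns_corr V3 W1 V1 W3 (comp_corr V1 W1 V2 W2 V3 W3 \<Gamma> \<Delta>)"
proof -
  let ?C = "comp_corr V1 W1 V2 W2 V3 W3 \<Gamma> \<Delta>"
  have chG: "channel (V2 \<times> W1) (V1 \<times> W2) \<Gamma>" and chD: "channel (V3 \<times> W2) (V2 \<times> W3) \<Delta>"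
    using \<Gamma> \<Delta> by (auto simp: ns_corr_def)
  \<comment> \<open>If exactly one middle set were empty, \<Gamma> or \<Delta> would send a unit to
    an empty set of outcomes, against total mass 1. That both are empty is excluded by
    \<open>ne\<close>.\<close>
  have ex: "\<exists>v2\<in>V2. \<exists>w2\<in>W2. True" if v3: "v3 \<in> V3" and w1: "w1 \<in> W1" for v3 w1
  proof (rule ccontr)
    assume "\<not> ?thesis"
    then consider "V2 = {}" "W2 = {}" | w2 where "V2 = {}" "w2 \<in> W2" | v2 where "W2 = {}" "v2 \<in> V2"
      by blast
    then show False
    proof cases
      case 1 then show ?thesis using ne v3 w1 by blast
    next
      case 2
      then show ?thesis using channel_entry_sum[OF chD, of "(v3, w2)"] fin v3 by simp
    next
      case 3
      then show ?thesis using channel_entry_sum[OF chG, of "(v2, w1)"] fin w1 by simp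
    qed
  qed
  \<comment> \<open>\<open>G w1 w2\<close> is the probability of w2 under \<Gamma>,
    \<open>D v3 v2\<close> that of v2 under \<Delta>. By no-signalling the arbitrary choice of the
    other setting does not matter.\<close>
  define G where "G w1 w2 = (\<Sum>v1\<in>V1. entry \<Gamma> (v1, w2) ((SOME v2. v2 \<in> V2), w1))" for w1 w2
  define D where "D v3 v2 = (\<Sum>w3\<in>W3. entry \<Delta> (v2, w3) (v3, (SOME w2. w2 \<in> W2)))" for v3 v2
  have G: "(\<Sum>v1\<in>V1. entry \<Gamma> (v1, w2) (v2, w1)) = G w1 w2" if "w1 \<in> W1" "w2 \<in> W2" "v2 \<in> V2" for w1 w2 v2
    using \<Gamma> that someI[of "\<lambda>v. v \<in> V2" v2] unfolding ns_corr_def G_def by blast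
  have D: "(\<Sum>w3\<in>W3. entry \<Delta> (v2, w3) (v3, w2)) = D v3 v2" if "v3 \<in> V3" "w2 \<in> W2" "v2 \<in> V2" for v3 w2 v2
    using \<Delta> that someI[of "\<lambda>w. w \<in> W2" w2] unfolding ns_corr_def D_def by blast
  \<comment> \<open>Summing out w3 replaces \<Delta> by its marginal D. The remaining factor is the
    marginal of \<Gamma> on v1, independent of w1, which gives one half of no-signalling;
    \<open>right\<close> gives the other.\<close>
  have left: "(\<Sum>w3\<in>W3. entry ?C (v1, w3) (v3, w1)) = (\<Sum>v2\<in>V2. D v3 v2 * (\<Sum>w2\<in>W2. entry \<Gamma> (v1, w2) (v2, w1)))"
    if "v1 \<in> V1" "v3 \<in> V3" "w1 \<in> W1" for v1 v3 w1
  proof -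
    have "(\<Sum>w3\<in>W3. entry ?C (v1, w3) (v3, w1))
        = (\<Sum>w3\<in>W3. \<Sum>v2\<in>V2. \<Sum>w2\<in>W2. entry \<Gamma> (v1, w2) (v2, w1) * entry \<Delta> (v2, w3) (v3, w2))"
      using that by (simp add: entry_comp_corr)
    also have "\<dots> = (\<Sum>v2\<in>V2. \<Sum>w3\<in>W3. \<Sum>w2\<in>W2. entry \<Gamma> (v1, w2) (v2, w1) * entry \<Delta> (v2, w3) (v3, w2))"
      by (rule sum.swap)
    also have "\<dots> = (\<Sum>v2\<in>V2. \<Sum>w2\<in>W2. \<Sum>w3\<in>W3. entry \<Gamma> (v1, w2) (v2, w1) * entry \<Delta> (v2, w3) (v3, w2))"
      by (rule sum.cong[OF refl], rule sum.swap)
    also have "\<dots> = (\<Sum>v2\<in>V2. \<Sum>w2\<in>W2. entry \<Gamma> (v1, w2) (v2, w1) * D v3 v2)"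
      using that by (simp add: D flip: sum_distrib_left)
    finally show ?thesis by (simp add: sum_distrib_left mult.commute)
  qed
  have right: "(\<Sum>v1\<in>V1. entry ?C (v1, w3) (v3, w1)) = (\<Sum>w2\<in>W2. G w1 w2 * (\<Sum>v2\<in>V2. entry \<Delta> (v2, w3) (v3, w2)))"
    if "w3 \<in> W3" "v3 \<in> V3" "w1 \<in> W1" for w3 v3 w1
  proof -
    have "(\<Sum>v1\<in>V1. entry ?C (v1, w3) (v3, w1))
        = (\<Sum>v1\<in>V1. \<Sum>w2\<in>W2. \<Sum>v2\<in>V2. entry \<Gamma> (v1, w2) (v2, w1) * entry \<Delta> (v2, w3) (v3, w2))"
      using that by (simp add: entry_comp_corr sum.swap[of _ V2])
    also have "\<dots> = (\<Sum>w2\<in>W2. \<Sum>v1\<in>V1. \<Sum>v2\<in>V2. entry \<Gamma> (v1, w2) (v2, w1) * entry \<Delta> (v2, w3) (v3, w2))"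
      by (rule sum.swap)
    also have "\<dots> = (\<Sum>w2\<in>W2. \<Sum>v2\<in>V2. \<Sum>v1\<in>V1. entry \<Gamma> (v1, w2) (v2, w1) * entry \<Delta> (v2, w3) (v3, w2))"
      by (rule sum.cong[OF refl], rule sum.swap)
    also have "\<dots> = (\<Sum>w2\<in>W2. \<Sum>v2\<in>V2. G w1 w2 * entry \<Delta> (v2, w3) (v3, w2))"
      using that by (simp add: G flip: sum_distrib_right)
    finally show ?thesis by (simp add: sum_distrib_left)
  qed
  have total: "(\<Sum>x\<in>V1 \<times> W3. entry ?C x (v3, w1)) = 1" if v3: "v3 \<in> V3" and w1: "w1 \<in> W1" for v3 w1
  proof -
    obtain v2 w2 where v2: "v2 \<in> V2" and w2: "w2 \<in> W2" using ex[OF v3 w1] by blast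
    have sG: "(\<Sum>w\<in>W2. G w1 w) = 1"
    proof -
      have "(\<Sum>w\<in>W2. G w1 w) = (\<Sum>w\<in>W2. \<Sum>v1\<in>V1. entry \<Gamma> (v1, w) (v2, w1))"
        using G w1 v2 by simp
      also have "\<dots> = (\<Sum>v1\<in>V1. \<Sum>w\<in>W2. entry \<Gamma> (v1, w) (v2, w1))" by (rule sum.swap)
      also have "\<dots> = 1"
        using channel_entry_sum[OF chG, of "(v2, w1)"] fin v2 w1 by (simp add: sum.cartesian_product)
      finally show ?thesis .
    qed
    have sD: "(\<Sum>v\<in>V2. D v3 v) = 1"
    proof -
      have "(\<Sum>v\<in>V2. D v3 v) = (\<Sum>v\<in>V2. \<Sum>w3\<in>W3. entry \<Delta> (v, w3) (v3, w2))"
        using D v3 w2 by simp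
      also have "\<dots> = 1"
        using channel_entry_sum[OF chD, of "(v3, w2)"] fin v3 w2 by (simp add: sum.cartesian_product)
      finally show ?thesis .
    qed
    have "(\<Sum>x\<in>V1 \<times> W3. entry ?C x (v3, w1)) = (\<Sum>v1\<in>V1. \<Sum>w3\<in>W3. entry ?C (v1, w3) (v3, w1))"
      by (simp add: sum.cartesian_product)
    also have "\<dots> = (\<Sum>v1\<in>V1. \<Sum>v2\<in>V2. \<Sum>w2\<in>W2. D v3 v2 * entry \<Gamma> (v1, w2) (v2, w1))"
      using v3 w1 by (simp add: left sum_distrib_left)
    also have "\<dots> = (\<Sum>v2\<in>V2. \<Sum>v1\<in>V1. \<Sum>w2\<in>W2. D v3 v2 * entry \<Gamma> (v1, w2) (v2, w1))"
      by (rule sum.swap)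
    also have "\<dots> = (\<Sum>v2\<in>V2. \<Sum>w2\<in>W2. \<Sum>v1\<in>V1. D v3 v2 * entry \<Gamma> (v1, w2) (v2, w1))"
      by (rule sum.cong[OF refl], rule sum.swap)
    also have "\<dots> = (\<Sum>v2\<in>V2. \<Sum>w2\<in>W2. D v3 v2 * G w1 w2)"
      using w1 by (simp add: G flip: sum_distrib_left)
    also have "\<dots> = 1" using sG sD by (simp flip: sum_distrib_left sum_distrib_right)
    finally show ?thesis .
  qed
  have nonneg: "entry ?C (v1, w3) (v3, w1) \<in> \<real>\<^sub>\<ge>\<^sub>0"
    if "v1 \<in> V1" "w1 \<in> W1" "v3 \<in> V3" "w3 \<in> W3" for v1 w1 v3 w3
  proof -
    have "entry \<Gamma> (v1, w2) (v2, w1) * entry \<Delta> (v2, w3) (v3, w2) \<in> \<real>\<^sub>\<ge>\<^sub>0" if "v2 \<in> V2" "w2 \<in> W2" for v2 w2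
      using channel_entry_nonneg[OF chG, of "(v2, w1)" "(v1, w2)"] fin that
        channel_entry_nonneg[OF chD, of "(v3, w2)" "(v2, w3)"] \<open>v1 \<in> V1\<close> \<open>w1 \<in> W1\<close> \<open>v3 \<in> V3\<close> \<open>w3 \<in> W3\<close>
      by (simp add: nonneg_Reals_mult_I)
    then show ?thesis
      unfolding entry_comp_corr[OF that] complex_nonneg_Reals_iff Re_sum Im_sum
      by (auto intro!: sum_nonneg sum.neutral)
  qed
  have "channel (V3 \<times> W1) (V1 \<times> W3) ?C"
  proof -
    let ?k = "\<lambda>x u. \<Sum>v2\<in>V2. \<Sum>w2\<in>W2. entry \<Gamma> (fst x, w2) (v2, snd u) * entry \<Delta> (v2, snd x) (fst u, w2)"
    have k: "?k x u = entry ?C x u" if "x \<in> V1 \<times> W3" "u \<in> V3 \<times> W1" for x u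
      using that by (cases x, cases u) (auto simp: entry_comp_corr)
    show ?thesis
      unfolding comp_corr_def
    proof (rule channel_chan)
      show "?k x u \<in> \<real>\<^sub>\<ge>\<^sub>0" if "x \<in> V1 \<times> W3" "u \<in> V3 \<times> W1" for x u
        unfolding k[OF that] using that nonneg by auto
      show "(\<Sum>x\<in>V1 \<times> W3. ?k x u) = 1" if "u \<in> V3 \<times> W1" for u
      proof -
        have "(\<Sum>x\<in>V1 \<times> W3. ?k x u) = (\<Sum>x\<in>V1 \<times> W3. entry ?C x u)"
          by (intro sum.cong refl k that)
        then show ?thesis using that total by auto
      qed
    qed (use fin in auto)
  qed
  moreover have "(\<Sum>w3\<in>W3. entry ?C (v1, w3) (v3, w1)) = (\<Sum>w3\<in>W3. entry ?C (v1, w3) (v3, w1'))"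
    if "v1 \<in> V1" "v3 \<in> V3" "w1 \<in> W1" "w1' \<in> W1" for v1 v3 w1 w1'
  proof -
    have "(\<Sum>w2\<in>W2. entry \<Gamma> (v1, w2) (v2, w1)) = (\<Sum>w2\<in>W2. entry \<Gamma> (v1, w2) (v2, w1'))" if "v2 \<in> V2" for v2
      using \<Gamma> that \<open>v1 \<in> V1\<close> \<open>w1 \<in> W1\<close> \<open>w1' \<in> W1\<close> unfolding ns_corr_def by blast
    then show ?thesis using that by (simp add: left)
  qed
  moreover have "(\<Sum>v1\<in>V1. entry ?C (v1, w3) (v3, w1)) = (\<Sum>v1\<in>V1. entry ?C (v1, w3) (v3', w1))"
    if "w3 \<in> W3" "w1 \<in> W1" "v3 \<in> V3" "v3' \<in> V3" for w3 w1 v3 v3'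
  proof -
    have "(\<Sum>v2\<in>V2. entry \<Delta> (v2, w3) (v3, w2)) = (\<Sum>v2\<in>V2. entry \<Delta> (v2, w3) (v3', w2))" if "w2 \<in> W2" for w2
      using \<Delta> that \<open>w3 \<in> W3\<close> \<open>v3 \<in> V3\<close> \<open>v3' \<in> V3\<close> unfolding ns_corr_def by blast
    then show ?thesis using that by (simp add: right)
  qed
  ultimately show ?thesis unfolding ns_corr_def by blast
qed

text \<open>A POVM without outcomes has sum zero, so it forces the zero space, which has no unit
  vector. For q, qa and qc this supplies the hypothesis \<open>ne\<close> of
  \<open>ns_comp\<close>.\<close>

lemma qc_model_nonempty:
  assumes "qc_model V3 W2 V2 W3 \<Delta> H \<xi> E F" "V2 = {}"
  shows "V3 = {}"
proof (rule ccontr)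
  assume "V3 \<noteq> {}"
  then obtain v3 where "v3 \<in> V3" by blast
  interpret hilbert_space H using assms by (simp add: qc_model_def)
  have "\<xi> \<in> carrier H" "ipnorm H \<xi> = 1" "povm H {} (E v3)"
    using assms \<open>v3 \<in> V3\<close> by (auto simp: qc_model_def)
  then have "\<xi> = \<zero>\<^bsub>H\<^esub>" by (auto simp: povm_def)
  then show False using \<open>ipnorm H \<xi> = 1\<close> by simp
qed

lemma qc_comp:
  assumes c: "(UNIV :: complex set) \<lesssim> (UNIV :: 'h set)"
    and \<Gamma>: "qc_corr TYPE('h) V2 W1 V1 W2 \<Gamma>" and \<Delta>: "qc_corr TYPE('h) V3 W2 V2 W3 \<Delta>"
  shows "qc_corr TYPE('h) V3 W1 V1 W3 (comp_corr V1 W1 V2 W2 V3 W3 \<Gamma> \<Delta>)"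
proof -
  obtain H1 :: "'h ip_module" and \<xi>1 E1 F1 where m1: "qc_model V2 W1 V1 W2 \<Gamma> H1 \<xi>1 E1 F1"
    using \<Gamma> unfolding qc_corr_def by blast
  obtain H2 :: "'h ip_module" and \<xi>2 E2 F2 where m2: "qc_model V3 W2 V2 W3 \<Delta> H2 \<xi>2 E2 F2"
    using \<Delta> unfolding qc_corr_def by blast
  show ?thesis
    unfolding qc_corr_def
  proof
    show "ns_corr V3 W1 V1 W3 (comp_corr V1 W1 V2 W2 V3 W3 \<Gamma> \<Delta>)"
      using \<Gamma> \<Delta> qc_model_nonempty[OF m2] by (intro ns_comp) (auto simp: qc_corr_def)
    show "\<exists>(H :: 'h ip_module) \<xi> E F. qc_model V3 W1 V1 W3 (comp_corr V1 W1 V2 W2 V3 W3 \<Gamma> \<Delta>) H \<xi> E F"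
      by (rule qc_model_compose_exists[OF c fin(1,6) m1 m2 entry_comp_corr])
  qed
qed

lemma q_nonempty:
  assumes "q_corr TYPE('h) V3 W2 V2 W3 \<Delta>" "V2 = {}"
  shows "V3 = {}"
proof -
  obtain H :: "'h ip_module" and \<xi> E F where "qc_model V3 W2 V2 W3 \<Delta> H \<xi> E F"
    using assms(1) unfolding q_corr_def by blast
  from qc_model_nonempty[OF this assms(2)] show ?thesis .
qed

lemma q_comp:
  assumes c: "(UNIV :: complex set) \<lesssim> (UNIV :: 'h set)"
    and \<Gamma>: "q_corr TYPE('h) V2 W1 V1 W2 \<Gamma>" and \<Delta>: "q_corr TYPE('h) V3 W2 V2 W3 \<Delta>"
  shows "q_corr TYPE('h) V3 W1 V1 W3 (comp_corr V1 W1 V2 W2 V3 W3 \<Gamma> \<Delta>)"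
proof -
  obtain I1 J1 :: "'h set" where 1: "q_ell2 V2 W1 V1 W2 \<Gamma> I1 J1 id"
    using q_corr_to_ell2[OF \<Gamma>] by blast
  obtain I2 J2 :: "'h set" where 2: "q_ell2 V3 W2 V2 W3 \<Delta> I2 J2 id"
    using q_corr_to_ell2[OF \<Delta>] by blast
  show ?thesis
  proof (rule q_corr_from_ell2[OF c])
    show "ns_corr V3 W1 V1 W3 (comp_corr V1 W1 V2 W2 V3 W3 \<Gamma> \<Delta>)"
      using \<Gamma> \<Delta> q_nonempty[OF \<Delta>] by (intro ns_comp) (auto simp: q_corr_def)
    show "q_ell2 V3 W1 V1 W3 (comp_corr V1 W1 V2 W2 V3 W3 \<Gamma> \<Delta>) (I1 \<times> I2) (J1 \<times> J2) mid_swap"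
      by (rule q_ell2_compose[OF fin(1,6) 1 2 entry_comp_corr])
  qed
qed

text \<open>\<open>comp_corr\<close> depends on \<Gamma> and \<Delta> through finite sums of
  products of entries, so the composed approximants converge termwise.\<close>

lemma qa_comp:
  assumes c: "(UNIV :: complex set) \<lesssim> (UNIV :: 'h set)"
    and \<Gamma>: "qa_corr TYPE('h) V2 W1 V1 W2 \<Gamma>" and \<Delta>: "qa_corr TYPE('h) V3 W2 V2 W3 \<Delta>"
  shows "qa_corr TYPE('h) V3 W1 V1 W3 (comp_corr V1 W1 V2 W2 V3 W3 \<Gamma> \<Delta>)"
proof -
  obtain \<Gamma>s where \<Gamma>s: "\<And>n::nat. q_corr TYPE('h) V2 W1 V1 W2 (\<Gamma>s n)"
    "\<And>A x y. A \<in> diag_mats (V2 \<times> W1) \<Longrightarrow> (\<lambda>n. \<Gamma>s n A x y) \<longlonglongrightarrow> \<Gamma> A x y"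
    using \<Gamma> unfolding qa_corr_def by blast
  obtain \<Delta>s where \<Delta>s: "\<And>n::nat. q_corr TYPE('h) V3 W2 V2 W3 (\<Delta>s n)"
    "\<And>A x y. A \<in> diag_mats (V3 \<times> W2) \<Longrightarrow> (\<lambda>n. \<Delta>s n A x y) \<longlonglongrightarrow> \<Delta> A x y"
    using \<Delta> unfolding qa_corr_def by blast
  have l1: "(\<lambda>n. entry (\<Gamma>s n) x (v2, w1)) \<longlonglongrightarrow> entry \<Gamma> x (v2, w1)" if "v2 \<in> V2" "w1 \<in> W1" for x v2 w1
    unfolding entry_def using that by (intro \<Gamma>s(2) diag_unit_mem) auto
  have l2: "(\<lambda>n. entry (\<Delta>s n) x (v3, w2)) \<longlonglongrightarrow> entry \<Delta> x (v3, w2)" if "v3 \<in> V3" "w2 \<in> W2" for x v3 w2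
    unfolding entry_def using that by (intro \<Delta>s(2) diag_unit_mem) auto
  have lim: "(\<lambda>n. comp_corr V1 W1 V2 W2 V3 W3 (\<Gamma>s n) (\<Delta>s n) A x y) \<longlonglongrightarrow> comp_corr V1 W1 V2 W2 V3 W3 \<Gamma> \<Delta> A x y"
    for A x y
  proof (cases "x = y \<and> x \<in> V1 \<times> W3")
    case True
    then show ?thesis unfolding comp_corr_def chan_def
      by (auto intro!: tendsto_sum tendsto_mult l1 l2)
  next
    case False
    then have "comp_corr V1 W1 V2 W2 V3 W3 G D A x y = 0" for G D
      unfolding comp_corr_def chan_def by (rule if_not_P)
    then show ?thesis by simp
  qed
  have ns: "ns_corr V2 W1 V1 W2 \<Gamma>" "ns_corr V3 W2 V2 W3 \<Delta>"
    using \<Gamma> \<Delta> by (simp_all add: qa_corr_def)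
  show ?thesis
    unfolding qa_corr_def
  proof (intro conjI exI[of _ "\<lambda>n. comp_corr V1 W1 V2 W2 V3 W3 (\<Gamma>s n) (\<Delta>s n)"] allI ballI)
    \<comment> \<open>The limit itself carries no operator model; the condition on empty sets is
      taken from an approximant.\<close>
    show "ns_corr V3 W1 V1 W3 (comp_corr V1 W1 V2 W2 V3 W3 \<Gamma> \<Delta>)"
      by (rule ns_comp[OF ns]) (simp add: q_nonempty[OF \<Delta>s(1)])
    show "q_corr TYPE('h) V3 W1 V1 W3 (comp_corr V1 W1 V2 W2 V3 W3 (\<Gamma>s n) (\<Delta>s n))" for n
      by (rule q_comp[OF c \<Gamma>s(1) \<Delta>s(1)])
    show "(\<lambda>n. comp_corr V1 W1 V2 W2 V3 W3 (\<Gamma>s n) (\<Delta>s n) A x y)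
        \<longlonglongrightarrow> comp_corr V1 W1 V2 W2 V3 W3 \<Gamma> \<Delta> A x y" for A x y
      by (rule lim)
  qed
qed

end

section \<open>Local correlations\<close>

lemma loc_entry:
  assumes "\<forall>A\<in>diag_mats V2. \<forall>B\<in>diag_mats W1.
      \<Gamma> (kron A B) = (\<lambda>x y. \<Sum>i<n. complex_of_real (p i) * kron (\<Phi> i A) (\<Psi> i B) x y)"
    "v2 \<in> V2" "w1 \<in> W1"
  shows "entry \<Gamma> (v1, w2) (v2, w1) = (\<Sum>i<n. of_real (p i) * (entry (\<Phi> i) v1 v2 * entry (\<Psi> i) w2 w1))"
proof -
  have "\<Gamma> (kron (diag_unit v2) (diag_unit w1)) =
      (\<lambda>x y. \<Sum>i<n. complex_of_real (p i) * kron (\<Phi> i (diag_unit v2)) (\<Psi> i (diag_unit w1)) x y)"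
    by (rule assms(1)[rule_format, OF diag_unit_mem[OF assms(2)] diag_unit_mem[OF assms(3)]])
  from fun_cong[OF fun_cong[OF this]] show ?thesis
    unfolding entry_def kron_diag_unit unfolding kron_def by simp
qed

text \<open>Both sides of the defining identity are determined by entries, so these are all that has
  to be compared. An arbitrary finite index set is convenient because composition indexes by pairs;
  an enumeration then leads back to an initial segment.\<close>

lemma loc_corrI:
  assumes fin: "finite V2" "finite W1" "finite S" and ns: "ns_corr V2 W1 V1 W2 \<Gamma>"
    and ch: "\<And>i. i \<in> S \<Longrightarrow> p i \<ge> 0 \<and> channel V2 V1 (\<Phi> i) \<and> channel W1 W2 (\<Psi> i)" and p1: "sum p S = (1 :: real)"
    and e: "\<And>v1 w1 v2 w2. \<lbrakk>v1 \<in> V1; w1 \<in> W1; v2 \<in> V2; w2 \<in> W2\<rbrakk> \<Longrightarrow> entry \<Gamma> (v1, w2) (v2, w1) =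
      (\<Sum>i\<in>S. of_real (p i) * (entry (\<Phi> i) v1 v2 * entry (\<Psi> i) w2 w1))"
  shows "loc_corr V2 W1 V1 W2 \<Gamma>"
proof -
  have chG: "channel (V2 \<times> W1) (V1 \<times> W2) \<Gamma>" using ns by (simp add: ns_corr_def)
  have eq: "\<Gamma> (kron A B) = (\<lambda>x y. \<Sum>i\<in>S. complex_of_real (p i) * kron (\<Phi> i A) (\<Psi> i B) x y)"
    if A: "A \<in> diag_mats V2" and B: "B \<in> diag_mats W1" for A B
  proof (intro ext)
    fix x y
    have K: "kron (\<Phi> i A) (\<Psi> i B) \<in> diag_mats (V1 \<times> W2)" if "i \<in> S" for i
      using ch[OF that] by (intro kron_mem channelD(1)[OF _ A] channelD(1)[OF _ B]) auto
    show "\<Gamma> (kron A B) x y = (\<Sum>i\<in>S. complex_of_real (p i) * kron (\<Phi> i A) (\<Psi> i B) x y)"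
    proof (cases "x = y \<and> x \<in> V1 \<times> W2")
      case False
      then have "kron (\<Phi> i A) (\<Psi> i B) x y = 0" if "i \<in> S" for i
        by (intro diag_matsD[OF K[OF that]]) blast
      moreover have "\<Gamma> (kron A B) x y = 0"
        using False by (intro diag_matsD[OF channelD(1)[OF chG kron_mem[OF A B]]]) blast
      ultimately show ?thesis by simp
    next
      case True
      then obtain v1 w2 where x: "x = (v1, w2)" "y = (v1, w2)" "v1 \<in> V1" "w2 \<in> W2" by auto
      have "\<Gamma> (kron A B) x y = (\<Sum>(v2, w1)\<in>V2 \<times> W1. A v2 v2 * B w1 w1 * entry \<Gamma> (v1, w2) (v2, w1))"
        using channel_expand[OF chG _ kron_mem[OF A B]] fin True
        by (simp add: chan_def x kron_def case_prod_beta')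
      also have "\<dots> = (\<Sum>(v2, w1)\<in>V2 \<times> W1. \<Sum>i\<in>S. A v2 v2 * B w1 w1 *
          (of_real (p i) * (entry (\<Phi> i) v1 v2 * entry (\<Psi> i) w2 w1)))"
        using x by (intro sum.cong refl) (auto simp: e sum_distrib_left)
      also have "\<dots> = (\<Sum>i\<in>S. \<Sum>(v2, w1)\<in>V2 \<times> W1. A v2 v2 * B w1 w1 *
          (of_real (p i) * (entry (\<Phi> i) v1 v2 * entry (\<Psi> i) w2 w1)))"
        unfolding case_prod_beta' by (rule sum.swap)
      also have "\<dots> = (\<Sum>i\<in>S. of_real (p i) * ((\<Sum>v2\<in>V2. A v2 v2 * entry (\<Phi> i) v1 v2) *
          (\<Sum>w1\<in>W1. B w1 w1 * entry (\<Psi> i) w2 w1)))"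
      proof (rule sum.cong[OF refl])
        fix i
        have "(\<Sum>v2\<in>V2. A v2 v2 * entry (\<Phi> i) v1 v2) * (\<Sum>w1\<in>W1. B w1 w1 * entry (\<Psi> i) w2 w1)
            = (\<Sum>(v2, w1)\<in>V2 \<times> W1. A v2 v2 * entry (\<Phi> i) v1 v2 * (B w1 w1 * entry (\<Psi> i) w2 w1))"
          by (simp only: sum_product sum.cartesian_product)
        then show "(\<Sum>(v2, w1)\<in>V2 \<times> W1. A v2 v2 * B w1 w1 *
            (of_real (p i) * (entry (\<Phi> i) v1 v2 * entry (\<Psi> i) w2 w1)))
          = of_real (p i) * ((\<Sum>v2\<in>V2. A v2 v2 * entry (\<Phi> i) v1 v2) * (\<Sum>w1\<in>W1. B w1 w1 * entry (\<Psi> i) w2 w1))"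
          by (simp add: sum_distrib_left case_prod_beta' mult_ac)
      qed
      also have "\<dots> = (\<Sum>i\<in>S. complex_of_real (p i) * kron (\<Phi> i A) (\<Psi> i B) x y)"
      proof (rule sum.cong[OF refl])
        fix i assume i: "i \<in> S"
        have "\<Phi> i A = chan V2 V1 (entry (\<Phi> i)) A" "\<Psi> i B = chan W1 W2 (entry (\<Psi> i)) B"
          using channel_expand[OF _ fin(1) A] channel_expand[OF _ fin(2) B] ch[OF i] by auto
        then have "\<Phi> i A v1 v1 = (\<Sum>v2\<in>V2. A v2 v2 * entry (\<Phi> i) v1 v2)"
          "\<Psi> i B w2 w2 = (\<Sum>w1\<in>W1. B w1 w1 * entry (\<Psi> i) w2 w1)"
          using x by (simp_all add: chan_def)
        then show "of_real (p i) * ((\<Sum>v2\<in>V2. A v2 v2 * entry (\<Phi> i) v1 v2) * (\<Sum>w1\<in>W1. B w1 w1 * entry (\<Psi> i) w2 w1))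
          = complex_of_real (p i) * kron (\<Phi> i A) (\<Psi> i B) x y"
          by (simp add: x kron_def)
      qed
      finally show ?thesis .
    qed
  qed
  obtain h where h: "bij_betw h {..<card S} S"
    using ex_bij_betw_nat_finite[OF fin(3)] by (auto simp: atLeast0LessThan)
  have hS: "h i \<in> S" if "i < card S" for i using h that by (auto simp: bij_betw_def)
  show ?thesis
    unfolding loc_corr_def
  proof (intro conjI exI ballI allI impI)
    show "(\<Sum>i<card S. p (h i)) = 1" using sum.reindex_bij_betw[OF h, of p] p1 by simp
    show "\<Gamma> (kron A B) = (\<lambda>x y. \<Sum>i<card S. complex_of_real (p (h i)) * kron (\<Phi> (h i) A) (\<Psi> (h i) B) x y)"
      if "A \<in> diag_mats V2" "B \<in> diag_mats W1" for A B
      unfolding eq[OF that] by (intro ext, rule sum.reindex_bij_betw[OF h, symmetric])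
  qed (use ns ch hS in auto)
qed

lemma sum4_swap:
  "(\<Sum>a\<in>A. \<Sum>b\<in>B. \<Sum>c\<in>C. \<Sum>d\<in>D. f a b c d) = (\<Sum>c\<in>C. \<Sum>d\<in>D. \<Sum>a\<in>A. \<Sum>b\<in>B. f a b c d)"
proof -
  have "(\<Sum>a\<in>A. \<Sum>b\<in>B. \<Sum>c\<in>C. \<Sum>d\<in>D. f a b c d) = (\<Sum>a\<in>A. \<Sum>c\<in>C. \<Sum>b\<in>B. \<Sum>d\<in>D. f a b c d)"
    by (rule sum.cong[OF refl], rule sum.swap)
  also have "\<dots> = (\<Sum>c\<in>C. \<Sum>a\<in>A. \<Sum>b\<in>B. \<Sum>d\<in>D. f a b c d)" by (rule sum.swap)
  also have "\<dots> = (\<Sum>c\<in>C. \<Sum>a\<in>A. \<Sum>d\<in>D. \<Sum>b\<in>B. f a b c d)"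
    by (rule sum.cong[OF refl], rule sum.cong[OF refl], rule sum.swap)
  also have "\<dots> = (\<Sum>c\<in>C. \<Sum>d\<in>D. \<Sum>a\<in>A. \<Sum>b\<in>B. f a b c d)"
    by (rule sum.cong[OF refl], rule sum.swap)
  finally show ?thesis .
qed

text \<open>For products of local channels the loop opens up: \<Phi> i follows \<Theta> j on the
  left, \<Xi> j follows \<Psi> i on the right, with weight p i * q j.\<close>

lemma loc_comp:
  assumes fin: "finite V1" "finite V2" "finite V3" "finite W1" "finite W2" "finite W3"
    and \<Gamma>: "loc_corr V2 W1 V1 W2 \<Gamma>" and \<Delta>: "loc_corr V3 W2 V2 W3 \<Delta>"
  shows "loc_corr V3 W1 V1 W3 (comp_corr V1 W1 V2 W2 V3 W3 \<Gamma> \<Delta>)"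
proof -
  obtain n :: nat and p \<Phi> \<Psi> where ch1: "\<forall>i<n. p i \<ge> 0 \<and> channel V2 V1 (\<Phi> i) \<and> channel W1 W2 (\<Psi> i)"
    and p: "(\<Sum>i<n. p i) = 1" and G: "\<forall>A\<in>diag_mats V2. \<forall>B\<in>diag_mats W1.
      \<Gamma> (kron A B) = (\<lambda>x y. \<Sum>i<n. complex_of_real (p i) * kron (\<Phi> i A) (\<Psi> i B) x y)"
    using \<Gamma> unfolding loc_corr_def by blast
  obtain m :: nat and q \<Theta> \<Xi> where ch2: "\<forall>j<m. q j \<ge> 0 \<and> channel V3 V2 (\<Theta> j) \<and> channel W2 W3 (\<Xi> j)"
    and q: "(\<Sum>j<m. q j) = 1" and D: "\<forall>A\<in>diag_mats V3. \<forall>B\<in>diag_mats W2.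
      \<Delta> (kron A B) = (\<lambda>x y. \<Sum>j<m. complex_of_real (q j) * kron (\<Theta> j A) (\<Xi> j B) x y)"
    using \<Delta> unfolding loc_corr_def by blast
  \<comment> \<open>The weights sum to 1, so \<Theta> 0 exists, and a channel from V3 to V2 forces
    V3 to be empty when V2 is.\<close>
  have "0 < m" using q by (cases m) auto
  then have ne: "V3 = {}" if "V2 = {}"
    using that ch2 channel_entry_sum[of V3 V2 "\<Theta> 0"] fin by force
  show ?thesis
  proof (rule loc_corrI[where S = "{..<n} \<times> {..<m}" and p = "\<lambda>(i, j). p i * q j"
        and \<Phi> = "\<lambda>(i, j) A. \<Phi> i (\<Theta> j A)" and \<Psi> = "\<lambda>(i, j) B. \<Xi> j (\<Psi> i B)"])
    show "ns_corr V3 W1 V1 W3 (comp_corr V1 W1 V2 W2 V3 W3 \<Gamma> \<Delta>)"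
      using \<Gamma> \<Delta> ne by (intro ns_comp fin) (auto simp: loc_corr_def)
    show "(case i of (i, j) \<Rightarrow> p i * q j) \<ge> 0 \<and> channel V3 V1 (case i of (i, j) \<Rightarrow> \<lambda>A. \<Phi> i (\<Theta> j A)) \<and>
        channel W1 W3 (case i of (i, j) \<Rightarrow> \<lambda>B. \<Xi> j (\<Psi> i B))" if "i \<in> {..<n} \<times> {..<m}" for i
      using that ch1 ch2 by (auto intro: channel_compose)
    have "(\<Sum>(i, j)\<in>{..<n} \<times> {..<m}. p i * q j) = (\<Sum>i<n. p i) * (\<Sum>j<m. q j)"
      by (simp add: sum_product sum.cartesian_product)
    then show "(\<Sum>(i, j)\<in>{..<n} \<times> {..<m}. p i * q j) = 1" using p q by simp
  next
    fix v1 w1 v3 w3 assume v: "v1 \<in> V1" "w1 \<in> W1" "v3 \<in> V3" "w3 \<in> W3"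
    let ?\<phi> = "\<lambda>i v2. entry (\<Phi> i) v1 v2" and ?\<psi> = "\<lambda>i w2. entry (\<Psi> i) w2 w1"
    let ?\<theta> = "\<lambda>j v2. entry (\<Theta> j) v2 v3" and ?\<xi> = "\<lambda>j w2. entry (\<Xi> j) w3 w2"
    let ?P = "\<lambda>i. complex_of_real (p i)" and ?Q = "\<lambda>j. complex_of_real (q j)"
    have "entry (comp_corr V1 W1 V2 W2 V3 W3 \<Gamma> \<Delta>) (v1, w3) (v3, w1) =
      (\<Sum>v2\<in>V2. \<Sum>w2\<in>W2. (\<Sum>i<n. ?P i * (?\<phi> i v2 * ?\<psi> i w2)) * (\<Sum>j<m. ?Q j * (?\<theta> j v2 * ?\<xi> j w2)))"
      unfolding entry_comp_corr[OF fin v]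
      using v by (intro sum.cong refl) (simp add: loc_entry[OF G] loc_entry[OF D])
    also have "\<dots> = (\<Sum>v2\<in>V2. \<Sum>w2\<in>W2. \<Sum>i<n. \<Sum>j<m.
        (?P i * (?\<phi> i v2 * ?\<psi> i w2)) * (?Q j * (?\<theta> j v2 * ?\<xi> j w2)))"
      by (simp only: sum_product)
    also have "\<dots> = (\<Sum>i<n. \<Sum>j<m. \<Sum>v2\<in>V2. \<Sum>w2\<in>W2.
        (?P i * (?\<phi> i v2 * ?\<psi> i w2)) * (?Q j * (?\<theta> j v2 * ?\<xi> j w2)))"
      by (rule sum4_swap)
    also have "\<dots> = (\<Sum>i<n. \<Sum>j<m. ?P i * ?Q j *
        ((\<Sum>v2\<in>V2. ?\<phi> i v2 * ?\<theta> j v2) * (\<Sum>w2\<in>W2. ?\<xi> j w2 * ?\<psi> i w2)))"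
      unfolding sum_product unfolding sum_distrib_left
      by (intro sum.cong refl) (simp only: mult_ac)
    also have "\<dots> = (\<Sum>i<n. \<Sum>j<m. ?P i * ?Q j *
        (entry (\<lambda>A. \<Phi> i (\<Theta> j A)) v1 v3 * entry (\<lambda>B. \<Xi> j (\<Psi> i B)) w3 w1))"
      using ch1 ch2 v fin
      by (intro sum.cong refl) (simp add: entry_compose[where V = V2 and U = V3 and W = V1]
        entry_compose[where V = W2 and U = W1 and W = W3])
    finally show "entry (comp_corr V1 W1 V2 W2 V3 W3 \<Gamma> \<Delta>) (v1, w3) (v3, w1) =
      (\<Sum>i\<in>{..<n} \<times> {..<m}. complex_of_real (case i of (i, j) \<Rightarrow> p i * q j) *
        (entry (case i of (i, j) \<Rightarrow> \<lambda>A. \<Phi> i (\<Theta> j A)) v1 v3 *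
         entry (case i of (i, j) \<Rightarrow> \<lambda>B. \<Xi> j (\<Psi> i B)) w3 w1))"
      by (simp add: sum.cartesian_product case_prod_beta')
  qed (use fin in auto)
qed

lemma corr_comp:
  assumes c: "(UNIV :: complex set) \<lesssim> (UNIV :: 'h set)"
    and fin: "finite V1" "finite V2" "finite V3" "finite W1" "finite W2" "finite W3"
    and ne: "t = Ns \<Longrightarrow> V2 \<noteq> {} \<or> W2 \<noteq> {}"
    and "corr_of_type TYPE('h) t V2 W1 V1 W2 \<Gamma>" "corr_of_type TYPE('h) t V3 W2 V2 W3 \<Delta>"
  shows "corr_of_type TYPE('h) t V3 W1 V1 W3 (comp_corr V1 W1 V2 W2 V3 W3 \<Gamma> \<Delta>)"
  using assms by (cases t) (auto intro: loc_comp q_comp qa_comp qc_comp ns_comp)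

section \<open>The identity correlation\<close>

lemma entry_id: "entry (\<lambda>A. A) x v = (if x = v then 1 else 0)"
  by (simp add: entry_def diag_unit_def)

lemma ns_id:
  fixes V :: "'v set" and W :: "'w set"
  assumes "finite V" "finite W"
  shows "ns_corr V W V W (\<lambda>A. A)"
proof -
  have "(\<Sum>w2\<in>W. entry (\<lambda>A. A) (v1, w2) (v2, w1)) = (if v1 = v2 then 1 else 0)" if "w1 \<in> W" for v1 v2 :: 'v and w1
    using that assms by (simp add: entry_id)
  moreover have "(\<Sum>v1\<in>V. entry (\<lambda>A. A) (v1, w2) (v2, w1)) = (if w2 = w1 then 1 else 0)" if "v2 \<in> V" for w2 w1 :: 'w and v2
    using that assms by (simp add: entry_id)
  ultimately show ?thesis by (auto simp: ns_corr_def channel_def)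
qed

lemma povm_indicator:
  assumes "finite V" "v \<in> V"
  shows "povm (ell2 I) V (\<lambda>u x. if u = v then x else (\<lambda>i. 0))"
proof (rule povm_ell2I[OF assms(1)])
  interpret hilbert_space "ell2 I" by (rule hilbert_ell2)
  have id: "bounded_op (ell2 I) (\<lambda>x. x)" by (auto simp: bounded_op_def intro!: exI[of _ 1])
  have "positive_op (ell2 I) (\<lambda>x. x)" using id ip_nonneg by (simp add: positive_op_def)
  then show "positive_op (ell2 I) (\<lambda>x. if u = v then x else (\<lambda>i. 0))" for u
    using positive_op_zero by (cases "u = v") auto
  show "(\<Sum>u\<in>V. (if u = v then x else (\<lambda>i. 0)) k) = x k" for x k
  proof -
    have "(\<Sum>u\<in>V. (if u = v then x else (\<lambda>i. 0)) k) = (\<Sum>u\<in>V. if u = v then x k else 0)"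
      by (intro sum.cong) auto
    then show ?thesis using assms by simp
  qed
qed

text \<open>Answering with the question is a deterministic strategy: one-dimensional spaces carry
  it, with measurements that are the identity for the outcome equal to the setting and zero
  otherwise.\<close>

lemma q_id:
  assumes c: "(UNIV :: complex set) \<lesssim> (UNIV :: 'h set)" and fin: "finite V" "finite W"
  shows "q_corr TYPE('h) V W V W (\<lambda>A. A)"
proof (rule q_corr_from_ell2[OF c ns_id[OF fin]])
  let ?E = "\<lambda>v u x. if u = v then x else (\<lambda>i. 0)"
  have d: "delta ((), ()) \<in> L2 ({()} \<times> {()})" by (rule delta_mem) simp
  interpret hilbert_space "ell2 ({()} \<times> {()})" by (rule hilbert_ell2)
  have "ip (ell2 ({()} \<times> {()})) (delta ((), ())) (delta ((), ())) = 1"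
    by (simp only: ip_delta) (simp add: delta_def)
  moreover have "ip (ell2 ({()} \<times> {()})) (\<lambda>i. 0) (delta ((), ())) = 0" by (simp add: ip_ell2)
  ultimately have "qc_model V W V W (\<lambda>A. A) (ell2 ({()} \<times> {()})) (delta ((), ())) ?E ?E"
    using fin d by (auto simp: qc_model_def hilbert_ell2 povm_indicator ipnorm_def entry_id)
  then show "q_ell2 V W V W (\<lambda>A. A) {()} {()} id"
    unfolding q_ell2_def using fin
    by (intro conjI exI[of _ "delta ((), ())"] exI[of _ ?E])
      (auto simp: povm_indicator ten_def)
qed

lemma loc_id:
  assumes "finite V" "finite W"
  shows "loc_corr V W V W (\<lambda>A. A)"
proof (rule loc_corrI[where S = "{()}" and p = "\<lambda>_. 1" and \<Phi> = "\<lambda>_ A. A" and \<Psi> = "\<lambda>_ A. A"])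
  show "ns_corr V W V W (\<lambda>A. A)" by (rule ns_id[OF assms])
qed (use assms in \<open>auto simp: channel_def entry_id\<close>)

lemma corr_id:
  assumes c: "(UNIV :: complex set) \<lesssim> (UNIV :: 'h set)" and fin: "finite V" "finite W"
  shows "corr_of_type TYPE('h) t V W V W (\<lambda>A. A)"
proof -
  have q: "q_corr TYPE('h) V W V W (\<lambda>A. A)" using assms by (rule q_id)
  then have "qc_corr TYPE('h) V W V W (\<lambda>A. A)" unfolding q_corr_def qc_corr_def by blast
  moreover have "qa_corr TYPE('h) V W V W (\<lambda>A. A)"
    unfolding qa_corr_def using ns_id[OF fin] q by (intro conjI exI[of _ "\<lambda>_ A. A"]) auto
  ultimately show ?thesis using q loc_id[OF fin] ns_id[OF fin] by (cases t) auto
qed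

theorem theorem3p3:
  fixes t :: corr_type
  assumes "(UNIV :: complex set) \<lesssim> (UNIV :: 'h set)"
  shows "preorder_on (hypergraphs t :: ('v, 'w) hypergraph set)
    {(G1, G2). G1 \<in> hypergraphs t \<and> G2 \<in> hypergraphs t \<and> leads_to TYPE('h) t G1 G2}"
proof -
  have refl: "leads_to TYPE('h) t G G" if "G \<in> hypergraphs t" for G :: "('v, 'w) hypergraph"
    unfolding leads_to_def
  proof (intro exI conjI)
    show "corr_of_type TYPE('h) t (left G) (right G) (left G) (right G) (\<lambda>A. A)"
      using that by (intro corr_id[OF assms]) (auto simp: hypergraphs_def is_hypergraph_def)
  qed (auto simp: entry_id split: if_splits)
  have trans: "leads_to TYPE('h) t G1 G3"
    if G: "G1 \<in> hypergraphs t" "G2 \<in> hypergraphs t" "G3 \<in> hypergraphs t"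
      and l12: "leads_to TYPE('h) t G1 G2" and l23: "leads_to TYPE('h) t G2 G3"
    for G1 G2 G3 :: "('v, 'w) hypergraph"
  proof -
    have fin: "finite (left G1)" "finite (left G2)" "finite (left G3)"
      "finite (right G1)" "finite (right G2)" "finite (right G3)"
      and ne: "t = Ns \<Longrightarrow> left G2 \<noteq> {} \<or> right G2 \<noteq> {}"
      using G by (auto simp: hypergraphs_def is_hypergraph_def)
    obtain \<Gamma> where \<Gamma>: "corr_of_type TYPE('h) t (left G2) (right G1) (left G1) (right G2) \<Gamma>"
      "\<And>v1 w2 v2 w1. \<lbrakk>v1 \<in> left G1; w2 \<in> right G2; v2 \<in> left G2; w1 \<in> right G1;
        entry \<Gamma> (v1, w2) (v2, w1) \<noteq> 0; (v1, w1) \<in> edges G1\<rbrakk> \<Longrightarrow> (v2, w2) \<in> edges G2"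
      using l12 unfolding leads_to_def by blast
    obtain \<Delta> where \<Delta>: "corr_of_type TYPE('h) t (left G3) (right G2) (left G2) (right G3) \<Delta>"
      "\<And>v2 w3 v3 w2. \<lbrakk>v2 \<in> left G2; w3 \<in> right G3; v3 \<in> left G3; w2 \<in> right G2;
        entry \<Delta> (v2, w3) (v3, w2) \<noteq> 0; (v2, w2) \<in> edges G2\<rbrakk> \<Longrightarrow> (v3, w3) \<in> edges G3"
      using l23 unfolding leads_to_def by blast
    let ?C = "comp_corr (left G1) (right G1) (left G2) (right G2) (left G3) (right G3) \<Gamma> \<Delta>"
    have "(v3, w3) \<in> edges G3"
      if v: "v1 \<in> left G1" "w1 \<in> right G1" "v3 \<in> left G3" "w3 \<in> right G3"
        and nz: "entry ?C (v1, w3) (v3, w1) \<noteq> 0" and e: "(v1, w1) \<in> edges G1" for v1 w1 v3 w3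
    proof -
      \<comment> \<open>A nonzero sum has a nonzero summand. Its factor from \<Gamma> makes (v2, w2)
        an edge of the middle hypergraph, and its factor from \<Delta> carries this on to (v3,
        w3).\<close>
      obtain v2 w2 where "v2 \<in> left G2" "w2 \<in> right G2"
        "entry \<Gamma> (v1, w2) (v2, w1) * entry \<Delta> (v2, w3) (v3, w2) \<noteq> 0"
        using nz unfolding entry_comp_corr[OF fin v] by (meson sum.neutral)
      then show ?thesis using \<Gamma>(2) \<Delta>(2) v e by (metis mult_zero_left mult_zero_right)
    qed
    moreover have "corr_of_type TYPE('h) t (left G3) (right G1) (left G1) (right G3) ?C"
      by (rule corr_comp[OF assms fin ne \<Gamma>(1) \<Delta>(1)])
    ultimately show ?thesis unfolding leads_to_def by blast
  qed
  show ?thesis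
    unfolding preorder_on_def refl_on_def trans_def using refl trans by blast
qed

end
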